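(* (i) $\mathrm{p\text{-}TC}$ is an invariant of the proper homotopy type: if $X$ and $Y$ are properly homotopy equivalent then $\mathrm{p\text{-}TC}(X)=\mathrm{p\text{-}TC}(Y)$. (ii) $\mathrm{TC}(X)\le \mathrm{p\text{-}TC}(X)$ for any space $X$, and equality holds if $X$ is compact. (iii) If $X$ has the proper homotopy type of $\mathbb R_+$, then $\mathrm{p\text{-}TC}(X)=0$. The converse also holds for any $X\in\mathbf P_\infty$. (iv) For any $X\in\mathbf P_\infty$ and any ray $\alpha$ of $X$, $$\mathrm{p\text{-}cat}_\alpha(X)\le \mathrm{p\text{-}TC}(X)\le 2\,\mathrm{p\text{-}cat}_\alpha(X).$$ (v) For any space $X$ and the exterior diagonal $\Delta_X\colon X_{cc}\to X_{cc}\times X_{cc}$, $$\operatorname{nil}\ker H^*_{\mathcal E}(\Delta_X)\le \mathrm{p\text{-}TC}(X).$$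
   Context: All spaces are assumed metrizable. $I=[0,1]$, $\mathbb R_+=[0,\infty)$. A proper map is a continuous map for which preimages of compact sets are compact; a proper homotopy is a homotopy $X\times I\to Y$ that is a proper map. $\mathbf P_\infty$ is the class (full subcategory of spaces and proper maps) of Hausdorff, non compact, $\sigma$-compact, locally compact spaces. A ray of $X$ is a proper map $\mathbb R_+\to X$. $\mathrm{TC}(X)$ is the (reduced) topological complexity: the least $n$ (or $\infty$) such that $X\times X$ is covered by $n+1$ open sets with continuous local sections of $q\colon X^I\to X\times X$, $q(\gamma)=(\gamma(0),\gamma(1))$. $\mathrm{p\text{-}TC}(X)$ is the least $n$ (or $\infty$) such that $X\times X$ is covered by $n+1$ open sets $U_0,\dots,U_n$ with continuous local sections $\sigma_i\colon U_i\to X^I$ of $q$ such that: every compact $K\subseteq X$ is contained in a compact $L\subseteq X$ with $\operatorname{Im}\sigma_i(x,y)\subseteq X\setminus K$ for all $(x,y)\in U_i\cap\bigl((X\setminus L)\times (X\setminus L)\bigr)$. For $X\in\mathbf P_\infty$ with ray $\alpha$, $\mathrm{p\text{-}cat}_\alpha(X)$ is the least $n$ (or $\infty$) such that $X$ has an open cover $\{U_0,\dots,U_n\}$ for which, for each $i$, there is a proper map $r\colon\overline U_i\to\mathbb R_+$ with $\alpha\circ r$ properly homotopic to the inclusion $\overline U_i\hookrightarrow X$. Exterior spaces (for (v)). An exterior space is a space $(X,\tau)$ with a nonempty family $\mathcal E\subseteq\tau$ of exterior sets closed under finite intersections and under passing to larger open sets. Exterior maps are continuous maps for which preimages of exterior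 sets are exterior. $X_{cc}$ is $X$ with the cocompact externology, formed by the complements of closed compact subspaces. A product of exterior spaces carries the externology of open sets containing a product of exterior sets. Exterior cohomology. Let $H^*$ be an ES-theory with coefficients in an arbitrary ring $R$: a contravariant functor from pairs of spaces to non-negatively graded $R$-modules satisfying exactness, excision, homotopy invariance and continuity (for closed $A$, $H^*(A)$ is the direct limit of $H^*(N)$ over neighbourhoods $N$ of $A$), and equipped with cross products. The exterior cohomology of an exterior pair is $H^*_{\mathcal E}(X,A)=\varinjlim\{H^*(X,E): E \text{ exterior neighbourhood of } A\}$, and $H^*_{\mathcal E}(X)=H^*_{\mathcal E}(X,\emptyset)$, the limit being over all exterior sets $E$. The cup product on $H^*_{\mathcal E}(X)$ is the cross product followed by the map induced by the diagonal $X\to X\times X$. For an exterior map $f$, $\operatorname{nil}\ker H^*_{\mathcal E}(f)$ is the largest $k$ such that there are $k$ classes in $\ker H^*_{\mathcal E}(f)$ with non-zero cup product. Item (v) holds for any such choice of $H^*$. *)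

theory Defs
  imports "HOL-Analysis.Analysis" "HOL-Algebra.Module" "HOL-Algebra.AbelCoset"
    "HOL-Library.Extended_Nat"
begin

section \<open>The proper category\<close>

text \<open>The library constant \<^const>\<open>Abstract_Topology.proper_map\<close> (closed map with compact fibres)
  does not include continuity; here a proper map is a continuous map with compact preimages of
  compact sets.\<close>

definition proper_cmap :: "'a topology \<Rightarrow> 'b topology \<Rightarrow> ('a \<Rightarrow> 'b) \<Rightarrow> bool" where
  "proper_cmap X Y f \<longleftrightarrow> continuous_map X Y f \<and>
     (\<forall>K. compactin Y K \<longrightarrow> compactin X {x \<in> topspace X. f x \<in> K})"

definition properly_homotopic ::
    "'a topology \<Rightarrow> 'b topology \<Rightarrow> ('a \<Rightarrow> 'b) \<Rightarrow> ('a \<Rightarrow> 'b) \<Rightarrow> bool" where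
  "properly_homotopic X Y f g \<longleftrightarrow>
     (\<exists>h. proper_cmap (prod_topology X (top_of_set {0..1::real})) Y h \<and>
          (\<forall>x \<in> topspace X. h (x, 0) = f x \<and> h (x, 1) = g x))"

definition properly_homotopy_equivalent :: "'a topology \<Rightarrow> 'b topology \<Rightarrow> bool" where
  "properly_homotopy_equivalent X Y \<longleftrightarrow>
     (\<exists>f g. proper_cmap X Y f \<and> proper_cmap Y X g \<and>
        properly_homotopic X X (g \<circ> f) id \<and> properly_homotopic Y Y (f \<circ> g) id)"

definition sigma_compact_space :: "'a topology \<Rightarrow> bool" where
  "sigma_compact_space X \<longleftrightarrow>
     (\<exists>\<K>. countable \<K> \<and> (\<forall>K \<in> \<K>. compactin X K) \<and> \<Union>\<K> = topspace X)"

definition P_infinity :: "'a topology \<Rightarrow> bool" where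
  "P_infinity X \<longleftrightarrow> Hausdorff_space X \<and> \<not> compact_space X \<and>
     sigma_compact_space X \<and> locally_compact_space X"

abbreviation halfline :: "real topology" where
  "halfline \<equiv> top_of_set {0..}"

definition ray :: "'a topology \<Rightarrow> (real \<Rightarrow> 'a) \<Rightarrow> bool" where
  "ray X \<alpha> \<longleftrightarrow> proper_cmap halfline X \<alpha>"


section \<open>Topological complexity and its proper version\<close>

text \<open>Paths are represented by functions that are \<^const>\<open>undefined\<close> outside the unit interval,
  so that every path has exactly one representative.\<close>

definition paths :: "'a topology \<Rightarrow> (real \<Rightarrow> 'a) set" where
  "paths X = {\<gamma> \<in> extensional {0..1}. pathin X \<gamma>}"

text \<open>The compact-open topology. The carrier itself belongs to the subbasis
  (take \<open>K = {}\<close>), so \<^const>\<open>topology_generated_by\<close> yields a topology on all paths.\<close>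

definition path_space :: "'a topology \<Rightarrow> (real \<Rightarrow> 'a) topology" where
  "path_space X = topology_generated_by
     {{\<gamma> \<in> paths X. \<gamma> ` K \<subseteq> V} | K V. compact K \<and> K \<subseteq> {0..1} \<and> openin X V}"

definition path_ends :: "(real \<Rightarrow> 'a) \<Rightarrow> 'a \<times> 'a" where
  "path_ends \<gamma> = (\<gamma> 0, \<gamma> 1)"

definition local_section ::
    "'a topology \<Rightarrow> ('a \<times> 'a) set \<Rightarrow> ('a \<times> 'a \<Rightarrow> real \<Rightarrow> 'a) \<Rightarrow> bool" where
  "local_section X U \<sigma> \<longleftrightarrow>
     continuous_map (subtopology (prod_topology X X) U) (path_space X) \<sigma> \<and>
     (\<forall>p \<in> U. path_ends (\<sigma> p) = p)"

definition proper_local_section ::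
    "'a topology \<Rightarrow> ('a \<times> 'a) set \<Rightarrow> ('a \<times> 'a \<Rightarrow> real \<Rightarrow> 'a) \<Rightarrow> bool" where
  "proper_local_section X U \<sigma> \<longleftrightarrow> local_section X U \<sigma> \<and>
     (\<forall>K. compactin X K \<longrightarrow>
        (\<exists>L. compactin X L \<and> K \<subseteq> L \<and>
           (\<forall>p \<in> U \<inter> ((topspace X - L) \<times> (topspace X - L)). \<sigma> p ` {0..1} \<subseteq> topspace X - K)))"

text \<open>The numerical invariants take values in \<^typ>\<open>enat\<close>, where the infimum of the empty set
  is \<open>\<infinity>\<close>.\<close>

definition TC :: "'a topology \<Rightarrow> enat" where
  "TC X = Inf {enat n | n. \<exists>U :: nat \<Rightarrow> ('a \<times> 'a) set.
     (\<Union>i\<le>n. U i) = topspace X \<times> topspace X \<and>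
     (\<forall>i\<le>n. openin (prod_topology X X) (U i) \<and> (\<exists>\<sigma>. local_section X (U i) \<sigma>))}"

definition p_TC :: "'a topology \<Rightarrow> enat" where
  "p_TC X = Inf {enat n | n. \<exists>U :: nat \<Rightarrow> ('a \<times> 'a) set.
     (\<Union>i\<le>n. U i) = topspace X \<times> topspace X \<and>
     (\<forall>i\<le>n. openin (prod_topology X X) (U i) \<and> (\<exists>\<sigma>. proper_local_section X (U i) \<sigma>))}"

definition p_cat :: "(real \<Rightarrow> 'a) \<Rightarrow> 'a topology \<Rightarrow> enat" where
  "p_cat \<alpha> X = Inf {enat n | n. \<exists>U :: nat \<Rightarrow> 'a set.
     (\<Union>i\<le>n. U i) = topspace X \<and>
     (\<forall>i\<le>n. openin X (U i) \<and>
        (\<exists>r. proper_cmap (subtopology X (X closure_of U i)) halfline r \<and>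
             properly_homotopic (subtopology X (X closure_of U i)) X (\<alpha> \<circ> r) id))}"


section \<open>A universe of spaces closed under products\<close>

text \<open>A cohomology theory has to be evaluated on a space \<open>X\<close> together with its iterated
  products, and these have different types in HOL. The points of all of them are therefore
  collected in one type: formal nested pairs of elements of \<open>'a\<close>.\<close>

datatype 'a pt = Pt (un_Pt: 'a) | Pr (pt1: "'a pt") (pt2: "'a pt")

text \<open>The homeomorphic copy of \<open>X\<close> in the universe.\<close>

definition lift_space :: "'a topology \<Rightarrow> 'a pt topology" where
  "lift_space X = pullback_topology (Pt ` topspace X) un_Pt X"

definition pt_times :: "'a pt set \<Rightarrow> 'a pt set \<Rightarrow> 'a pt set" where
  "pt_times A B = {Pr x y | x y. x \<in> A \<and> y \<in> B}"

definition prod_space :: "'a pt topology \<Rightarrow> 'a pt topology \<Rightarrow> 'a pt topology" where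
  "prod_space X Y = pullback_topology (pt_times (topspace X) (topspace Y))
     (\<lambda>p. (pt1 p, pt2 p)) (prod_topology X Y)"

definition pt_map_prod ::
    "('a pt \<Rightarrow> 'a pt) \<Rightarrow> ('a pt \<Rightarrow> 'a pt) \<Rightarrow> 'a pt \<Rightarrow> 'a pt" where
  "pt_map_prod f g p = Pr (f (pt1 p)) (g (pt2 p))"

definition diag :: "'a pt \<Rightarrow> 'a pt" where
  "diag x = Pr x x"

text \<open>The second component of the product of the pairs \<open>(X, A)\<close> and \<open>(Y, B)\<close>.\<close>

definition prod_sub ::
    "'a pt topology \<Rightarrow> 'a pt set \<Rightarrow> 'a pt topology \<Rightarrow> 'a pt set \<Rightarrow> 'a pt set" where
  "prod_sub X A Y B = pt_times A (topspace Y) \<union> pt_times (topspace X) B"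


section \<open>Exterior spaces\<close>

definition externology :: "'a topology \<Rightarrow> 'a set set \<Rightarrow> bool" where
  "externology X \<E> \<longleftrightarrow> \<E> \<noteq> {} \<and> (\<forall>E \<in> \<E>. openin X E) \<and>
     (\<forall>E \<in> \<E>. \<forall>E' \<in> \<E>. E \<inter> E' \<in> \<E>) \<and>
     (\<forall>E \<in> \<E>. \<forall>W. openin X W \<and> E \<subseteq> W \<longrightarrow> W \<in> \<E>)"

definition exterior_map ::
    "'a topology \<Rightarrow> 'a set set \<Rightarrow> 'b topology \<Rightarrow> 'b set set \<Rightarrow> ('a \<Rightarrow> 'b) \<Rightarrow> bool" where
  "exterior_map X \<E> Y \<F> f \<longleftrightarrow> continuous_map X Y f \<and>
     (\<forall>F \<in> \<F>. {x \<in> topspace X. f x \<in> F} \<in> \<E>)"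

definition cocompact :: "'a topology \<Rightarrow> 'a set set" where
  "cocompact X = {topspace X - K | K. closedin X K \<and> compactin X K}"

definition prod_ext ::
    "'a pt topology \<Rightarrow> 'a pt set set \<Rightarrow> 'a pt topology \<Rightarrow> 'a pt set set \<Rightarrow> 'a pt set set" where
  "prod_ext X \<E> Y \<F> = {W. openin (prod_space X Y) W \<and> (\<exists>E \<in> \<E>. \<exists>F \<in> \<F>. pt_times E F \<subseteq> W)}"


section \<open>Modules and direct limits\<close>

text \<open>The library locale \<^locale>\<open>module\<close> requires a commutative ring. The following is the same
  list of axioms over an arbitrary ring. The fields \<^const>\<open>mult\<close> and \<^const>\<open>one\<close> of a record of
  type \<^type>\<open>module\<close> play no role.\<close>

locale left_module = R?: ring R + M?: abelian_group M for R (structure) and M (structure) +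
  assumes smult_closed:
      "\<lbrakk>r \<in> carrier R; x \<in> carrier M\<rbrakk> \<Longrightarrow> r \<odot>\<^bsub>M\<^esub> x \<in> carrier M"
    and smult_l_distr:
      "\<lbrakk>r \<in> carrier R; s \<in> carrier R; x \<in> carrier M\<rbrakk> \<Longrightarrow>
        (r \<oplus>\<^bsub>R\<^esub> s) \<odot>\<^bsub>M\<^esub> x = r \<odot>\<^bsub>M\<^esub> x \<oplus>\<^bsub>M\<^esub> s \<odot>\<^bsub>M\<^esub> x"
    and smult_r_distr:
      "\<lbrakk>r \<in> carrier R; x \<in> carrier M; y \<in> carrier M\<rbrakk> \<Longrightarrow>
        r \<odot>\<^bsub>M\<^esub> (x \<oplus>\<^bsub>M\<^esub> y) = r \<odot>\<^bsub>M\<^esub> x \<oplus>\<^bsub>M\<^esub> r \<odot>\<^bsub>M\<^esub> y"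
    and smult_assoc1:
      "\<lbrakk>r \<in> carrier R; s \<in> carrier R; x \<in> carrier M\<rbrakk> \<Longrightarrow>
        (r \<otimes>\<^bsub>R\<^esub> s) \<odot>\<^bsub>M\<^esub> x = r \<odot>\<^bsub>M\<^esub> (s \<odot>\<^bsub>M\<^esub> x)"
    and smult_one: "x \<in> carrier M \<Longrightarrow> \<one>\<^bsub>R\<^esub> \<odot>\<^bsub>M\<^esub> x = x"

definition linear_map ::
    "'r ring \<Rightarrow> ('r, 'b) module \<Rightarrow> ('r, 'c) module \<Rightarrow> ('b \<Rightarrow> 'c) \<Rightarrow> bool" where
  "linear_map R M N h \<longleftrightarrow> h \<in> carrier M \<rightarrow> carrier N \<and>
     (\<forall>x \<in> carrier M. \<forall>y \<in> carrier M. h (x \<oplus>\<^bsub>M\<^esub> y) = h x \<oplus>\<^bsub>N\<^esub> h y) \<and>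
     (\<forall>r \<in> carrier R. \<forall>x \<in> carrier M. h (r \<odot>\<^bsub>M\<^esub> x) = r \<odot>\<^bsub>N\<^esub> h x)"

text \<open>Direct limit of a system of modules \<open>M E\<close> indexed by a family \<open>\<I>\<close> of sets that is directed
  by reverse inclusion; \<open>\<phi> E E' : M E \<rightarrow> M E'\<close> is the transition map for \<open>E' \<subseteq> E\<close>.\<close>

definition dl_rel :: "'i set set \<Rightarrow> ('i set \<Rightarrow> ('r, 'c) module) \<Rightarrow>
    ('i set \<Rightarrow> 'i set \<Rightarrow> 'c \<Rightarrow> 'c) \<Rightarrow> (('i set \<times> 'c) \<times> ('i set \<times> 'c)) set" where
  "dl_rel \<I> M \<phi> = {((E, a), (E', a')). E \<in> \<I> \<and> a \<in> carrier (M E) \<and> E' \<in> \<I> \<and> a' \<in> carrier (M E') \<and>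
     (\<exists>F \<in> \<I>. F \<subseteq> E \<and> F \<subseteq> E' \<and> \<phi> E F a = \<phi> E' F a')}"

definition dl_class :: "'i set set \<Rightarrow> ('i set \<Rightarrow> ('r, 'c) module) \<Rightarrow>
    ('i set \<Rightarrow> 'i set \<Rightarrow> 'c \<Rightarrow> 'c) \<Rightarrow> 'i set \<Rightarrow> 'c \<Rightarrow> ('i set \<times> 'c) set" where
  "dl_class \<I> M \<phi> E a = dl_rel \<I> M \<phi> `` {(E, a)}"

definition direct_limit :: "'i set set \<Rightarrow> ('i set \<Rightarrow> ('r, 'c) module) \<Rightarrow>
    ('i set \<Rightarrow> 'i set \<Rightarrow> 'c \<Rightarrow> 'c) \<Rightarrow> ('r, ('i set \<times> 'c) set) module" where
  "direct_limit \<I> M \<phi> =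
     \<lparr>carrier = (SIGMA E:\<I>. carrier (M E)) // dl_rel \<I> M \<phi>,
      mult = undefined,
      one = undefined,
      zero = (\<Union>E \<in> \<I>. dl_class \<I> M \<phi> E \<zero>\<^bsub>M E\<^esub>),
      add = (\<lambda>C D. \<Union>(E, a) \<in> C. \<Union>(E', b) \<in> D. \<Union>F \<in> {F \<in> \<I>. F \<subseteq> E \<and> F \<subseteq> E'}.
               dl_class \<I> M \<phi> F (\<phi> E F a \<oplus>\<^bsub>M F\<^esub> \<phi> E' F b)),
      smult = (\<lambda>r C. \<Union>(E, a) \<in> C. dl_class \<I> M \<phi> E (r \<odot>\<^bsub>M E\<^esub> a))\<rparr>"

text \<open>\<open>L\<close>, with the compatible maps \<open>\<psi> E : M E \<rightarrow> L\<close>, is the direct limit.\<close>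

definition is_direct_limit :: "'i set set \<Rightarrow> ('i set \<Rightarrow> ('r, 'c) module) \<Rightarrow>
    ('i set \<Rightarrow> 'i set \<Rightarrow> 'c \<Rightarrow> 'c) \<Rightarrow> ('r, 'd) module \<Rightarrow> ('i set \<Rightarrow> 'c \<Rightarrow> 'd) \<Rightarrow> bool" where
  "is_direct_limit \<I> M \<phi> L \<psi> \<longleftrightarrow>
     bij_betw (\<lambda>C. the_elem ((\<lambda>(E, a). \<psi> E a) ` C)) (carrier (direct_limit \<I> M \<phi>)) (carrier L)"


section \<open>ES-theories\<close>

text \<open>
  The data of a cohomology theory on pairs \<open>(X, A)\<close> of spaces in the universe:
  the coefficient ring, the modules \<open>H\<^sup>n(X, A)\<close>, the homomorphism
  \<open>H\<^sup>n(Y, B) \<rightarrow> H\<^sup>n(X, A)\<close> induced by a map \<open>(X, A) \<rightarrow> (Y, B)\<close> (\<open>ind T n X A Y B f\<close>),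
  the coboundary \<open>H\<^sup>n(A) \<rightarrow> H\<^sup>n\<^sup>+\<^sup>1(X, A)\<close> and the cross product
  \<open>H\<^sup>p(X, A) \<times> H\<^sup>q(Y, B) \<rightarrow> H\<^sup>p\<^sup>+\<^sup>q((X, A) \<times> (Y, B))\<close>.\<close>

record ('a, 'r, 'c) cohomology_data =
  coeffs :: "'r ring"
  coh :: "nat \<Rightarrow> 'a pt topology \<Rightarrow> 'a pt set \<Rightarrow> ('r, 'c) module"
  ind :: "nat \<Rightarrow> 'a pt topology \<Rightarrow> 'a pt set \<Rightarrow> 'a pt topology \<Rightarrow> 'a pt set \<Rightarrow>
            ('a pt \<Rightarrow> 'a pt) \<Rightarrow> 'c \<Rightarrow> 'c"
  cobd :: "nat \<Rightarrow> 'a pt topology \<Rightarrow> 'a pt set \<Rightarrow> 'c \<Rightarrow> 'c"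
  cross :: "nat \<Rightarrow> nat \<Rightarrow> 'a pt topology \<Rightarrow> 'a pt set \<Rightarrow> 'a pt topology \<Rightarrow> 'a pt set \<Rightarrow>
              'c \<Rightarrow> 'c \<Rightarrow> 'c"

definition space_pair :: "'a topology \<Rightarrow> 'a set \<Rightarrow> bool" where
  "space_pair X A \<longleftrightarrow> metrizable_space X \<and> A \<subseteq> topspace X"

definition pair_map ::
    "'a topology \<Rightarrow> 'a set \<Rightarrow> 'b topology \<Rightarrow> 'b set \<Rightarrow> ('a \<Rightarrow> 'b) \<Rightarrow> bool" where
  "pair_map X A Y B f \<longleftrightarrow>
     space_pair X A \<and> space_pair Y B \<and> continuous_map X Y f \<and> f ` A \<subseteq> B"

definition neighbourhoods :: "'a topology \<Rightarrow> 'a set \<Rightarrow> 'a set set" where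
  "neighbourhoods X A = {N. N \<subseteq> topspace X \<and> A \<subseteq> X interior_of N}"

text \<open>
  Grading by \<^typ>\<open>nat\<close> means \<open>H\<^sup>n = 0\<close> for \<open>n < 0\<close>, so exactness includes injectivity of
  \<open>H\<^sup>0(X, A) \<rightarrow> H\<^sup>0(X)\<close> (\<open>exact_0\<close>).

  Cross products are only required for pairs with open second component, the case needed for
  exterior sets: for general pairs they do not exist even in Alexander-Spanier cohomology.
  They are natural and biadditive. Over a non-commutative ring of coefficients the product of
  left modules is linear in its first argument only (there is no right module structure to
  express that it is balanced); over a commutative ring it is bilinear.\<close>

locale ES_theory =
  fixes T :: "('a, 'r, 'c) cohomology_data"
  assumes coeffs_ring: "ring (coeffs T)"
    and coh_module:
      "space_pair X A \<Longrightarrow> left_module (coeffs T) (coh T n X A)"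
    and ind_linear:
      "pair_map X A Y B f \<Longrightarrow> linear_map (coeffs T) (coh T n Y B) (coh T n X A) (ind T n X A Y B f)"
    and ind_cong:
      "\<lbrakk>pair_map X A Y B f; \<And>x. x \<in> topspace X \<Longrightarrow> f x = g x; a \<in> carrier (coh T n Y B)\<rbrakk> \<Longrightarrow>
        ind T n X A Y B f a = ind T n X A Y B g a"
    and ind_id:
      "\<lbrakk>space_pair X A; a \<in> carrier (coh T n X A)\<rbrakk> \<Longrightarrow> ind T n X A X A id a = a"
    and ind_comp:
      "\<lbrakk>pair_map X A Y B f; pair_map Y B Z C g; a \<in> carrier (coh T n Z C)\<rbrakk> \<Longrightarrow>
        ind T n X A Z C (g \<circ> f) a = ind T n X A Y B f (ind T n Y B Z C g a)"
    and homotopy_invariance: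
      "\<lbrakk>space_pair X A; space_pair Y B; homotopic_with (\<lambda>h. h ` A \<subseteq> B) X Y f g;
        a \<in> carrier (coh T n Y B)\<rbrakk> \<Longrightarrow>
        ind T n X A Y B f a = ind T n X A Y B g a"
    and cobd_linear:
      "space_pair X A \<Longrightarrow>
        linear_map (coeffs T) (coh T n (subtopology X A) {}) (coh T (Suc n) X A) (cobd T n X A)"
    and cobd_natural:
      "\<lbrakk>pair_map X A Y B f; a \<in> carrier (coh T n (subtopology Y B) {})\<rbrakk> \<Longrightarrow>
        cobd T n X A (ind T n (subtopology X A) {} (subtopology Y B) {} f a) =
        ind T (Suc n) X A Y B f (cobd T n Y B a)"
    and exact_0:
      "space_pair X A \<Longrightarrow> inj_on (ind T 0 X {} X A id) (carrier (coh T 0 X A))"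
    and exact_X:
      "space_pair X A \<Longrightarrow>
        ind T n X {} X A id ` carrier (coh T n X A) =
        a_kernel (coh T n X {}) (coh T n (subtopology X A) {}) (ind T n (subtopology X A) {} X {} id)"
    and exact_A:
      "space_pair X A \<Longrightarrow>
        ind T n (subtopology X A) {} X {} id ` carrier (coh T n X {}) =
        a_kernel (coh T n (subtopology X A) {}) (coh T (Suc n) X A) (cobd T n X A)"
    and exact_XA:
      "space_pair X A \<Longrightarrow>
        cobd T n X A ` carrier (coh T n (subtopology X A) {}) =
        a_kernel (coh T (Suc n) X A) (coh T (Suc n) X {}) (ind T (Suc n) X {} X A id)"
    and excision:
      "\<lbrakk>space_pair X A; openin X S; X closure_of S \<subseteq> X interior_of A\<rbrakk> \<Longrightarrow>
        bij_betw (ind T n (subtopology X (topspace X - S)) (A - S) X A id)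
          (carrier (coh T n X A)) (carrier (coh T n (subtopology X (topspace X - S)) (A - S)))"
    and continuity:
      "\<lbrakk>metrizable_space X; closedin X A\<rbrakk> \<Longrightarrow>
        is_direct_limit (neighbourhoods X A)
          (\<lambda>N. coh T n (subtopology X N) {})
          (\<lambda>N N'. ind T n (subtopology X N') {} (subtopology X N) {} id)
          (coh T n (subtopology X A) {})
          (\<lambda>N. ind T n (subtopology X A) {} (subtopology X N) {} id)"
    and cross_closed:
      "\<lbrakk>metrizable_space X; openin X A; metrizable_space Y; openin Y B;
        a \<in> carrier (coh T p X A); b \<in> carrier (coh T q Y B)\<rbrakk> \<Longrightarrow>
        cross T p q X A Y B a b \<in> carrier (coh T (p + q) (prod_space X Y) (prod_sub X A Y B))"
    and cross_add_left:
      "\<lbrakk>metrizable_space X; openin X A; metrizable_space Y; openin Y B;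
        a \<in> carrier (coh T p X A); a' \<in> carrier (coh T p X A); b \<in> carrier (coh T q Y B)\<rbrakk> \<Longrightarrow>
        cross T p q X A Y B (a \<oplus>\<^bsub>coh T p X A\<^esub> a') b =
        cross T p q X A Y B a b
          \<oplus>\<^bsub>coh T (p + q) (prod_space X Y) (prod_sub X A Y B)\<^esub> cross T p q X A Y B a' b"
    and cross_add_right:
      "\<lbrakk>metrizable_space X; openin X A; metrizable_space Y; openin Y B;
        a \<in> carrier (coh T p X A); b \<in> carrier (coh T q Y B); b' \<in> carrier (coh T q Y B)\<rbrakk> \<Longrightarrow>
        cross T p q X A Y B a (b \<oplus>\<^bsub>coh T q Y B\<^esub> b') =
        cross T p q X A Y B a b
          \<oplus>\<^bsub>coh T (p + q) (prod_space X Y) (prod_sub X A Y B)\<^esub> cross T p q X A Y B a b'"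
    and cross_smult_left:
      "\<lbrakk>metrizable_space X; openin X A; metrizable_space Y; openin Y B; r \<in> carrier (coeffs T);
        a \<in> carrier (coh T p X A); b \<in> carrier (coh T q Y B)\<rbrakk> \<Longrightarrow>
        cross T p q X A Y B (r \<odot>\<^bsub>coh T p X A\<^esub> a) b =
        r \<odot>\<^bsub>coh T (p + q) (prod_space X Y) (prod_sub X A Y B)\<^esub> cross T p q X A Y B a b"
    and cross_smult_right:
      "\<lbrakk>cring (coeffs T);
        metrizable_space X; openin X A; metrizable_space Y; openin Y B; r \<in> carrier (coeffs T);
        a \<in> carrier (coh T p X A); b \<in> carrier (coh T q Y B)\<rbrakk> \<Longrightarrow>
        cross T p q X A Y B a (r \<odot>\<^bsub>coh T q Y B\<^esub> b) =
        r \<odot>\<^bsub>coh T (p + q) (prod_space X Y) (prod_sub X A Y B)\<^esub> cross T p q X A Y B a b"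
    and cross_natural:
      "\<lbrakk>pair_map X A X' A' f; openin X A; openin X' A';
        pair_map Y B Y' B' g; openin Y B; openin Y' B';
        a \<in> carrier (coh T p X' A'); b \<in> carrier (coh T q Y' B')\<rbrakk> \<Longrightarrow>
        cross T p q X A Y B (ind T p X A X' A' f a) (ind T q Y B Y' B' g b) =
        ind T (p + q) (prod_space X Y) (prod_sub X A Y B) (prod_space X' Y') (prod_sub X' A' Y' B')
          (pt_map_prod f g) (cross T p q X' A' Y' B' a b)"


section \<open>Exterior cohomology\<close>

definition ext_nbhds :: "'a set set \<Rightarrow> 'a set \<Rightarrow> 'a set set" where
  "ext_nbhds \<E> A = {E \<in> \<E>. A \<subseteq> E}"

definition ext_pair_coh :: "('a, 'r, 'c) cohomology_data \<Rightarrow> nat \<Rightarrow> 'a pt topology \<Rightarrow>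
    'a pt set set \<Rightarrow> 'a pt set \<Rightarrow> ('r, ('a pt set \<times> 'c) set) module" where
  "ext_pair_coh T n X \<E> A =
     direct_limit (ext_nbhds \<E> A) (\<lambda>E. coh T n X E) (\<lambda>E E'. ind T n X E' X E id)"

definition ext_coh :: "('a, 'r, 'c) cohomology_data \<Rightarrow> nat \<Rightarrow> 'a pt topology \<Rightarrow>
    'a pt set set \<Rightarrow> ('r, ('a pt set \<times> 'c) set) module" where
  "ext_coh T n X \<E> = ext_pair_coh T n X \<E> {}"

text \<open>The class in \<open>H\<^sup>n\<^sub>\<E>(X)\<close> represented by \<open>a \<in> H\<^sup>n(X, E)\<close>.\<close>

definition ext_class :: "('a, 'r, 'c) cohomology_data \<Rightarrow> nat \<Rightarrow> 'a pt topology \<Rightarrow>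
    'a pt set set \<Rightarrow> 'a pt set \<Rightarrow> 'c \<Rightarrow> ('a pt set \<times> 'c) set" where
  "ext_class T n X \<E> E a =
     dl_class (ext_nbhds \<E> {}) (\<lambda>E. coh T n X E) (\<lambda>E E'. ind T n X E' X E id) E a"

text \<open>In the following two definitions all members of the union coincide: the operations do not
  depend on the representatives.\<close>

definition ext_ind :: "('a, 'r, 'c) cohomology_data \<Rightarrow> nat \<Rightarrow>
    'a pt topology \<Rightarrow> 'a pt set set \<Rightarrow> 'a pt topology \<Rightarrow> 'a pt set set \<Rightarrow> ('a pt \<Rightarrow> 'a pt) \<Rightarrow>
    ('a pt set \<times> 'c) set \<Rightarrow> ('a pt set \<times> 'c) set" where
  "ext_ind T n X \<E> Y \<F> f C = (\<Union>(F, a) \<in> C.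
     ext_class T n X \<E> {x \<in> topspace X. f x \<in> F} (ind T n X {x \<in> topspace X. f x \<in> F} Y F f a))"

definition ext_cross :: "('a, 'r, 'c) cohomology_data \<Rightarrow> nat \<Rightarrow> nat \<Rightarrow>
    'a pt topology \<Rightarrow> 'a pt set set \<Rightarrow> 'a pt topology \<Rightarrow> 'a pt set set \<Rightarrow>
    ('a pt set \<times> 'c) set \<Rightarrow> ('a pt set \<times> 'c) set \<Rightarrow> ('a pt set \<times> 'c) set" where
  "ext_cross T p q X \<E> Y \<F> C D = (\<Union>(E, a) \<in> C. \<Union>(F, b) \<in> D.
     ext_class T (p + q) (prod_space X Y) (prod_ext X \<E> Y \<F>) (prod_sub X E Y F)
       (cross T p q X E Y F a b))"

definition ext_cup :: "('a, 'r, 'c) cohomology_data \<Rightarrow> nat \<Rightarrow> nat \<Rightarrow>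
    'a pt topology \<Rightarrow> 'a pt set set \<Rightarrow>
    ('a pt set \<times> 'c) set \<Rightarrow> ('a pt set \<times> 'c) set \<Rightarrow> ('a pt set \<times> 'c) set" where
  "ext_cup T p q X \<E> C D =
     ext_ind T (p + q) X \<E> (prod_space X X) (prod_ext X \<E> X \<E>) diag (ext_cross T p q X \<E> X \<E> C D)"

text \<open>The graded module \<open>H\<^sup>*\<^sub>\<E>(X)\<close> is the direct sum of the \<open>H\<^sup>n\<^sub>\<E>(X)\<close>: its elements, not
  necessarily homogeneous, are finitely supported families.\<close>

definition total_ext_coh :: "('a, 'r, 'c) cohomology_data \<Rightarrow> 'a pt topology \<Rightarrow>
    'a pt set set \<Rightarrow> (nat \<Rightarrow> ('a pt set \<times> 'c) set) set" where
  "total_ext_coh T X \<E> = {u. (\<forall>n. u n \<in> carrier (ext_coh T n X \<E>)) \<and>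
                              finite {n. u n \<noteq> \<zero>\<^bsub>ext_coh T n X \<E>\<^esub>}}"

definition total_cup :: "('a, 'r, 'c) cohomology_data \<Rightarrow> 'a pt topology \<Rightarrow> 'a pt set set \<Rightarrow>
    (nat \<Rightarrow> ('a pt set \<times> 'c) set) \<Rightarrow> (nat \<Rightarrow> ('a pt set \<times> 'c) set) \<Rightarrow>
    nat \<Rightarrow> ('a pt set \<times> 'c) set" where
  "total_cup T X \<E> u v n =
     finsum (ext_coh T n X \<E>) (\<lambda>p. ext_cup T p (n - p) X \<E> (u p) (v (n - p))) {..n}"

definition ker_ext_ind :: "('a, 'r, 'c) cohomology_data \<Rightarrow>
    'a pt topology \<Rightarrow> 'a pt set set \<Rightarrow> 'a pt topology \<Rightarrow> 'a pt set set \<Rightarrow> ('a pt \<Rightarrow> 'a pt) \<Rightarrow>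
    (nat \<Rightarrow> ('a pt set \<times> 'c) set) set" where
  "ker_ext_ind T X \<E> Y \<F> f = {u \<in> total_ext_coh T Y \<F>.
     \<forall>n. ext_ind T n X \<E> Y \<F> f (u n) = \<zero>\<^bsub>ext_coh T n X \<E>\<^esub>}"

text \<open>The supremum over an empty set is \<open>0\<close>, and the supremum is \<open>\<infinity>\<close> if there are arbitrarily
  long non-zero products. The ring \<open>H\<^sup>*\<^sub>\<E>(Y)\<close> need not have a unit, so only products of at
  least one factor occur.\<close>

definition nil_ker :: "('a, 'r, 'c) cohomology_data \<Rightarrow>
    'a pt topology \<Rightarrow> 'a pt set set \<Rightarrow> 'a pt topology \<Rightarrow> 'a pt set set \<Rightarrow> ('a pt \<Rightarrow> 'a pt) \<Rightarrow>
    enat" where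
  "nil_ker T X \<E> Y \<F> f = Sup {enat (Suc (length us)) | u us.
     set (u # us) \<subseteq> ker_ext_ind T X \<E> Y \<F> f \<and>
     (\<exists>n. foldl (total_cup T Y \<F>) u us n \<noteq> \<zero>\<^bsub>ext_coh T n Y \<F>\<^esub>)}"

end

(*
  A section over U is a homotopy from the first to the second projection of U, so sections and
  proper homotopies can be concatenated and pulled back; this gives (i) and (iii), and it
  turns a proper nullhomotopy along a ray over each of U_i and U_j into a section over the product
  of U_i and U_j. The (n+1)^2 products are merged into 2n+1 sets by comparing the sizes of bump
  functions. In the other direction, if r is a proper function on X, then restricting a section to
  the pairs (alpha (r x), x) contracts X properly to the ray.

  If pTC X = 0, then the paths between consecutive points of a sequence that tends to infinity form
  a ray, and X contracts to it.

  For (v), a class in the kernel of the diagonal vanishes on each U_i, hence comes from a class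
  relative to an exterior neighbourhood of U_i. A product of n+1 of them comes from a class relative
  to the union of the U_i, which is the whole of the product of X with itself.
*)
theory Submission
  imports Defs
begin

text \<open>A section is controlled near infinity only over pairs whose two points are both far out;
  when one of them stays near a compact set, nothing bounds the path. So a section over an open set
  is not a proper homotopy, and properness has to be obtained either from pairs that escape in both
  coordinates or from proper homotopies applied to one point of the pair. A second gap lies between
  open sets and closures: \<open>p_cat\<close> asks for contractions on closures while
  \<open>p_TC\<close> offers open sets, so covers are shrunk, which rests on the normality of
  metrizable spaces. In (v) the planner stays inside a prescribed exterior set only over F, the
  square of a neighbourhood of infinity. A kernel class is therefore shown to vanish on the image V
  of one of the U_i relative to the intersection of V and F. Excision turns this into vanishing on
  \<open>V \<union> F\<close> relative to F, and the exact sequence of the triple formed by the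
  whole product, \<open>V \<union> F\<close> and F gives the lift. Enlarging V by F is also what
  makes the new support exterior.\<close>

section \<open>Infima of extended natural numbers\<close>

lemma Inf_enat_le: "P n \<Longrightarrow> Inf {enat n | n. P n} \<le> enat n"
  by (rule Inf_lower) blast

text \<open>A finite value excludes the empty set, whose infimum is infinite, and a nonempty set of
  extended naturals attains its infimum.\<close>

lemma Inf_enat_attained:
  assumes "Inf {enat n | n. P n} = enat n"
  shows "P n"
proof -
  have "{enat n | n. P n} \<noteq> {}"
    using assms by (metis Inf_enat_def enat.distinct(2))
  then have "Inf {enat n | n. P n} \<in> {enat n | n. P n}"
    by (metis (no_types, lifting) Inf_enat_def LeastI_ex ex_in_conv)
  then show ?thesis
    using assms by auto
qed

section \<open>Concatenation of homotopies\<close>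

abbreviation unit_interval :: "real topology" where
  "unit_interval \<equiv> top_of_set {0..1}"

text \<open>The last conclusion confines each track of the concatenation to the tracks of its two
  halves; this is how properness will pass to concatenations.\<close>

lemma concat_homotopies:
  assumes F: "continuous_map (prod_topology Z unit_interval) X F"
    and G: "continuous_map (prod_topology Z unit_interval) X G"
    and FG: "\<And>z. z \<in> topspace Z \<Longrightarrow> F (z, 1) = G (z, 0)"
  obtains J where "continuous_map (prod_topology Z unit_interval) X J"
    "\<And>z. J (z, 0) = F (z, 0)" "\<And>z. J (z, 1) = G (z, 1)"
    "\<And>z t. t \<in> {0..1} \<Longrightarrow>
       J (z, t) \<in> (\<lambda>s. F (z, s)) ` {0..1} \<union> (\<lambda>s. G (z, s)) ` {0..1}"
proof
  let ?J = "\<lambda>zt. if snd zt \<le> 1/2 then F (fst zt, 2 * snd zt) else G (fst zt, 2 * snd zt - 1)"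
  let ?Q = "prod_topology Z unit_interval"
  have sndr: "continuous_map ?Q euclideanreal snd"
    using continuous_map_snd continuous_map_in_subtopology by blast
  have c1: "continuous_map (subtopology ?Q {x \<in> topspace ?Q. snd x \<le> 1/2}) ?Q (\<lambda>zt. (fst zt, 2 * snd zt))"
    using continuous_map_from_subtopology[OF sndr]
    by (auto simp: continuous_map_pairwise o_def continuous_map_in_subtopology
        intro!: continuous_intros continuous_map_from_subtopology[OF continuous_map_fst])
  have c2: "continuous_map (subtopology ?Q {x \<in> topspace ?Q. 1/2 \<le> snd x}) ?Q (\<lambda>zt. (fst zt, 2 * snd zt - 1))"
    using continuous_map_from_subtopology[OF sndr]
    by (auto simp: continuous_map_pairwise o_def continuous_map_in_subtopology
        intro!: continuous_intros continuous_map_from_subtopology[OF continuous_map_fst])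
  show "continuous_map ?Q X ?J"
  proof (rule continuous_map_cases_le)
    show "continuous_map ?Q euclideanreal (\<lambda>x. 1/2)" by simp
    show "continuous_map (subtopology ?Q {x \<in> topspace ?Q. snd x \<le> 1/2}) X (\<lambda>x. F (fst x, 2 * snd x))"
      using continuous_map_compose[OF c1 F] by (simp add: o_def)
    show "continuous_map (subtopology ?Q {x \<in> topspace ?Q. 1/2 \<le> snd x}) X (\<lambda>x. G (fst x, 2 * snd x - 1))"
      using continuous_map_compose[OF c2 G] by (simp add: o_def)
    show "F (fst x, 2 * snd x) = G (fst x, 2 * snd x - 1)" if "x \<in> topspace ?Q" "snd x = 1/2" for x
    proof -
      have "F (fst x, 1) = G (fst x, 0)"
        using that FG[of "fst x"] by auto
      then show ?thesis unfolding that(2) by simp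
    qed
  qed (use sndr in auto)
  show "?J (z, t) \<in> (\<lambda>s. F (z, s)) ` {0..1} \<union> (\<lambda>s. G (z, s)) ` {0..1}"
    if "t \<in> {0..1}" for z t
    using that by auto
qed auto


section \<open>Motion planners\<close>

definition planner :: "'a topology \<Rightarrow> ('a \<times> 'a) set \<Rightarrow> (('a \<times> 'a) \<times> real \<Rightarrow> 'a) \<Rightarrow> bool" where
  "planner X U h \<longleftrightarrow>
     continuous_map (prod_topology (subtopology (prod_topology X X) U) unit_interval) X h \<and>
     (\<forall>p \<in> U. h (p, 0) = fst p \<and> h (p, 1) = snd p)"

definition proper_planner :: "'a topology \<Rightarrow> ('a \<times> 'a) set \<Rightarrow> (('a \<times> 'a) \<times> real \<Rightarrow> 'a) \<Rightarrow> bool" where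
  "proper_planner X U h \<longleftrightarrow> planner X U h \<and>
     (\<forall>K. compactin X K \<longrightarrow> (\<exists>L. compactin X L \<and> K \<subseteq> L \<and>
        (\<forall>p \<in> U. \<forall>t \<in> {0..1}. fst p \<notin> L \<and> snd p \<notin> L \<longrightarrow> h (p, t) \<notin> K)))"

text \<open>One half of the exponential law. It rests on local compactness of the interval: a
  compact neighbourhood of t that the path sends into V supplies a subbasic set of the compact-open
  topology.\<close>

lemma continuous_map_path_eval:
  assumes \<sigma>: "continuous_map Z (path_space X) \<sigma>"
  shows "continuous_map (prod_topology Z unit_interval) X (\<lambda>(z, t). \<sigma> z t)"
proof -
  have ps: "\<sigma> z \<in> paths X" if "z \<in> topspace Z" for z
  proof -
    have "\<sigma> z \<in> topspace (path_space X)"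
      using \<sigma> that by (meson continuous_map_image_subset_topspace image_subset_iff)
    then show ?thesis
      by (auto simp: path_space_def topology_generated_by_topspace)
  qed
  then have in_X: "\<sigma> z t \<in> topspace X" if "z \<in> topspace Z" "t \<in> {0..1}" for z t
    using that by (fastforce simp: paths_def pathin_def continuous_map_def)
  have "openin (prod_topology Z unit_interval) {x \<in> topspace Z \<times> {0..1}. (\<lambda>(z, t). \<sigma> z t) x \<in> V}"
    if V: "openin X V" for V
  proof (subst openin_subopen, clarify)
    fix z t assume z: "z \<in> topspace Z" and t: "t \<in> {0..1::real}" and zt: "\<sigma> z t \<in> V"
    have "openin unit_interval {s \<in> {0..1}. \<sigma> z s \<in> V}"
      using ps[OF z] V by (auto simp: paths_def pathin_def continuous_map_def)
    then obtain W where W: "open W" "{s \<in> {0..1}. \<sigma> z s \<in> V} = {0..1} \<inter> W"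
      by (auto simp: openin_open)
    then obtain e where e: "e > 0" "cball t e \<subseteq> W"
      using zt t by (metis (mono_tags, lifting) IntD2 mem_Collect_eq open_contains_cball)
    let ?K = "cball t e \<inter> {0..1}"
    let ?S = "{\<gamma> \<in> paths X. \<gamma> ` ?K \<subseteq> V}"
    have "openin (path_space X) ?S"
      unfolding path_space_def
      by (rule topology_generated_by_Basis) (use V in blast)
    then have o: "openin Z {z \<in> topspace Z. \<sigma> z \<in> ?S}"
      using \<sigma> openin_continuous_map_preimage by blast
    have "openin unit_interval ({0..1} \<inter> ball t e)"
      by (simp add: openin_open_Int)
    with o have "openin (prod_topology Z unit_interval) ({z \<in> topspace Z. \<sigma> z \<in> ?S} \<times> ({0..1} \<inter> ball t e))"
      by (simp add: openin_prod_Times_iff)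
    moreover have "\<sigma> z ` ?K \<subseteq> V"
      using W e by auto
    then have "(z, t) \<in> {z \<in> topspace Z. \<sigma> z \<in> ?S} \<times> ({0..1} \<inter> ball t e)"
      using z t ps e by auto
    moreover have "{z \<in> topspace Z. \<sigma> z \<in> ?S} \<times> ({0..1} \<inter> ball t e)
        \<subseteq> {x \<in> topspace Z \<times> {0..1}. (case x of (z, t) \<Rightarrow> \<sigma> z t) \<in> V}"
      by (auto simp: image_subset_iff)
    ultimately show "\<exists>T. openin (prod_topology Z unit_interval) T \<and> (z, t) \<in> T \<and>
        T \<subseteq> {x \<in> topspace Z \<times> {0..1}. (case x of (z, t) \<Rightarrow> \<sigma> z t) \<in> V}"
      by blast
  qed
  then show ?thesis
    using in_X by (auto simp: continuous_map_def)
qed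

text \<open>The other half of the exponential law. The complement of the preimage of a subbasic set
  is the image of a closed set under the projection along the compact set K, and such projections
  are closed maps.\<close>

lemma continuous_map_path_curry:
  assumes h: "continuous_map (prod_topology Z unit_interval) X h"
  shows "continuous_map Z (path_space X) (\<lambda>z. restrict (\<lambda>t. h (z, t)) {0..1})"
proof -
  let ?s = "\<lambda>z. restrict (\<lambda>t. h (z, t)) {0..1}"
  have path: "?s z \<in> paths X" if "z \<in> topspace Z" for z
  proof -
    have "continuous_map unit_interval (prod_topology Z unit_interval) (\<lambda>t. (z, t))"
      using that by (auto simp: continuous_map_pairwise o_def continuous_map_id[unfolded id_def])
    from continuous_map_compose[OF this h]
    have "continuous_map unit_interval X (\<lambda>t. h (z, t))" by (simp add: o_def)
    then have "continuous_map unit_interval X (?s z)"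
      by (rule continuous_map_eq) auto
    then show ?thesis by (simp add: paths_def pathin_def)
  qed
  show ?thesis
    unfolding path_space_def
  proof (rule continuous_on_generated_topo)
    fix S assume "S \<in> {{\<gamma> \<in> paths X. \<gamma> ` K \<subseteq> V} | K V. compact K \<and> K \<subseteq> {0..1} \<and> openin X V}"
    then obtain K V where S: "S = {\<gamma> \<in> paths X. \<gamma> ` K \<subseteq> V}" and K: "compact K" "K \<subseteq> {0..1}"
      and V: "openin X V" by auto
    let ?C = "{p \<in> topspace Z \<times> K. h p \<in> topspace X - V}"
    have sub: "subtopology (prod_topology Z unit_interval) (topspace Z \<times> K) = prod_topology Z (top_of_set K)"
      using K by (simp add: subtopology_Times subtopology_subtopology inf.absorb2)
    have "continuous_map (prod_topology Z (top_of_set K)) X h"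
      using h continuous_map_from_subtopology sub by metis
    then have "closedin (prod_topology Z (top_of_set K)) ?C"
      using closedin_continuous_map_preimage[where C = "topspace X - V"] V by fastforce
    moreover have "closed_map (prod_topology Z (top_of_set K)) Z fst"
      using K by (intro closed_map_fst) (simp add: compact_space_subtopology)
    ultimately have "closedin Z (fst ` ?C)"
      by (simp add: closed_map_def)
    then have "openin Z (topspace Z - fst ` ?C)" by blast
    moreover have "topspace Z - fst ` ?C = ?s -` S \<inter> topspace Z"
    proof -
      have "h (z, t) \<in> topspace X" if "z \<in> topspace Z" "t \<in> K" for z t
        using h that K by (force simp: continuous_map_def)
      then show ?thesis
        using path K by (auto simp: S image_subset_iff subset_iff) force
    qed
    ultimately show "openin Z (?s -` S \<inter> topspace Z)" by simp
  next
    have "paths X = {\<gamma> \<in> paths X. \<gamma> ` {} \<subseteq> topspace X}" by simp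
    then have "paths X \<in> {{\<gamma> \<in> paths X. \<gamma> ` K \<subseteq> V} | K V. compact K \<and> K \<subseteq> {0..1} \<and> openin X V}"
      using compact_empty openin_topspace by blast
    then show "?s ` topspace Z \<subseteq> \<Union>{{\<gamma> \<in> paths X. \<gamma> ` K \<subseteq> V} | K V. compact K \<and> K \<subseteq> {0..1} \<and> openin X V}"
      using path by (intro image_subsetI UnionI[of "paths X"]) simp_all
  qed
qed

text \<open>With the exponential law, sections are replaced by maps on a product with the interval;
  after this lemma the path space is not unfolded again.\<close>

lemma ex_local_section_iff_planner:
  assumes "U \<subseteq> topspace X \<times> topspace X"
  shows "(\<exists>\<sigma>. local_section X U \<sigma>) \<longleftrightarrow> (\<exists>h. planner X U h)" (is ?A)
    and "(\<exists>\<sigma>. proper_local_section X U \<sigma>) \<longleftrightarrow> (\<exists>h. proper_planner X U h)" (is ?B)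
proof -
  have top: "topspace (subtopology (prod_topology X X) U) = U"
    using assms by auto
  have 1: "planner X U (\<lambda>(p, t). \<sigma> p t)" if "local_section X U \<sigma>" for \<sigma>
    using that continuous_map_path_eval[of "subtopology (prod_topology X X) U" X \<sigma>]
    by (auto simp: planner_def local_section_def path_ends_def)
  have 2: "local_section X U (\<lambda>p. restrict (\<lambda>t. h (p, t)) {0..1})" if "planner X U h" for h
    using that continuous_map_path_curry[of "subtopology (prod_topology X X) U" X h]
    by (auto simp: planner_def local_section_def path_ends_def)
  show ?A using 1 2 by blast
  have 3: "proper_planner X U (\<lambda>(p, t). \<sigma> p t)" if s: "proper_local_section X U \<sigma>" for \<sigma>
    unfolding proper_planner_def
  proof (intro conjI allI impI)
    show "planner X U (\<lambda>(p, t). \<sigma> p t)" using s 1 by (simp add: proper_local_section_def)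
    fix K assume "compactin X K"
    then obtain L where L: "compactin X L" "K \<subseteq> L"
      "\<And>p. p \<in> U \<inter> ((topspace X - L) \<times> (topspace X - L)) \<Longrightarrow> \<sigma> p ` {0..1} \<subseteq> topspace X - K"
      using s unfolding proper_local_section_def by meson
    have "\<forall>p\<in>U. \<forall>t\<in>{0..1}. fst p \<notin> L \<and> snd p \<notin> L \<longrightarrow> (case (p, t) of (p, t) \<Rightarrow> \<sigma> p t) \<notin> K"
    proof (intro ballI impI)
      fix p t assume "p \<in> U" "t \<in> {0..1::real}" "fst p \<notin> L \<and> snd p \<notin> L"
      moreover from this have "p \<in> U \<inter> ((topspace X - L) \<times> (topspace X - L))"
        using assms by (cases p) auto
      ultimately show "(case (p, t) of (p, t) \<Rightarrow> \<sigma> p t) \<notin> K"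
        using L(3)[of p] by (auto simp: image_subset_iff)
    qed
    then show "\<exists>L. compactin X L \<and> K \<subseteq> L \<and> (\<forall>p\<in>U. \<forall>t\<in>{0..1}. fst p \<notin> L \<and> snd p \<notin> L \<longrightarrow> (case (p, t) of (p, t) \<Rightarrow> \<sigma> p t) \<notin> K)"
      using L by blast
  qed
  have 4: "proper_local_section X U (\<lambda>p. restrict (\<lambda>t. h (p, t)) {0..1})" if h: "proper_planner X U h" for h
    unfolding proper_local_section_def
  proof (intro conjI allI impI)
    show "local_section X U (\<lambda>p. restrict (\<lambda>t. h (p, t)) {0..1})"
      using h 2 by (simp add: proper_planner_def)
    fix K assume "compactin X K"
    then obtain L where L: "compactin X L" "K \<subseteq> L"
      "\<And>p t. \<lbrakk>p \<in> U; t \<in> {0..1}; fst p \<notin> L; snd p \<notin> L\<rbrakk> \<Longrightarrow> h (p, t) \<notin> K"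
      using h unfolding proper_planner_def by meson
    have "continuous_map (prod_topology (subtopology (prod_topology X X) U) unit_interval) X h"
      using h by (simp add: proper_planner_def planner_def)
    then have "h (p, t) \<in> topspace X" if "p \<in> U" "t \<in> {0..1}" for p t
      using that top unfolding continuous_map_def by (auto simp: Pi_iff)
    then show "\<exists>L. compactin X L \<and> K \<subseteq> L \<and> (\<forall>p \<in> U \<inter> ((topspace X - L) \<times> (topspace X - L)).
        restrict (\<lambda>t. h (p, t)) {0..1} ` {0..1} \<subseteq> topspace X - K)"
      using L by (intro exI[of _ L]) auto
  qed
  show ?B using 3 4 by blast
qed

section \<open>Covers with motion planners, and the comparison with \<open>TC\<close>\<close>

definition proper_planners :: "'a topology \<Rightarrow> nat \<Rightarrow> (nat \<Rightarrow> ('a \<times> 'a) set) \<Rightarrow> bool" where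
  "proper_planners X n U \<longleftrightarrow> (\<Union>i\<le>n. U i) = topspace X \<times> topspace X \<and>
     (\<forall>i\<le>n. openin (prod_topology X X) (U i) \<and> (\<exists>h. proper_planner X (U i) h))"

lemma openin_prod_subset: "openin (prod_topology X X) U \<Longrightarrow> U \<subseteq> topspace X \<times> topspace X"
  using openin_subset by force

lemma p_TC_le: "proper_planners X n U \<Longrightarrow> p_TC X \<le> enat n"
  unfolding p_TC_def proper_planners_def
  by (rule Inf_enat_le) (metis ex_local_section_iff_planner(2) openin_prod_subset)

lemma p_TC_eq_enatE:
  assumes "p_TC X = enat n"
  obtains U where "proper_planners X n U"
proof -
  have "\<exists>U. (\<Union>i\<le>n. U i) = topspace X \<times> topspace X \<and>
     (\<forall>i\<le>n. openin (prod_topology X X) (U i) \<and> (\<exists>\<sigma>. proper_local_section X (U i) \<sigma>))"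
    using assms unfolding p_TC_def by (rule Inf_enat_attained)
  then obtain U where "(\<Union>i\<le>n. U i) = topspace X \<times> topspace X"
     "\<forall>i\<le>n. openin (prod_topology X X) (U i) \<and> (\<exists>\<sigma>. proper_local_section X (U i) \<sigma>)"
    by blast
  then have "proper_planners X n U"
    unfolding proper_planners_def by (metis ex_local_section_iff_planner(2) openin_prod_subset)
  then show thesis using that by blast
qed

lemma TC_le_p_TC: "TC X \<le> p_TC X"
proof (cases "p_TC X")
  case (enat n)
  then obtain U where U: "proper_planners X n U"
    by (rule p_TC_eq_enatE)
  then have "\<exists>\<sigma>. local_section X (U i) \<sigma>" if "i \<le> n" for i
    using that unfolding proper_planners_def proper_planner_def
    by (metis ex_local_section_iff_planner(1) openin_prod_subset)
  then have "\<exists>U. (\<Union>i\<le>n. U i) = topspace X \<times> topspace X \<and>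
     (\<forall>i\<le>n. openin (prod_topology X X) (U i) \<and> (\<exists>\<sigma>. local_section X (U i) \<sigma>))"
    using U by (intro exI[of _ U]) (simp add: proper_planners_def)
  then show ?thesis
    unfolding enat TC_def by (rule Inf_enat_le)
qed simp

text \<open>Taking the whole space as L leaves no pair outside L, so every section satisfies the
  condition at infinity.\<close>

lemma TC_eq_p_TC_compact:
  assumes "compact_space X"
  shows "TC X = p_TC X"
proof -
  have "local_section X U \<sigma> \<Longrightarrow> proper_local_section X U \<sigma>" for U \<sigma>
    using assms by (auto simp: proper_local_section_def compact_space_def dest: compactin_subset_topspace)
  then have "local_section X U \<sigma> \<longleftrightarrow> proper_local_section X U \<sigma>" for U \<sigma>
    by (auto simp: proper_local_section_def)
  then show ?thesis by (simp add: TC_def p_TC_def)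
qed

section \<open>Proper maps and compact sets\<close>

lemma proper_cmap_compactin:
  "\<lbrakk>proper_cmap X Y f; compactin Y K\<rbrakk> \<Longrightarrow> compactin X {x \<in> topspace X. f x \<in> K}"
  by (simp add: proper_cmap_def)

text \<open>Compact sets of a Hausdorff target are closed, so their preimages are closed and it is
  enough to enclose them in compact sets.\<close>

lemma proper_cmapI:
  assumes f: "continuous_map X Y f" and Y: "Hausdorff_space Y"
    and C: "\<And>K. compactin Y K \<Longrightarrow> \<exists>C. compactin X C \<and> {x \<in> topspace X. f x \<in> K} \<subseteq> C"
  shows "proper_cmap X Y f"
  unfolding proper_cmap_def
proof (intro conjI allI impI f)
  fix K assume K: "compactin Y K"
  then obtain C where C: "compactin X C" "{x \<in> topspace X. f x \<in> K} \<subseteq> C"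
    using assms(3) by blast
  moreover have "closedin X {x \<in> topspace X. f x \<in> K}"
    using f K Y by (simp add: closedin_continuous_map_preimage compactin_imp_closedin)
  ultimately show "compactin X {x \<in> topspace X. f x \<in> K}"
    using closed_compactin by blast
qed

lemma compactin_halflineE:
  assumes "compactin halfline K"
  obtains M where "M \<ge> 0" "K \<subseteq> {0..M}"
proof -
  have K: "compact K" "K \<subseteq> {0..}"
    using assms by (auto simp: compactin_subtopology)
  then obtain M where "\<forall>x\<in>K. norm x \<le> M"
    using bounded_iff compact_imp_bounded by blast
  then have "K \<subseteq> {0..max M 0}"
    using K by (force simp: max_def)
  then show thesis using that[of "max M 0"] by auto
qed

lemma compactin_halfline_interval: "compactin halfline {0..M}"
  by (auto simp: compactin_subtopology)

text \<open>L is the projection of the compact preimage of K; the whole track of a point outside L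
  then avoids K.\<close>

lemma proper_homotopy_preimage:
  assumes H: "proper_cmap (prod_topology (subtopology X A) unit_interval) Y H" and K: "compactin Y K"
  obtains L where "compactin X L" "\<And>x t. \<lbrakk>x \<in> topspace X \<inter> A; t \<in> {0..1}; H (x, t) \<in> K\<rbrakk> \<Longrightarrow> x \<in> L"
proof
  let ?Q = "prod_topology (subtopology X A) unit_interval"
  let ?C = "{q \<in> topspace ?Q. H q \<in> K}"
  have "compactin ?Q ?C"
    using H K proper_cmap_compactin by blast
  then have "compactin (subtopology X A) (fst ` ?C)"
    by (rule image_compactin) (rule continuous_map_fst)
  then show "compactin X (fst ` ?C)"
    by (simp add: compactin_subtopology)
  show "x \<in> fst ` ?C" if "x \<in> topspace X \<inter> A" "t \<in> {0..1}" "H (x, t) \<in> K" for x t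
    using that by (force simp: image_iff)
qed


section \<open>Operations on motion planners\<close>

text \<open>A proper planner without its end conditions. The pieces of a concatenation do not join
  the two points of a pair, but each has to satisfy the condition at infinity.\<close>

definition proper_track :: "'a topology \<Rightarrow> ('a \<times> 'a) set \<Rightarrow> (('a \<times> 'a) \<times> real \<Rightarrow> 'a) \<Rightarrow> bool" where
  "proper_track X U F \<longleftrightarrow>
     continuous_map (prod_topology (subtopology (prod_topology X X) U) unit_interval) X F \<and>
     (\<forall>K. compactin X K \<longrightarrow> (\<exists>L. compactin X L \<and> K \<subseteq> L \<and>
        (\<forall>p \<in> U. \<forall>t \<in> {0..1}. fst p \<notin> L \<and> snd p \<notin> L \<longrightarrow> F (p, t) \<notin> K)))"

lemma proper_planner_iff_track:
  "proper_planner X U h \<longleftrightarrow> proper_track X U h \<and> (\<forall>p \<in> U. h (p, 0) = fst p \<and> h (p, 1) = snd p)"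
  by (auto simp: proper_planner_def planner_def proper_track_def)

text \<open>The inclusion of K in L costs nothing, since L may be replaced by its union with
  K.\<close>

lemma proper_trackI:
  assumes "continuous_map (prod_topology (subtopology (prod_topology X X) U) unit_interval) X F"
    and "\<And>K. compactin X K \<Longrightarrow> \<exists>L. compactin X L \<and>
        (\<forall>p \<in> U. \<forall>t \<in> {0..1}. fst p \<notin> L \<and> snd p \<notin> L \<longrightarrow> F (p, t) \<notin> K)"
  shows "proper_track X U F"
  unfolding proper_track_def
proof (intro conjI allI impI assms(1))
  fix K assume K: "compactin X K"
  then obtain L where L: "compactin X L"
    "\<And>p t. \<lbrakk>p \<in> U; t \<in> {0..1}; fst p \<notin> L; snd p \<notin> L\<rbrakk> \<Longrightarrow> F (p, t) \<notin> K"
    using assms(2) by meson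
  then show "\<exists>L. compactin X L \<and> K \<subseteq> L \<and>
      (\<forall>p \<in> U. \<forall>t \<in> {0..1}. fst p \<notin> L \<and> snd p \<notin> L \<longrightarrow> F (p, t) \<notin> K)"
    using K by (intro exI[of _ "K \<union> L"]) (auto simp: compactin_Un)
qed

lemma proper_trackE:
  assumes "proper_track X U F" "compactin X K"
  obtains L where "compactin X L" "K \<subseteq> L"
    "\<And>p t. \<lbrakk>p \<in> U; t \<in> {0..1}; fst p \<notin> L; snd p \<notin> L\<rbrakk> \<Longrightarrow> F (p, t) \<notin> K"
  using assms unfolding proper_track_def by meson

lemma proper_track_concat:
  assumes F: "proper_track X U F" and G: "proper_track X U G"
    and FG: "\<And>p. p \<in> U \<Longrightarrow> F (p, 1) = G (p, 0)"
  obtains J where "proper_track X U J" "\<And>p. J (p, 0) = F (p, 0)" "\<And>p. J (p, 1) = G (p, 1)"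
proof -
  let ?Z = "subtopology (prod_topology X X) U"
  obtain J where J: "continuous_map (prod_topology ?Z unit_interval) X J"
    "\<And>z. J (z, 0) = F (z, 0)" "\<And>z. J (z, 1) = G (z, 1)"
    "\<And>z t. t \<in> {0..1} \<Longrightarrow> J (z, t) \<in> (\<lambda>s. F (z, s)) ` {0..1} \<union> (\<lambda>s. G (z, s)) ` {0..1}"
    by (rule concat_homotopies[of ?Z X F G]) (use assms in \<open>auto simp: proper_track_def\<close>)
  have "proper_track X U J"
  proof (rule proper_trackI[OF J(1)])
    fix K assume K: "compactin X K"
    obtain L where L: "compactin X L"
      "\<And>p t. \<lbrakk>p \<in> U; t \<in> {0..1}; fst p \<notin> L; snd p \<notin> L\<rbrakk> \<Longrightarrow> F (p, t) \<notin> K"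
      using proper_trackE[OF F K] by metis
    obtain M where M: "compactin X M"
      "\<And>p t. \<lbrakk>p \<in> U; t \<in> {0..1}; fst p \<notin> M; snd p \<notin> M\<rbrakk> \<Longrightarrow> G (p, t) \<notin> K"
      using proper_trackE[OF G K] by metis
    have "J (p, t) \<notin> K" if "p \<in> U" "t \<in> {0..1}" "fst p \<notin> L \<union> M" "snd p \<notin> L \<union> M" for p t
      using J(4)[OF that(2), of p] L(2)[OF that(1)] M(2)[OF that(1)] that(3,4)
      by (metis (no_types, lifting) UnCI UnE imageE)
    then show "\<exists>L. compactin X L \<and> (\<forall>p\<in>U. \<forall>t\<in>{0..1}. fst p \<notin> L \<and> snd p \<notin> L \<longrightarrow> J (p, t) \<notin> K)"
      using L M by (intro exI[of _ "L \<union> M"]) (auto simp: compactin_Un)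
  qed
  then show thesis using J that by blast
qed

lemma proper_planner_concat3:
  assumes "proper_track X U F" "proper_track X U G" "proper_track X U H"
    and "\<And>p. p \<in> U \<Longrightarrow> F (p, 0) = fst p \<and> F (p, 1) = G (p, 0) \<and> G (p, 1) = H (p, 0) \<and> H (p, 1) = snd p"
  shows "\<exists>h. proper_planner X U h"
proof -
  obtain J where J: "proper_track X U J" "\<And>p. J (p, 0) = F (p, 0)" "\<And>p. J (p, 1) = G (p, 1)"
    using proper_track_concat[OF assms(1,2)] assms(4) by metis
  obtain J' where J': "proper_track X U J'" "\<And>p. J' (p, 0) = J (p, 0)" "\<And>p. J' (p, 1) = H (p, 1)"
    using proper_track_concat[OF J(1) assms(3)] assms(4) J by metis
  then show ?thesis
    using J assms(4) by (intro exI[of _ J']) (simp add: proper_planner_iff_track)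
qed

text \<open>If both points of a pair lie outside the L that belongs to K, then so does the one
  selected by \<open>c\<close>, and its track under H avoids K. The reparametrization
  \<open>s\<close> allows H to be run backwards.\<close>

lemma proper_track_of_homotopy:
  assumes H: "proper_cmap (prod_topology (subtopology X A) unit_interval) X H"
    and U: "U \<subseteq> topspace X \<times> topspace X"
    and c: "continuous_map (prod_topology (subtopology (prod_topology X X) U) unit_interval) X c"
    and s: "continuous_map (prod_topology (subtopology (prod_topology X X) U) unit_interval) unit_interval s"
    and cA: "\<And>p t. \<lbrakk>p \<in> U; t \<in> {0..1}\<rbrakk> \<Longrightarrow> c (p, t) \<in> A \<inter> {fst p, snd p}"
  shows "proper_track X U (\<lambda>q. H (c q, s q))"
proof (rule proper_trackI)
  let ?Q = "prod_topology (subtopology (prod_topology X X) U) unit_interval"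
  have "continuous_map ?Q (prod_topology (subtopology X A) unit_interval) (\<lambda>q. (c q, s q))"
    using c s cA by (auto simp: continuous_map_pairwise o_def continuous_map_in_subtopology)
  from continuous_map_compose[OF this, of X H] H
  show "continuous_map ?Q X (\<lambda>q. H (c q, s q))"
    by (simp add: proper_cmap_def o_def)
  fix K assume "compactin X K"
  then obtain L where L: "compactin X L" "\<And>x t. \<lbrakk>x \<in> topspace X \<inter> A; t \<in> {0..1}; H (x, t) \<in> K\<rbrakk> \<Longrightarrow> x \<in> L"
    using proper_homotopy_preimage[OF H] by blast
  have "H (c (p, t), s (p, t)) \<notin> K" if p: "p \<in> U" "t \<in> {0..1}" "fst p \<notin> L" "snd p \<notin> L" for p t
  proof
    assume *: "H (c (p, t), s (p, t)) \<in> K"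
    have q: "(p, t) \<in> topspace ?Q"
      using p U by auto
    have "s (p, t) \<in> {0..1}" "c (p, t) \<in> topspace X"
      using s c q by (metis continuous_map_image_subset_topspace image_subset_iff topspace_euclidean_subtopology, metis continuous_map_image_subset_topspace image_subset_iff)
    with L(2)[of "c (p, t)" "s (p, t)"] * cA[OF p(1,2)] have "c (p, t) \<in> L"
      by blast
    then show False using cA[OF p(1,2)] p by auto
  qed
  then show "\<exists>L. compactin X L \<and> (\<forall>p\<in>U. \<forall>t\<in>{0..1}. fst p \<notin> L \<and> snd p \<notin> L \<longrightarrow> H (c (p, t), s (p, t)) \<notin> K)"
    using L(1) by blast
qed

lemma continuous_map_track_projections:
  fixes X :: "'a topology" and U :: "('a \<times> 'a) set"
  defines "Q \<equiv> prod_topology (subtopology (prod_topology X X) U) unit_interval"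
  shows "continuous_map Q X (\<lambda>q. fst (fst q))" "continuous_map Q X (\<lambda>q. snd (fst q))"
    "continuous_map Q unit_interval snd" "continuous_map Q unit_interval (\<lambda>q. 1 - snd q)"
    "continuous_map Q (subtopology (prod_topology X X) U) fst"
proof -
  show f: "continuous_map Q (subtopology (prod_topology X X) U) fst"
    unfolding Q_def by (rule continuous_map_fst)
  then have f': "continuous_map Q (prod_topology X X) fst"
    by (simp add: continuous_map_in_subtopology)
  show "continuous_map Q X (\<lambda>q. fst (fst q))" "continuous_map Q X (\<lambda>q. snd (fst q))"
    using continuous_map_compose[OF f' continuous_map_fst] continuous_map_compose[OF f' continuous_map_snd]
    by (simp_all add: o_def)
  show s: "continuous_map Q unit_interval snd"
    unfolding Q_def by (rule continuous_map_snd)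
  show "continuous_map Q unit_interval (\<lambda>q. 1 - snd q)"
    using s by (auto simp: continuous_map_in_subtopology Pi_iff intro!: continuous_intros)
qed

section \<open>Invariance under proper homotopy equivalence\<close>

text \<open>The path from x to y runs from x back to \<open>g (f x)\<close> along the homotopy, then
  along the image under \<open>g\<close> of the path planned in Y from \<open>f x\<close> to
  \<open>f y\<close>, and finally from \<open>g (f y)\<close> to y along the homotopy.\<close>

lemma proper_planner_pullback:
  assumes f: "proper_cmap X Y f" and g: "proper_cmap Y X g"
    and gf: "properly_homotopic X X (g \<circ> f) id" and h: "proper_planner Y U h"
  shows "\<exists>h'. proper_planner X {p \<in> topspace X \<times> topspace X. (f (fst p), f (snd p)) \<in> U} h'"
proof -
  define V where "V = {p \<in> topspace X \<times> topspace X. (f (fst p), f (snd p)) \<in> U}"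
  let ?Q = "prod_topology (subtopology (prod_topology X X) V) unit_interval"
  have V: "V \<subseteq> topspace X \<times> topspace X" by (auto simp: V_def)
  obtain H where H: "proper_cmap (prod_topology X unit_interval) X H"
    "\<And>x. x \<in> topspace X \<Longrightarrow> H (x, 0) = g (f x) \<and> H (x, 1) = x"
    using gf by (auto simp: properly_homotopic_def)
  then have H': "proper_cmap (prod_topology (subtopology X UNIV) unit_interval) X H"
    by simp
  have F: "proper_track X V (\<lambda>q. H (fst (fst q), 1 - snd q))"
    by (rule proper_track_of_homotopy[OF H' V]) (auto intro: continuous_map_track_projections)
  have G: "proper_track X V (\<lambda>q. H (snd (fst q), snd q))"
    by (rule proper_track_of_homotopy[OF H' V]) (auto intro: continuous_map_track_projections)
  have M: "proper_track X V (\<lambda>q. g (h ((f (fst (fst q)), f (snd (fst q))), snd q)))"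
  proof (rule proper_trackI)
    have fc: "continuous_map X Y f" and gc: "continuous_map Y X g"
      using f g by (auto simp: proper_cmap_def)
    have hc: "continuous_map (prod_topology (subtopology (prod_topology Y Y) U) unit_interval) Y h"
      using h by (simp add: proper_planner_def planner_def)
    have "continuous_map ?Q (prod_topology Y Y) (\<lambda>q. (f (fst (fst q)), f (snd (fst q))))"
      using continuous_map_compose[OF continuous_map_track_projections(1) fc]
        continuous_map_compose[OF continuous_map_track_projections(2) fc]
      by (simp add: continuous_map_pairwise o_def)
    then have "continuous_map ?Q (subtopology (prod_topology Y Y) U) (\<lambda>q. (f (fst (fst q)), f (snd (fst q))))"
      by (auto simp: continuous_map_in_subtopology V_def)
    then have "continuous_map ?Q (prod_topology (subtopology (prod_topology Y Y) U) unit_interval)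
        (\<lambda>q. ((f (fst (fst q)), f (snd (fst q))), snd q))"
      using continuous_map_track_projections(3) by (simp add: continuous_map_pairwise o_def)
    from continuous_map_compose[OF continuous_map_compose[OF this hc] gc]
    show "continuous_map ?Q X (\<lambda>q. g (h ((f (fst (fst q)), f (snd (fst q))), snd q)))"
      by (simp add: o_def)
    have hY: "h (p, t) \<in> topspace Y" if "p \<in> U \<inter> topspace Y \<times> topspace Y" "t \<in> {0..1}" for p t
      using hc that by (force simp: continuous_map_def Pi_iff)
    fix K assume "compactin X K"
    define gK where "gK = {y \<in> topspace Y. g y \<in> K}"
    have gK: "compactin Y gK"
      unfolding gK_def using \<open>compactin X K\<close> g proper_cmap_compactin by blast
    have "proper_track Y U h"
      using h by (simp add: proper_planner_iff_track)
    then obtain L where L: "compactin Y L"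
      "\<And>p t. \<lbrakk>p \<in> U; t \<in> {0..1}; fst p \<notin> L; snd p \<notin> L\<rbrakk> \<Longrightarrow> h (p, t) \<notin> gK"
      using proper_trackE[OF _ gK] by metis
    have fY: "f x \<in> topspace Y" if "x \<in> topspace X" for x
      using fc that by (auto simp: continuous_map_def)
    let ?L = "{x \<in> topspace X. f x \<in> L}"
    have "compactin X ?L"
      using f L proper_cmap_compactin by blast
    moreover have "g (h ((f (fst p), f (snd p)), t)) \<notin> K"
      if "p \<in> V" "t \<in> {0..1}" "fst p \<notin> ?L" "snd p \<notin> ?L" for p t
      using that fY hY[of "(f (fst p), f (snd p))" t] L(2)[of "(f (fst p), f (snd p))" t]
      by (auto simp: V_def gK_def mem_Times_iff)
    ultimately show "\<exists>L. compactin X L \<and> (\<forall>p\<in>V. \<forall>t\<in>{0..1}. fst p \<notin> L \<and> snd p \<notin> L \<longrightarrow>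
        g (h ((f (fst (fst (p, t))), f (snd (fst (p, t)))), snd (p, t))) \<notin> K)"
      by (intro exI[of _ ?L]) simp
  qed
  have "\<exists>h. proper_planner X V h"
  proof (rule proper_planner_concat3[OF F M G])
    fix p assume "p \<in> V"
    then show "H (fst (fst (p, 0)), 1 - snd (p, 0)) = fst p \<and>
         H (fst (fst (p, 1)), 1 - snd (p, 1)) =
         g (h ((f (fst (fst (p, 0))), f (snd (fst (p, 0)))), snd (p, 0))) \<and>
         g (h ((f (fst (fst (p, 1))), f (snd (fst (p, 1)))), snd (p, 1))) =
         H (snd (fst (p, 0)), snd (p, 0)) \<and> H (snd (fst (p, 1)), snd (p, 1)) = snd p"
      using H(2) h by (auto simp: V_def proper_planner_iff_track)
  qed
  then show ?thesis by (simp add: V_def)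
qed

lemma p_TC_le_dominated:
  assumes f: "proper_cmap X Y f" and g: "proper_cmap Y X g" and gf: "properly_homotopic X X (g \<circ> f) id"
  shows "p_TC X \<le> p_TC Y"
proof (cases "p_TC Y")
  case (enat n)
  then obtain U where U: "proper_planners Y n U"
    by (rule p_TC_eq_enatE)
  let ?V = "\<lambda>i. {p \<in> topspace X \<times> topspace X. (f (fst p), f (snd p)) \<in> U i}"
  have fc: "continuous_map X Y f"
    using f by (simp add: proper_cmap_def)
  have "proper_planners X n ?V"
    unfolding proper_planners_def
  proof (intro conjI allI impI)
    show "(\<Union>i\<le>n. ?V i) = topspace X \<times> topspace X"
    proof (intro equalityI subsetI)
      fix p assume p: "p \<in> topspace X \<times> topspace X"
      then have "(f (fst p), f (snd p)) \<in> topspace Y \<times> topspace Y"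
        using fc by (auto simp: continuous_map_def)
      then show "p \<in> (\<Union>i\<le>n. ?V i)"
        using p U by (auto simp: proper_planners_def)
    qed auto
    fix i assume i: "i \<le> n"
    have "continuous_map (prod_topology X X) (prod_topology Y Y) (\<lambda>p. (f (fst p), f (snd p)))"
      using continuous_map_compose[OF continuous_map_fst fc, of X] continuous_map_compose[OF continuous_map_snd fc, of X]
      by (simp add: continuous_map_pairwise o_def)
    then show "openin (prod_topology X X) (?V i)"
      using openin_continuous_map_preimage[of "prod_topology X X" _ _ "U i"] U i
      by (simp add: proper_planners_def)
    show "\<exists>h. proper_planner X (?V i) h"
      using U i proper_planner_pullback[OF f g gf] by (auto simp: proper_planners_def)
  qed
  then show ?thesis
    using enat by (simp add: p_TC_le)
qed simp

lemma p_TC_properly_homotopy_equivalent: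
  assumes "properly_homotopy_equivalent X Y"
  shows "p_TC X = p_TC Y"
proof -
  obtain f g where "proper_cmap X Y f" "proper_cmap Y X g"
    "properly_homotopic X X (g \<circ> f) id" "properly_homotopic Y Y (f \<circ> g) id"
    using assms by (auto simp: properly_homotopy_equivalent_def)
  then show ?thesis
    by (intro antisym) (rule p_TC_le_dominated; assumption)+
qed

text \<open>Disjointness removes any condition of agreement on overlaps, and finiteness of F keeps
  the union of the compact sets belonging to the single planners compact.\<close>

lemma proper_planner_disjoint_Union:
  assumes F: "finite F" and W: "\<And>s. s \<in> F \<Longrightarrow> openin (prod_topology X X) (W s)"
    and h: "\<And>s. s \<in> F \<Longrightarrow> proper_planner X (W s) (h s)"
    and disj: "disjoint_family_on W F"
  shows "\<exists>h. proper_planner X (\<Union>s\<in>F. W s) h"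
proof -
  define U where "U = (\<Union>s\<in>F. W s)"
  let ?Q = "\<lambda>U. prod_topology (subtopology (prod_topology X X) U) unit_interval"
  have disj': "s = s'" if "s \<in> F" "s' \<in> F" "p \<in> W s" "p \<in> W s'" for s s' p
    using disj that by (auto simp: disjoint_family_on_def)
  define \<iota> where "\<iota> p = (SOME s. s \<in> F \<and> p \<in> W s)" for p
  have \<iota>: "\<iota> p = s" if "s \<in> F" "p \<in> W s" for p s
    unfolding \<iota>_def by (rule some_equality) (use that disj' in blast)+
  let ?h = "\<lambda>q. h (\<iota> (fst q)) q"
  have "continuous_map (?Q U) X ?h"
  proof (rule pasting_lemma)
    fix s assume s: "s \<in> F"
    have "W s = U \<inter> W s" using s by (auto simp: U_def)
    then have "openin (subtopology (prod_topology X X) U) (W s)"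
      using W[OF s] by (metis openin_subtopology_Int2)
    then show "openin (?Q U) (W s \<times> {0..1})"
      by (simp add: openin_prod_Times_iff)
    have "subtopology (?Q U) (W s \<times> {0..1}) = ?Q (W s)"
      using \<open>W s = U \<inter> W s\<close> by (simp add: subtopology_Times subtopology_subtopology)
    then show "continuous_map (subtopology (?Q U) (W s \<times> {0..1})) X (h s)"
      using h[OF s] by (simp add: proper_planner_def planner_def)
  next
    fix q assume "q \<in> topspace (?Q U)"
    then show "\<exists>j. j \<in> F \<and> q \<in> W j \<times> {0..1} \<and> h (\<iota> (fst q)) q = h j q"
      using \<iota> by (fastforce simp: U_def)
  qed (use disj' in auto)
  moreover have "\<exists>L. compactin X L \<and> (\<forall>p\<in>U. \<forall>t\<in>{0..1}. fst p \<notin> L \<and> snd p \<notin> L \<longrightarrow> ?h (p, t) \<notin> K)"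
    if K: "compactin X K" for K
  proof -
    have "\<exists>L. compactin X L \<and> (\<forall>p \<in> W s. \<forall>t \<in> {0..1}. fst p \<notin> L \<and> snd p \<notin> L \<longrightarrow> h s (p, t) \<notin> K)"
      if "s \<in> F" for s
      using h[OF that] K unfolding proper_planner_iff_track proper_track_def by meson
    then obtain L where L: "\<And>s. s \<in> F \<Longrightarrow> compactin X (L s)"
      "\<And>s p t. \<lbrakk>s \<in> F; p \<in> W s; t \<in> {0..1}; fst p \<notin> L s; snd p \<notin> L s\<rbrakk> \<Longrightarrow> h s (p, t) \<notin> K"
      by metis
    have "compactin X (\<Union>s\<in>F. L s)"
      using F L by (intro compactin_Union) auto
    moreover have "?h (p, t) \<notin> K"
      if "p \<in> U" "t \<in> {0..1}" "fst p \<notin> (\<Union>s\<in>F. L s)" "snd p \<notin> (\<Union>s\<in>F. L s)" for p t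
    proof -
      obtain s where s: "s \<in> F" "p \<in> W s"
        using \<open>p \<in> U\<close> by (auto simp: U_def)
      then show ?thesis
        using that L(2)[OF s] \<iota>[OF s] by auto
    qed
    ultimately show ?thesis by blast
  qed
  ultimately have "proper_track X U ?h"
    by (rule proper_trackI)
  moreover have "\<forall>p \<in> U. ?h (p, 0) = fst p \<and> ?h (p, 1) = snd p"
    using h \<iota> by (auto simp: U_def proper_planner_iff_track)
  ultimately show ?thesis
    unfolding proper_planner_iff_track U_def by blast
qed

section \<open>Exhaustions and coverings\<close>

lemma locally_compact_compact_neighbourhood:
  assumes X: "locally_compact_space X" and K: "compactin X K"
  obtains V L where "openin X V" "compactin X L" "K \<subseteq> V" "V \<subseteq> L"
proof -
  have "\<forall>x \<in> K. \<exists>U C. openin X U \<and> compactin X C \<and> x \<in> U \<and> U \<subseteq> C"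
    using X compactin_subset_topspace[OF K] by (auto simp: locally_compact_space_def subset_iff)
  then obtain U C where UC: "\<And>x. x \<in> K \<Longrightarrow> openin X (U x) \<and> compactin X (C x) \<and> x \<in> U x \<and> U x \<subseteq> C x"
    by metis
  then have "Ball (U ` K) (openin X)" "K \<subseteq> \<Union>(U ` K)" by auto
  then obtain \<F> where \<F>: "finite \<F>" "\<F> \<subseteq> U ` K" "K \<subseteq> \<Union>\<F>"
    using K unfolding compactin_def by meson
  then obtain S where S: "finite S" "S \<subseteq> K" "\<F> = U ` S"
    using finite_subset_image by metis
  show thesis
  proof
    show "openin X (\<Union>x\<in>S. U x)" using UC S by blast
    show "compactin X (\<Union>x\<in>S. C x)" using UC S by (intro compactin_Union) auto
    show "K \<subseteq> (\<Union>x\<in>S. U x)" using \<F> S by simp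
    show "(\<Union>x\<in>S. U x) \<subseteq> (\<Union>x\<in>S. C x)" using UC S by blast
  qed
qed

text \<open>The open sets between consecutive members are what puts every compact set inside a
  single \<open>K n\<close>: finitely many \<open>V n\<close> cover it, and the sequence
  increases.\<close>

lemma sigma_compact_exhaustion:
  assumes X: "sigma_compact_space X" "locally_compact_space X"
  obtains K V :: "nat \<Rightarrow> 'a set" where "\<And>n. compactin X (K n)" "\<And>n. openin X (V n)"
    "\<And>n. K n \<subseteq> V n" "\<And>n. V n \<subseteq> K (Suc n)" "(\<Union>n. K n) = topspace X"
    "\<And>C. compactin X C \<Longrightarrow> \<exists>n. C \<subseteq> K n"
proof -
  obtain \<K> where \<K>: "countable \<K>" "\<And>K. K \<in> \<K> \<Longrightarrow> compactin X K" "\<Union>\<K> = topspace X"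
    using X by (auto simp: sigma_compact_space_def)
  \<comment> \<open>Adding the empty set makes the family nonempty, so that it is the range of a
    sequence even if the given cover is empty.\<close>
  define C where "C = from_nat_into (insert {} \<K>)"
  have rC: "range C = insert {} \<K>"
    unfolding C_def using \<K>(1) by (intro range_from_nat_into) auto
  then have Cn: "compactin X (C n)" for n
    using \<K>(2) by (metis compactin_empty insertE rangeI)
  have "\<exists>K. \<forall>n. (compactin X (K n) \<and> C n \<subseteq> K n) \<and> (\<exists>V. openin X V \<and> K n \<subseteq> V \<and> V \<subseteq> K (Suc n))"
  proof (rule dependent_nat_choice)
    show "\<exists>K. compactin X K \<and> C 0 \<subseteq> K" using Cn by blast
    fix K n assume "compactin X K \<and> C n \<subseteq> K"
    then obtain V L where "openin X V" "compactin X L" "K \<subseteq> V" "V \<subseteq> L"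
      using locally_compact_compact_neighbourhood[OF X(2)] by metis
    then show "\<exists>L. (compactin X L \<and> C (Suc n) \<subseteq> L) \<and> (\<exists>V. openin X V \<and> K \<subseteq> V \<and> V \<subseteq> L)"
      using Cn[of "Suc n"] by (intro exI[of _ "L \<union> C (Suc n)"]) (auto simp: compactin_Un)
  qed
  then obtain K where K: "\<And>n. compactin X (K n)" "\<And>n. C n \<subseteq> K n"
    "\<And>n. \<exists>V. openin X V \<and> K n \<subseteq> V \<and> V \<subseteq> K (Suc n)" by blast
  then obtain V where V: "\<And>n. openin X (V n)" "\<And>n. K n \<subseteq> V n" "\<And>n. V n \<subseteq> K (Suc n)"
    by metis
  have cover: "(\<Union>n. K n) = topspace X"
  proof
    show "(\<Union>n. K n) \<subseteq> topspace X" using K(1) compactin_subset_topspace by blast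
    have "topspace X = \<Union>(range C)" using rC \<K>(3) by simp
    then show "topspace X \<subseteq> (\<Union>n. K n)" using K(2) by blast
  qed
  have mono: "incseq K"
    using V by (intro incseq_SucI) blast
  have "\<exists>n. D \<subseteq> K n" if D: "compactin X D" for D
  proof -
    have "topspace X \<subseteq> \<Union>(range V)"
      unfolding cover[symmetric] using V(2) by (intro UN_mono) auto
    then have "D \<subseteq> \<Union>(range V)"
      using compactin_subset_topspace[OF D] by simp
    moreover have "Ball (range V) (openin X)" using V by blast
    ultimately obtain \<F> where "finite \<F>" "\<F> \<subseteq> range V" "D \<subseteq> \<Union>\<F>"
      using D unfolding compactin_def by meson
    then obtain S where S: "finite S" "\<F> = V ` S"
      using finite_subset_image by metis
    have "V i \<subseteq> K (Suc (Max S))" if "i \<in> S" for i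
      using V(3)[of i] incseqD[OF mono, of "Suc i" "Suc (Max S)"] S that by auto
    then show ?thesis
      using \<open>D \<subseteq> \<Union>\<F>\<close> S by blast
  qed
  then show thesis using that K V cover by blast
qed

text \<open>r is a sum of Urysohn functions \<open>f n\<close> that vanish on \<open>K n\<close> and
  equal 1 off \<open>V n\<close>. On \<open>V n\<close> only the terms with index at most n survive,
  which gives continuity; off \<open>V n\<close> the terms 0 to n all equal 1, which gives
  properness.\<close>

lemma ex_proper_cmap_halfline:
  assumes "normal_space X" and X: "Hausdorff_space X" "sigma_compact_space X" "locally_compact_space X"
  obtains r where "proper_cmap X halfline r"
proof -
  obtain K V :: "nat \<Rightarrow> 'a set" where K: "\<And>n. compactin X (K n)" and V: "\<And>n. openin X (V n)"
    and KV: "\<And>n. K n \<subseteq> V n" "\<And>n. V n \<subseteq> K (Suc n)" and cover: "(\<Union>n. K n) = topspace X"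
    using sigma_compact_exhaustion[OF X(2,3)] by metis
  have mono: "K m \<subseteq> K n" if "m \<le> n" for m n
    using KV incseqD[OF incseq_SucI, of K m n] that by blast
  have "\<exists>f. continuous_map X (top_of_set {0..1}) f \<and> f ` K n \<subseteq> {0} \<and> f ` (topspace X - V n) \<subseteq> {1::real}" for n
    using Urysohn_lemma[of X "K n" "topspace X - V n" 0 1] K V KV X(1) \<open>normal_space X\<close>
    by (metis Diff_disjoint compactin_imp_closedin disjnt_def disjnt_subset1 closedin_diff closedin_topspace zero_le_one)
  then obtain f :: "nat \<Rightarrow> 'a \<Rightarrow> real" where f: "\<And>n. continuous_map X (top_of_set {0..1}) (f n)"
    "\<And>n x. x \<in> K n \<Longrightarrow> f n x = 0" "\<And>n x. x \<in> topspace X - V n \<Longrightarrow> f n x = 1"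
    by (metis (no_types, lifting) image_subset_iff singletonD)
  have fr: "continuous_map X euclideanreal (f n)" and f0: "x \<in> topspace X \<Longrightarrow> 0 \<le> f n x" for n x
    using f(1)[of n] by (auto simp: continuous_map_in_subtopology Pi_iff)
  \<comment> \<open>This is the full series of the \<open>f m\<close>: the omitted terms vanish, and
    the index set is finite because x lies in \<open>K m\<close> from some m on.\<close>
  define r where "r x = (\<Sum>m | x \<notin> K m. f m x)" for x
  have finK: "{m. x \<notin> K m} \<subseteq> {..n}" if "x \<in> V n" for x n
    using that KV(2)[of n] mono by (auto simp: not_le Suc_le_eq) (metis Suc_leI not_le subsetD)
  have r_eq: "r x = (\<Sum>m\<le>n. f m x)" if "x \<in> V n" for x n
    unfolding r_def using finK[OF that] f(2) by (intro sum.mono_neutral_left) auto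
  have inV: "\<exists>n. x \<in> V n" if "x \<in> topspace X" for x
    using that cover KV by blast
  have r_ge: "real n + 1 \<le> r x" if x: "x \<in> topspace X" "x \<notin> V n" for x n
  proof -
    obtain k where k: "x \<in> V k" using inV[OF x(1)] by blast
    have nm: "x \<notin> V m" if "m \<le> n" for m
    proof (cases "m = n")
      case False
      then have "V m \<subseteq> V n" using KV mono[of "Suc m" n] that by force
      then show ?thesis using \<open>x \<notin> V n\<close> by blast
    qed (use \<open>x \<notin> V n\<close> in simp)
    have "real n + 1 = (\<Sum>m\<le>n. f m x)"
      using f(3) nm x(1) by simp
    also have "\<dots> \<le> r x"
      unfolding r_def
    proof (rule sum_mono2)
      show "finite {m. x \<notin> K m}" using finK[OF k] finite_subset by blast
      show "{..n} \<subseteq> {m. x \<notin> K m}" using nm KV by blast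
    qed (use f0 x in auto)
    finally show ?thesis .
  qed
  have "continuous_map X euclideanreal r"
  proof (rule pasting_lemma[where I = UNIV and T = V and f = "\<lambda>n x. \<Sum>m\<le>n. f m x"])
    show "continuous_map (subtopology X (V n)) euclideanreal (\<lambda>x. \<Sum>m\<le>n. f m x)" for n
      by (intro continuous_map_from_subtopology continuous_intros fr) auto
    show "(\<Sum>m\<le>i. f m x) = (\<Sum>m\<le>j. f m x)" if "x \<in> topspace X \<inter> V i \<inter> V j" for i j x
      using that r_eq[of x i] r_eq[of x j] by simp
    show "\<exists>j. j \<in> UNIV \<and> x \<in> V j \<and> r x = (\<Sum>m\<le>j. f m x)" if "x \<in> topspace X" for x
      using inV[OF that] r_eq[of x] by blast
  qed (use V in simp)
  moreover have "0 \<le> r x" if "x \<in> topspace X" for x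
    unfolding r_def using f0 that by (intro sum_nonneg) auto
  ultimately have "continuous_map X halfline r"
    by (auto simp: continuous_map_in_subtopology)
  moreover have "Hausdorff_space halfline"
    by (simp add: Hausdorff_space_subtopology)
  ultimately have "proper_cmap X halfline r"
  proof (rule proper_cmapI)
    fix C assume "compactin halfline C"
    then obtain M where M: "C \<subseteq> {0..M}" by (rule compactin_halflineE)
    obtain n :: nat where n: "M < real n" using reals_Archimedean2 by blast
    have "x \<in> K (Suc n)" if "x \<in> topspace X" "r x \<in> C" for x
    proof -
      have "r x \<le> M" using that M by auto
      then show ?thesis using r_ge[of x n] that n KV(2)[of n] by force
    qed
    then show "\<exists>D. compactin X D \<and> {x \<in> topspace X. r x \<in> C} \<subseteq> D"
      using K by blast
  qed
  then show thesis using that by blast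
qed

text \<open>The open set W collects the members that have already been shrunk. At each step the
  closed set of points covered by \<open>U i\<close> alone is separated, and the smaller set B joins
  W for the rest of the induction.\<close>

lemma normal_space_shrink:
  assumes X: "normal_space X" and I: "finite I"
    and U: "\<And>i. i \<in> I \<Longrightarrow> openin X (U i)" and W: "openin X W"
    and cover: "topspace X \<subseteq> W \<union> (\<Union>i\<in>I. U i)"
  shows "\<exists>V. (\<forall>i\<in>I. openin X (V i) \<and> X closure_of V i \<subseteq> U i) \<and> topspace X \<subseteq> W \<union> (\<Union>i\<in>I. V i)"
  using I U W cover
proof (induction I arbitrary: W rule: finite_induct)
  case (insert i I)
  let ?C = "topspace X - (W \<union> (\<Union>i\<in>I. U i))"
  have "openin X (W \<union> (\<Union>i\<in>I. U i))" using insert.prems by (intro openin_Un openin_Union) auto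
  then have "closedin X ?C" by blast
  moreover have "?C \<subseteq> U i" "openin X (U i)" using insert by auto
  ultimately obtain B where B: "openin X B" "?C \<subseteq> B" "X closure_of B \<subseteq> U i"
    using X unfolding normal_space_alt by meson
  have "\<exists>V. (\<forall>i\<in>I. openin X (V i) \<and> X closure_of V i \<subseteq> U i) \<and> topspace X \<subseteq> (W \<union> B) \<union> (\<Union>i\<in>I. V i)"
    using insert B by (intro insert.IH) auto
  then obtain V where "\<forall>i\<in>I. openin X (V i) \<and> X closure_of V i \<subseteq> U i" "topspace X \<subseteq> (W \<union> B) \<union> (\<Union>i\<in>I. V i)"
    by blast
  moreover have "\<And>j. j \<in> I \<Longrightarrow> j \<noteq> i" using insert by blast
  ultimately show ?case
    using B by (intro exI[of _ "V(i := B)"]) fastforce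
qed auto

corollary normal_space_shrink_cover:
  fixes U :: "nat \<Rightarrow> 'a set"
  assumes "normal_space X" "\<And>i. i \<le> n \<Longrightarrow> openin X (U i)" "(\<Union>i\<le>n. U i) = topspace X"
  obtains V where "\<And>i. i \<le> n \<Longrightarrow> openin X (V i)" "\<And>i. i \<le> n \<Longrightarrow> X closure_of V i \<subseteq> U i"
    "(\<Union>i\<le>n. V i) = topspace X"
proof -
  obtain V where V: "\<forall>i\<in>{..n}. openin X (V i) \<and> X closure_of V i \<subseteq> U i"
    "topspace X \<subseteq> {} \<union> (\<Union>i\<in>{..n}. V i)"
    using normal_space_shrink[OF assms(1), of "{..n}" U "{}"] assms by auto
  moreover have "V i \<subseteq> topspace X" if "i \<le> n" for i
    using V(1) that openin_subset[of X "V i"] by auto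
  ultimately have "(\<Union>i\<le>n. V i) = topspace X"
    by (intro equalityI UN_least) auto
  with V show thesis by (intro that[of V]) simp_all
qed

lemma continuous_map_convex_halfline:
  assumes "continuous_map Q halfline f" "continuous_map Q halfline g" "continuous_map Q unit_interval s"
  shows "continuous_map Q halfline (\<lambda>q. (1 - s q) * f q + s q * g q)"
proof -
  have "(1 - s q) * f q + s q * g q \<ge> 0" if "q \<in> topspace Q" for q
    using assms that by (auto simp: continuous_map_in_subtopology Pi_iff)
  then show ?thesis
    using assms by (auto simp: continuous_map_in_subtopology intro!: continuous_intros)
qed

text \<open>The source of properness for straight-line homotopies in the half-line: a bound exceeded
  at both ends is exceeded all along the segment.\<close>

lemma convex_comb_gt:
  fixes a b M :: real
  assumes "M < a" "M < b" "t \<in> {0..1}"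
  shows "M < (1 - t) * a + t * b"
proof (cases "t = 1")
  case False
  then have "(1 - t) * M < (1 - t) * a" "t * M \<le> t * b"
    using assms by (auto intro: mult_left_mono)
  then have "(1 - t) * M + t * M < (1 - t) * a + t * b" by linarith
  then show ?thesis by (simp add: algebra_simps)
qed (use assms in simp)


section \<open>Proper category\<close>

definition proper_cat_cover :: "(real \<Rightarrow> 'a) \<Rightarrow> 'a topology \<Rightarrow> nat \<Rightarrow> (nat \<Rightarrow> 'a set) \<Rightarrow> bool" where
  "proper_cat_cover \<alpha> X n U \<longleftrightarrow> (\<Union>i\<le>n. U i) = topspace X \<and>
     (\<forall>i\<le>n. openin X (U i) \<and>
        (\<exists>r. proper_cmap (subtopology X (X closure_of U i)) halfline r \<and>
             properly_homotopic (subtopology X (X closure_of U i)) X (\<alpha> \<circ> r) id))"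

lemma p_cat_le: "proper_cat_cover \<alpha> X n U \<Longrightarrow> p_cat \<alpha> X \<le> enat n"
  unfolding p_cat_def proper_cat_cover_def by (rule Inf_enat_le, rule exI)

lemma p_cat_eq_enatE:
  assumes "p_cat \<alpha> X = enat n"
  obtains U where "proper_cat_cover \<alpha> X n U"
proof -
  have "\<exists>U. proper_cat_cover \<alpha> X n U"
    using assms unfolding p_cat_def proper_cat_cover_def by (rule Inf_enat_attained)
  then show thesis using that by blast
qed

text \<open>As r and \<alpha> are proper, the pair (\<open>\<alpha> (r x)\<close>, x) leaves every
  compact set in both coordinates when x does. This is exactly the situation in which a section is
  controlled, so the homotopy along the sections is proper.\<close>

lemma p_cat_le_p_TC:
  assumes "normal_space X" "P_infinity X" and \<alpha>: "ray X \<alpha>"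
  shows "p_cat \<alpha> X \<le> p_TC X"
proof (cases "p_TC X")
  case (enat n)
  then obtain U where U: "proper_planners X n U"
    by (rule p_TC_eq_enatE)
  have X: "Hausdorff_space X" "sigma_compact_space X" "locally_compact_space X"
    using assms by (auto simp: P_infinity_def)
  obtain r where r: "proper_cmap X halfline r"
    using ex_proper_cmap_halfline[OF assms(1) X] .
  have rc: "continuous_map X halfline r" and \<alpha>c: "continuous_map halfline X \<alpha>"
    using r \<alpha> by (auto simp: proper_cmap_def ray_def)
  have arc: "continuous_map X X (\<lambda>x. \<alpha> (r x))"
    using continuous_map_compose[OF rc \<alpha>c] by (simp add: o_def)
  define W where "W i = {x \<in> topspace X. (\<alpha> (r x), x) \<in> U i}" for i
  have gr: "continuous_map X (prod_topology X X) (\<lambda>x. (\<alpha> (r x), x))"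
    using arc by (simp add: continuous_map_pairwise o_def continuous_map_id[unfolded id_def])
  have "openin X (W i)" if "i \<le> n" for i
    unfolding W_def using U that openin_continuous_map_preimage[OF gr] by (simp add: proper_planners_def)
  moreover have "(\<Union>i\<le>n. W i) = topspace X"
  proof (intro equalityI subsetI)
    fix x assume x: "x \<in> topspace X"
    then have "(\<alpha> (r x), x) \<in> topspace X \<times> topspace X"
      using arc by (auto simp: continuous_map_def)
    then show "x \<in> (\<Union>i\<le>n. W i)"
      using U x by (auto simp: W_def proper_planners_def)
  qed (auto simp: W_def)
  \<comment> \<open>The contraction has to be defined on the closure of each member, so the cover is
    shrunk until the closures fit into the sets over which sections exist.\<close>
  ultimately obtain V where V: "\<And>i. i \<le> n \<Longrightarrow> openin X (V i)" "\<And>i. i \<le> n \<Longrightarrow> X closure_of V i \<subseteq> W i"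
    "(\<Union>i\<le>n. V i) = topspace X"
    using normal_space_shrink_cover[OF assms(1)] by metis
  have "proper_cat_cover \<alpha> X n V"
    unfolding proper_cat_cover_def
  proof (intro conjI allI impI V)
    fix i assume i: "i \<le> n"
    define C where "C = X closure_of V i"
    have C: "closedin X C" "C \<subseteq> W i" using V i by (auto simp: C_def)
    let ?Q = "prod_topology (subtopology X C) unit_interval"
    have "proper_cmap (subtopology X C) halfline r"
    proof (rule proper_cmapI)
      show "continuous_map (subtopology X C) halfline r"
        using rc by (rule continuous_map_from_subtopology)
      show "Hausdorff_space halfline" by (simp add: Hausdorff_space_subtopology)
      fix K assume "compactin halfline K"
      then have "compactin X (C \<inter> {x \<in> topspace X. r x \<in> K})"
        using r C by (intro closed_Int_compactin) (auto simp: proper_cmap_def)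
      then show "\<exists>D. compactin (subtopology X C) D \<and> {x \<in> topspace (subtopology X C). r x \<in> K} \<subseteq> D"
        by (intro exI[of _ "C \<inter> {x \<in> topspace X. r x \<in> K}"]) (auto simp: compactin_subtopology)
    qed
    moreover have "properly_homotopic (subtopology X C) X (\<alpha> \<circ> r) id"
    proof -
      obtain h where h: "proper_planner X (U i) h"
        using U i by (auto simp: proper_planners_def)
      let ?H = "\<lambda>q. h ((\<alpha> (r (fst q)), fst q), snd q)"
      have "proper_cmap ?Q X ?H"
      proof (rule proper_cmapI[OF _ X(1)])
        have "continuous_map ?Q X fst"
          using continuous_map_fst continuous_map_in_subtopology by blast
        from continuous_map_compose[OF this gr]
        have "continuous_map ?Q (subtopology (prod_topology X X) (U i)) (\<lambda>q. (\<alpha> (r (fst q)), fst q))"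
          using C by (auto simp: continuous_map_in_subtopology o_def W_def)
        then have "continuous_map ?Q (prod_topology (subtopology (prod_topology X X) (U i)) unit_interval)
            (\<lambda>q. ((\<alpha> (r (fst q)), fst q), snd q))"
          by (simp add: continuous_map_pairwise[of _ "subtopology (prod_topology X X) (U i)"] o_def continuous_map_snd)
        from continuous_map_compose[OF this, of X h] h
        show "continuous_map ?Q X ?H"
          by (simp add: proper_planner_def planner_def o_def)
        fix K assume K: "compactin X K"
        have "proper_track X (U i) h" using h by (simp add: proper_planner_iff_track)
        from proper_trackE[OF this K] obtain L where L: "compactin X L"
          "\<And>p t. \<lbrakk>p \<in> U i; t \<in> {0..1}; fst p \<notin> L; snd p \<notin> L\<rbrakk> \<Longrightarrow> h (p, t) \<notin> K" by metis
        \<comment> \<open>The points of C for which at least one coordinate of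
          (\<open>\<alpha> (r x)\<close>, x) lies in L; only over these can the homotopy meet
          K.\<close>
        let ?D = "C \<inter> (L \<union> {x \<in> topspace X. r x \<in> {s \<in> {0..}. \<alpha> s \<in> L}})"
        have "compactin halfline {s \<in> {0..}. \<alpha> s \<in> L}"
          using \<alpha> L(1) proper_cmap_compactin[of halfline X \<alpha> L] by (simp add: ray_def)
        from proper_cmap_compactin[OF r this] have "compactin X ?D"
          using L(1) C(1) by (intro closed_Int_compactin compactin_Un)
        then have "compactin ?Q (?D \<times> {0..1})"
          by (auto simp: compactin_Times compactin_subtopology)
        moreover have "{q \<in> topspace ?Q. ?H q \<in> K} \<subseteq> ?D \<times> {0..1}"
        proof
          fix q assume q: "q \<in> {q \<in> topspace ?Q. ?H q \<in> K}"
          have "r (fst q) \<in> {0..}"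
            using rc q by (auto simp: continuous_map_in_subtopology Pi_iff)
          have "(\<alpha> (r (fst q)), fst q) \<in> U i"
            using q C(2) by (auto simp: W_def subset_iff)
          moreover have "snd q \<in> {0..1}" "?H q \<in> K"
            using q by auto
          ultimately have "\<alpha> (r (fst q)) \<in> L \<or> fst q \<in> L"
            using L(2)[of "(\<alpha> (r (fst q)), fst q)" "snd q"] unfolding fst_conv snd_conv by blast
          then show "q \<in> ?D \<times> {0..1}"
            using q \<open>r (fst q) \<in> {0..}\<close> by auto
        qed
        ultimately show "\<exists>D. compactin ?Q D \<and> {q \<in> topspace ?Q. ?H q \<in> K} \<subseteq> D"
          by blast
      qed
      moreover have "\<forall>x \<in> topspace (subtopology X C). ?H (x, 0) = (\<alpha> \<circ> r) x \<and> ?H (x, 1) = id x"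
        using h C by (auto simp: proper_planner_iff_track W_def)
      ultimately show ?thesis
        unfolding properly_homotopic_def by blast
    qed
    ultimately show "\<exists>r. proper_cmap (subtopology X (X closure_of V i)) halfline r \<and>
             properly_homotopic (subtopology X (X closure_of V i)) X (\<alpha> \<circ> r) id"
      unfolding C_def by blast
  qed
  then show ?thesis
    using enat by (simp add: p_cat_le)
qed simp

section \<open>The upper bound by twice the proper category\<close>

text \<open>The path from x to y goes from x to \<open>\<alpha> (r1 x)\<close> by the first
  contraction reversed, along the ray by the straight segment from \<open>r1 x\<close> to
  \<open>r2 y\<close>, and from \<open>\<alpha> (r2 y)\<close> to y by the second contraction.
  Points far out have large values of r1 and r2, so the segment stays large.\<close>

lemma proper_planner_of_contractions:
  assumes U: "U \<subseteq> (topspace X \<inter> A) \<times> (topspace X \<inter> B)" and \<alpha>: "ray X \<alpha>"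
    and r1: "proper_cmap (subtopology X A) halfline r1" and r2: "proper_cmap (subtopology X B) halfline r2"
    and h1: "properly_homotopic (subtopology X A) X (\<alpha> \<circ> r1) id"
    and h2: "properly_homotopic (subtopology X B) X (\<alpha> \<circ> r2) id"
  shows "\<exists>h. proper_planner X U h"
proof -
  let ?Q = "prod_topology (subtopology (prod_topology X X) U) unit_interval"
  have U': "U \<subseteq> topspace X \<times> topspace X" and UA: "\<And>p. p \<in> U \<Longrightarrow> fst p \<in> A \<and> snd p \<in> B"
    using U by auto
  obtain H1 where H1: "proper_cmap (prod_topology (subtopology X A) unit_interval) X H1"
    "\<And>x. x \<in> topspace X \<inter> A \<Longrightarrow> H1 (x, 0) = \<alpha> (r1 x) \<and> H1 (x, 1) = x"
    using h1 by (auto simp: properly_homotopic_def)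
  obtain H2 where H2: "proper_cmap (prod_topology (subtopology X B) unit_interval) X H2"
    "\<And>x. x \<in> topspace X \<inter> B \<Longrightarrow> H2 (x, 0) = \<alpha> (r2 x) \<and> H2 (x, 1) = x"
    using h2 by (auto simp: properly_homotopic_def)
  have F: "proper_track X U (\<lambda>q. H1 (fst (fst q), 1 - snd q))"
    by (rule proper_track_of_homotopy[OF H1(1) U'])
      (use UA in \<open>auto intro: continuous_map_track_projections\<close>)
  have G: "proper_track X U (\<lambda>q. H2 (snd (fst q), snd q))"
    by (rule proper_track_of_homotopy[OF H2(1) U'])
      (use UA in \<open>auto intro: continuous_map_track_projections\<close>)
  let ?c = "\<lambda>q. (1 - snd q) * r1 (fst (fst q)) + snd q * r2 (snd (fst q))"
  have M: "proper_track X U (\<lambda>q. \<alpha> (?c q))"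
  proof (rule proper_trackI)
    have r1c: "continuous_map (subtopology X A) halfline r1" and r2c: "continuous_map (subtopology X B) halfline r2"
      and \<alpha>c: "continuous_map halfline X \<alpha>"
      using r1 r2 \<alpha> by (auto simp: proper_cmap_def ray_def)
    have "continuous_map ?Q (subtopology X A) (\<lambda>q. fst (fst q))"
      using continuous_map_track_projections(1)[of X U] UA by (auto simp: continuous_map_in_subtopology)
    from continuous_map_compose[OF this r1c]
    have 1: "continuous_map ?Q halfline (\<lambda>q. r1 (fst (fst q)))" by (simp add: o_def)
    have "continuous_map ?Q (subtopology X B) (\<lambda>q. snd (fst q))"
      using continuous_map_track_projections(2)[of X U] UA by (auto simp: continuous_map_in_subtopology)
    from continuous_map_compose[OF this r2c]
    have 2: "continuous_map ?Q halfline (\<lambda>q. r2 (snd (fst q)))" by (simp add: o_def)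
    from continuous_map_compose[OF continuous_map_convex_halfline[OF 1 2 continuous_map_track_projections(3)] \<alpha>c]
    show "continuous_map ?Q X (\<lambda>q. \<alpha> (?c q))" by (simp add: o_def)
    fix K assume "compactin X K"
    then have "compactin halfline {s \<in> topspace halfline. \<alpha> s \<in> K}"
      using \<alpha> proper_cmap_compactin unfolding ray_def by blast
    then obtain M where M: "{s \<in> topspace halfline. \<alpha> s \<in> K} \<subseteq> {0..M}"
      by (rule compactin_halflineE)
    let ?L1 = "{x \<in> topspace (subtopology X A). r1 x \<in> {0..M}}"
    let ?L2 = "{x \<in> topspace (subtopology X B). r2 x \<in> {0..M}}"
    have "compactin (subtopology X A) ?L1" "compactin (subtopology X B) ?L2"
      using proper_cmap_compactin r1 r2 compactin_halfline_interval by blast+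
    then have "compactin X (?L1 \<union> ?L2)"
      by (simp add: compactin_subtopology compactin_Un)
    moreover have "\<alpha> (?c (p, t)) \<notin> K"
      if p: "p \<in> U" "t \<in> {0..1}" "fst p \<notin> ?L1 \<union> ?L2" "snd p \<notin> ?L1 \<union> ?L2" for p t
    proof -
      have "fst p \<in> topspace (subtopology X A)" "snd p \<in> topspace (subtopology X B)"
        using p(1) U by auto
      moreover from this have "0 \<le> r1 (fst p)" "0 \<le> r2 (snd p)"
        using r1c r2c by (auto simp: continuous_map_in_subtopology Pi_iff)
      ultimately have gt: "M < r1 (fst p)" "M < r2 (snd p)"
        using p(3,4) by auto
      have "0 \<le> ?c (p, t)"
        using \<open>0 \<le> r1 (fst p)\<close> \<open>0 \<le> r2 (snd p)\<close> p(2) by auto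
      moreover have "M < ?c (p, t)"
        using convex_comb_gt[OF gt p(2)] by simp
      ultimately show ?thesis using M by force
    qed
    ultimately show "\<exists>L. compactin X L \<and>
        (\<forall>p\<in>U. \<forall>t\<in>{0..1}. fst p \<notin> L \<and> snd p \<notin> L \<longrightarrow> \<alpha> (?c (p, t)) \<notin> K)"
      by blast
  qed
  show ?thesis
  proof (rule proper_planner_concat3[OF F M G])
    fix p assume "p \<in> U"
    then have "fst p \<in> topspace X \<inter> A" "snd p \<in> topspace X \<inter> B"
      using U by auto
    then show "H1 (fst (fst (p, 0)), 1 - snd (p, 0)) = fst p \<and>
         H1 (fst (fst (p, 1)), 1 - snd (p, 1)) = \<alpha> (?c (p, 0)) \<and>
         \<alpha> (?c (p, 1)) = H2 (snd (fst (p, 0)), snd (p, 0)) \<and>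
         H2 (snd (fst (p, 1)), snd (p, 1)) = snd p"
      using H1(2) H2(2) by simp
  qed
qed

lemma openin_Collect_finite_Ball:
  assumes "finite S" "\<And>s. s \<in> S \<Longrightarrow> openin X {x \<in> topspace X. P s x}"
  shows "openin X {x \<in> topspace X. \<forall>s\<in>S. P s x}"
  using assms
proof (induction S rule: finite_induct)
  case (insert s S)
  have "{x \<in> topspace X. \<forall>s\<in>insert s S. P s x} =
      {x \<in> topspace X. P s x} \<inter> {x \<in> topspace X. \<forall>s\<in>S. P s x}" by auto
  then show ?case using insert by auto
qed simp

text \<open>The partition-of-unity argument: for a set \<open>S\<close> of indices, the points at which all functions
  with index in \<open>S\<close> are larger than all the others form an open set, and these open sets are
  disjoint for different \<open>S\<close> of the same size. Since the functions attain the value 1 at every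
  point in both coordinates, only the \<open>2n + 1\<close> sizes \<open>2, \<dots>, 2n + 2\<close> are needed.\<close>

lemma p_TC_le_twice_p_cat:
  assumes X: "normal_space X" and \<alpha>: "ray X \<alpha>"
  shows "p_TC X \<le> 2 * p_cat \<alpha> X"
proof (cases "p_cat \<alpha> X")
  case (enat n)
  then obtain U where U: "proper_cat_cover \<alpha> X n U"
    by (rule p_cat_eq_enatE)
  have Uo: "\<And>i. i \<le> n \<Longrightarrow> openin X (U i)" and Uc: "(\<Union>i\<le>n. U i) = topspace X"
    using U by (auto simp: proper_cat_cover_def)
  obtain V where V: "\<And>i. i \<le> n \<Longrightarrow> openin X (V i)" "\<And>i. i \<le> n \<Longrightarrow> X closure_of V i \<subseteq> U i"
    "(\<Union>i\<le>n. V i) = topspace X"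
    using normal_space_shrink_cover[OF X Uo Uc] by metis
  have "\<exists>f. continuous_map X (top_of_set {0..1}) f \<and> f ` (topspace X - U i) \<subseteq> {0::real} \<and> f ` (X closure_of V i) \<subseteq> {1}"
    if "i \<le> n" for i
  proof -
    have "closedin X (topspace X - U i)" "disjnt (topspace X - U i) (X closure_of V i)"
      using Uo[OF that] V(2)[OF that] by (auto simp: disjnt_def)
    then show ?thesis
      using Urysohn_lemma[OF X _ closedin_closure_of, of _ "V i" 0 1] by (metis zero_le_one)
  qed
  then obtain \<phi> :: "nat \<Rightarrow> 'a \<Rightarrow> real" where \<phi>: "\<And>i. i \<le> n \<Longrightarrow> continuous_map X (top_of_set {0..1}) (\<phi> i)"
    "\<And>i. i \<le> n \<Longrightarrow> \<phi> i ` (topspace X - U i) \<subseteq> {0}" "\<And>i. i \<le> n \<Longrightarrow> \<phi> i ` (X closure_of V i) \<subseteq> {1}"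
    by metis
  let ?P = "prod_topology X X"
  \<comment> \<open>The Boolean tells the coordinate on which the bump function is evaluated, so
    both coordinates contribute their own n + 1 functions.\<close>
  define I where "I = {..n} \<times> (UNIV :: bool set)"
  have finI: "finite I" "card I = 2 * n + 2" by (simp_all add: I_def card_cartesian_product)
  define f where "f s p = \<phi> (fst s) (if snd s then fst p else snd p)" for s :: "nat \<times> bool" and p
  have fc: "continuous_map ?P (top_of_set {0..1}) (f s)" if "s \<in> I" for s
    using continuous_map_compose[OF continuous_map_fst \<phi>(1), of "fst s" X]
      continuous_map_compose[OF continuous_map_snd \<phi>(1), of "fst s" X] that
    unfolding f_def by (cases "snd s") (auto simp: o_def I_def)
  have fc': "continuous_map ?P euclideanreal (f s)" if "s \<in> I" for s
    using fc[OF that] by (simp add: continuous_map_in_subtopology)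
  have f01: "f s p \<in> {0..1}" if "s \<in> I" "p \<in> topspace ?P" for s p
    using continuous_map_funspace[OF fc[OF that(1)]] that(2) by (metis PiE topspace_euclidean_subtopology)
  \<comment> \<open>Positivity is a condition of its own because of the case S = I, where no other
    function is left to compare with.\<close>
  define W where "W S = {p \<in> topspace ?P. \<forall>s\<in>S. 0 < f s p \<and> (\<forall>t \<in> I - S. f t p < f s p)}" for S
  \<comment> \<open>An index for each coordinate, at which the function is positive, places
    \<open>W S\<close> inside a product of two members of the cover. It also forces at least two
    elements, hence the shift by 2.\<close>
  define \<S> where "\<S> k = {S. S \<subseteq> I \<and> card S = k + 2 \<and> (\<exists>i. (i, True) \<in> S) \<and> (\<exists>i. (i, False) \<in> S)}" for k
  have finS: "finite (\<S> k)" for k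
    by (rule finite_subset[of _ "Pow I"]) (auto simp: \<S>_def finI)
  have Wo: "openin ?P (W S)" if S: "S \<in> \<S> k" for S k
  proof -
    have SI: "S \<subseteq> I" "finite S" using S finI finite_subset by (auto simp: \<S>_def)
    have lt: "openin ?P {p \<in> topspace ?P. g p < h p}"
      if "continuous_map ?P euclideanreal g" "continuous_map ?P euclideanreal h" for g h
    proof -
      have "continuous_map ?P euclideanreal (\<lambda>p. h p - g p)"
        using that by (intro continuous_intros)
      from openin_continuous_map_preimage[OF this, of "{0<..}"] show ?thesis by simp
    qed
    have "openin ?P {p \<in> topspace ?P. 0 < f s p \<and> (\<forall>t \<in> I - S. f t p < f s p)}" if s: "s \<in> S" for s
    proof -
      have "openin ?P {p \<in> topspace ?P. \<forall>t \<in> I - S. f t p < f s p}"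
        using finI(1) s SI by (intro openin_Collect_finite_Ball lt fc') auto
      moreover have "openin ?P {p \<in> topspace ?P. 0 < f s p}"
        using s SI by (intro lt fc') auto
      moreover have "{p \<in> topspace ?P. 0 < f s p \<and> (\<forall>t \<in> I - S. f t p < f s p)} =
          {p \<in> topspace ?P. 0 < f s p} \<inter> {p \<in> topspace ?P. \<forall>t \<in> I - S. f t p < f s p}" by auto
      ultimately show ?thesis by (simp only: openin_Int)
    qed
    then show ?thesis
      unfolding W_def using SI by (intro openin_Collect_finite_Ball)
  qed
  have disj: "disjoint_family_on W (\<S> k)" for k
    unfolding disjoint_family_on_def
  proof (intro ballI impI)
    fix S T assume ST: "S \<in> \<S> k" "T \<in> \<S> k" "S \<noteq> T"
    then have *: "S \<subseteq> I" "T \<subseteq> I" "card S = card T"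
      by (auto simp: \<S>_def)
    then have "finite S" "finite T"
      using finI(1) finite_subset by blast+
    \<comment> \<open>Different finite sets of equal size are incomparable; an index from either
      difference then gives two contradictory strict inequalities.\<close>
    then have "\<not> S \<subseteq> T" "\<not> T \<subseteq> S"
      using ST(3) card_subset_eq *(3) by metis+
    then obtain s t where st: "s \<in> S - T" "t \<in> T - S" "s \<in> I" "t \<in> I"
      using * by blast
    have False if "p \<in> W S" "p \<in> W T" for p
    proof -
      have "f t p < f s p" "f s p < f t p"
        using that st by (auto simp: W_def)
      then show False by simp
    qed
    then show "W S \<inter> W T = {}" by blast
  qed
  have planner: "\<exists>h. proper_planner X (W S) h" if S: "S \<in> \<S> k" for S k
  proof -
    obtain i j where ij: "(i, True) \<in> S" "(j, False) \<in> S" "i \<le> n" "j \<le> n"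
      using S by (auto simp: \<S>_def I_def)
    have pos: "x \<in> U l" if "l \<le> n" "x \<in> topspace X" "0 < \<phi> l x" for l x
      using \<phi>(2)[OF that(1)] that(2,3) by (metis DiffI image_subset_iff less_irrefl singletonD)
    have "W S \<subseteq> U i \<times> U j"
    proof
      fix p assume p: "p \<in> W S"
      then have "fst p \<in> topspace X" "snd p \<in> topspace X"
        by (auto simp: W_def)
      moreover have "0 < f (i, True) p" "0 < f (j, False) p"
        using ij(1,2) p unfolding W_def by blast+
      ultimately show "p \<in> U i \<times> U j"
        using pos[OF ij(3)] pos[OF ij(4)] by (simp add: f_def mem_Times_iff)
    qed
    also have "\<dots> \<subseteq> (topspace X \<inter> X closure_of U i) \<times> (topspace X \<inter> X closure_of U j)"
      using openin_subset[OF Uo[OF ij(3)]] openin_subset[OF Uo[OF ij(4)]]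
      by (intro Sigma_mono Int_greatest closure_of_subset)
    finally have sub: "W S \<subseteq> \<dots>" .
    obtain r1 where "proper_cmap (subtopology X (X closure_of U i)) halfline r1"
        "properly_homotopic (subtopology X (X closure_of U i)) X (\<alpha> \<circ> r1) id"
      using U ij by (auto simp: proper_cat_cover_def)
    moreover obtain r2 where "proper_cmap (subtopology X (X closure_of U j)) halfline r2"
        "properly_homotopic (subtopology X (X closure_of U j)) X (\<alpha> \<circ> r2) id"
      using U ij by (auto simp: proper_cat_cover_def)
    ultimately show ?thesis
      using proper_planner_of_contractions[OF sub \<alpha>] by blast
  qed
  have "proper_planners X (2 * n) (\<lambda>k. \<Union>S\<in>\<S> k. W S)"
    unfolding proper_planners_def
  proof (intro conjI allI impI)
    show "(\<Union>k\<le>2*n. \<Union>S\<in>\<S> k. W S) = topspace X \<times> topspace X"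
    proof (intro equalityI subsetI)
      fix p assume p: "p \<in> topspace X \<times> topspace X"
      \<comment> \<open>The indices at which the maximal possible value 1 is attained: all other
        functions are strictly smaller, so p lies in \<open>W S\<close>.\<close>
      define S where "S = {s \<in> I. f s p = 1}"
      have one: "\<exists>i\<le>n. \<phi> i x = 1" if x: "x \<in> topspace X" for x
      proof -
        obtain i where i: "i \<le> n" "x \<in> V i"
          using x unfolding V(3)[symmetric] by blast
        then have "x \<in> X closure_of V i"
          using closure_of_subset[OF openin_subset[OF V(1)]] by blast
        then show ?thesis using \<phi>(3)[OF i(1)] i(1) by blast
      qed
      obtain i j where ij: "i \<le> n" "\<phi> i (fst p) = 1" "j \<le> n" "\<phi> j (snd p) = 1"
        using one[of "fst p"] one[of "snd p"] p unfolding mem_Times_iff by blast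
      then have ijS: "(i, True) \<in> S" "(j, False) \<in> S"
        by (simp_all add: S_def f_def I_def)
      have "S \<subseteq> I" unfolding S_def by blast
      then have "card S \<le> 2 * n + 2" "finite S"
        using card_mono[OF finI(1)] finI(2) finite_subset[OF _ finI(1)] by auto
      moreover have "card {(i, True), (j, False)} \<le> card S"
        using ijS \<open>finite S\<close> by (intro card_mono) auto
      ultimately have card: "card S = (card S - 2) + 2" "card S - 2 \<le> 2 * n" by auto
      then have SS: "S \<in> \<S> (card S - 2)"
        unfolding \<S>_def using \<open>S \<subseteq> I\<close> ijS card(1) by (intro CollectI conjI exI)
      have lt1: "f t p < 1" if "t \<in> I - S" for t
      proof -
        have "f t p \<in> {0..1}" by (rule f01) (use that p in auto)
        moreover have "f t p \<noteq> 1" using that unfolding S_def by blast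
        ultimately show ?thesis by simp
      qed
      have "p \<in> W S"
        unfolding W_def
      proof (intro CollectI conjI ballI)
        fix s assume "s \<in> S"
        then have "f s p = 1" unfolding S_def by blast
        then show "0 < f s p" "\<And>t. t \<in> I - S \<Longrightarrow> f t p < f s p"
          using lt1 by simp_all
      qed (use p in simp)
      then show "p \<in> (\<Union>k\<le>2*n. \<Union>S\<in>\<S> k. W S)"
        using SS card(2) by (intro UN_I[of "card S - 2"] UN_I[OF SS]) simp_all
    next
      fix p assume "p \<in> (\<Union>k\<le>2*n. \<Union>S\<in>\<S> k. W S)"
      then show "p \<in> topspace X \<times> topspace X"
        unfolding W_def topspace_prod_topology by blast
    qed
    fix k assume "k \<le> 2 * n"
    show "openin ?P (\<Union>S\<in>\<S> k. W S)"
      using Wo by blast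
    have "\<exists>h. \<forall>S\<in>\<S> k. proper_planner X (W S) (h S)"
      using planner by (intro bchoice ballI)
    then obtain h where h: "\<And>S. S \<in> \<S> k \<Longrightarrow> proper_planner X (W S) (h S)"
      by blast
    show "\<exists>h. proper_planner X (\<Union>S\<in>\<S> k. W S) h"
      by (rule proper_planner_disjoint_Union[OF finS Wo h disj])
  qed
  then have "p_TC X \<le> enat (2 * n)"
    by (rule p_TC_le)
  then show ?thesis
    by (simp add: enat numeral_eq_enat)
qed (simp add: numeral_eq_enat)


section \<open>Spaces of proper topological complexity zero\<close>

lemma p_TC_halfline: "p_TC halfline = 0"
proof -
  let ?T = "topspace halfline \<times> topspace halfline"
  let ?h = "\<lambda>q. (1 - snd q) * fst (fst q) + snd q * snd (fst q) :: real"
  have "proper_track halfline ?T ?h"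
  proof (rule proper_trackI)
    show "continuous_map (prod_topology (subtopology (prod_topology halfline halfline) ?T) unit_interval) halfline ?h"
      by (intro continuous_map_convex_halfline continuous_map_track_projections)
    fix K assume "compactin halfline K"
    then obtain M where M: "K \<subseteq> {0..M}" by (rule compactin_halflineE)
    have "?h (p, t) \<notin> K" if "p \<in> ?T" "t \<in> {0..1}" "fst p \<notin> {0..M}" "snd p \<notin> {0..M}" for p t
    proof -
      have "M < fst p" "M < snd p" using that by auto
      from convex_comb_gt[OF this that(2)] show ?thesis using M by auto
    qed
    then show "\<exists>L. compactin halfline L \<and>
        (\<forall>p\<in>?T. \<forall>t\<in>{0..1}. fst p \<notin> L \<and> snd p \<notin> L \<longrightarrow> ?h (p, t) \<notin> K)"
      using compactin_halfline_interval by blast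
  qed
  then have "proper_planner halfline ?T ?h"
    by (simp add: proper_planner_iff_track)
  then have "proper_planners halfline 0 (\<lambda>_. ?T)"
    unfolding proper_planners_def by (auto simp: openin_prod_Times_iff)
  from p_TC_le[OF this] show ?thesis
    by (simp add: zero_enat_def[symmetric])
qed

text \<open>The straight-line homotopy works for any two proper self-maps. Later it supplies the
  homotopy from \<open>r \<circ> \<alpha>\<close> to the identity although r and \<alpha> are known
  only through the other composite.\<close>

lemma proper_cmaps_halfline_homotopic:
  assumes f: "proper_cmap halfline halfline f" and g: "proper_cmap halfline halfline g"
  shows "properly_homotopic halfline halfline f g"
  unfolding properly_homotopic_def
proof (intro exI conjI ballI)
  let ?Q = "prod_topology halfline unit_interval"
  let ?h = "\<lambda>q. (1 - snd q) * f (fst q) + snd q * g (fst q)"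
  have fc: "continuous_map halfline halfline f" and gc: "continuous_map halfline halfline g"
    using f g by (auto simp: proper_cmap_def)
  show "proper_cmap ?Q halfline ?h"
  proof (rule proper_cmapI)
    have "continuous_map ?Q halfline (\<lambda>q. f (fst q))" "continuous_map ?Q halfline (\<lambda>q. g (fst q))"
      using continuous_map_compose[OF continuous_map_fst fc, of unit_interval]
        continuous_map_compose[OF continuous_map_fst gc, of unit_interval] by (simp_all add: o_def)
    then show "continuous_map ?Q halfline ?h"
      by (intro continuous_map_convex_halfline continuous_map_snd)
    show "Hausdorff_space halfline" by (simp add: Hausdorff_space_subtopology)
    fix K assume "compactin halfline K"
    then obtain M where M: "K \<subseteq> {0..M}" by (rule compactin_halflineE)
    let ?L = "{x \<in> topspace halfline. f x \<in> {0..M}} \<union> {x \<in> topspace halfline. g x \<in> {0..M}}"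
    have "compactin halfline ?L"
      using proper_cmap_compactin[OF f compactin_halfline_interval]
        proper_cmap_compactin[OF g compactin_halfline_interval] by (rule compactin_Un)
    then have "compactin ?Q (?L \<times> {0..1})"
      unfolding compactin_Times by (simp add: compactin_subtopology)
    moreover have "{q \<in> topspace ?Q. ?h q \<in> K} \<subseteq> ?L \<times> {0..1}"
    proof
      fix q assume q: "q \<in> {q \<in> topspace ?Q. ?h q \<in> K}"
      have "0 \<le> f (fst q)" "0 \<le> g (fst q)"
        using q fc gc by (auto simp: continuous_map_in_subtopology Pi_iff)
      moreover have "\<not> (M < f (fst q) \<and> M < g (fst q))"
        using convex_comb_gt[of M "f (fst q)" "g (fst q)" "snd q"] q M by force
      ultimately show "q \<in> ?L \<times> {0..1}"
        using q by auto
    qed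
    ultimately show "\<exists>C. compactin ?Q C \<and> {q \<in> topspace ?Q. ?h q \<in> K} \<subseteq> C"
      by blast
  qed
qed auto

text \<open>With a single planner on all pairs, any two points are joined. The points are chosen so
  far out that the n-th path avoids \<open>K n\<close>, which makes the concatenation of all paths
  proper.\<close>

lemma ray_of_p_TC_zero:
  assumes X: "P_infinity X" and h: "proper_planner X (topspace X \<times> topspace X) h"
  obtains \<alpha> where "ray X \<alpha>"
proof -
  have X': "Hausdorff_space X" "sigma_compact_space X" "locally_compact_space X" "\<not> compact_space X"
    using X by (auto simp: P_infinity_def)
  let ?T = "topspace X \<times> topspace X"
  obtain K where K: "\<And>n. compactin X (K n)" and ex: "\<And>C. compactin X C \<Longrightarrow> \<exists>n::nat. C \<subseteq> K n"
    and mono: "incseq K"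
    using sigma_compact_exhaustion[OF X'(2,3)] by (metis incseq_SucI order_trans)
  have "\<exists>L. compactin X L \<and> (\<forall>p \<in> ?T. \<forall>t \<in> {0..1}. fst p \<notin> L \<and> snd p \<notin> L \<longrightarrow> h (p, t) \<notin> K n)" for n
    using h K[of n] unfolding proper_planner_def by meson
  then obtain L where L: "\<And>n. compactin X (L n)"
    "\<And>n p t. \<lbrakk>p \<in> ?T; t \<in> {0..1}; fst p \<notin> L n; snd p \<notin> L n\<rbrakk> \<Longrightarrow> h (p, t) \<notin> K n"
    by metis
  \<comment> \<open>Avoiding all of L 0 to L n, and not just the last one, makes the next point x (n
    + 1) avoid L n as well. The path between x n and x (n + 1) needs both.\<close>
  have "\<exists>x \<in> topspace X. x \<notin> (\<Union>m\<le>n. L m)" for n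
  proof -
    have "compactin X (\<Union>m\<le>n. L m)"
      using L(1) by (intro compactin_Union) auto
    then show ?thesis
      using X'(4) by (metis compact_space_def compactin_subset_topspace subsetI subset_antisym)
  qed
  then obtain x where x: "\<And>n. x n \<in> topspace X" "\<And>n. x n \<notin> (\<Union>m\<le>n. L m)" by metis
  define g where "g n t = h ((x n, x (Suc n)), t - real n)" for n t
  define \<alpha> where "\<alpha> t = g (nat \<lfloor>t\<rfloor>) t" for t
  have ends: "h (p, 0) = fst p" "h (p, 1) = snd p" if "p \<in> ?T" for p
    using h that by (auto simp: proper_planner_iff_track)
  have cont: "continuous_map (subtopology halfline {real n..real n + 1}) X (g n)" for n
  proof -
    let ?Q = "prod_topology (subtopology (prod_topology X X) ?T) unit_interval"
    have "continuous_map (subtopology halfline {real n..real n + 1}) unit_interval (\<lambda>t. t - real n)"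
      by (auto simp: continuous_map_in_subtopology intro!: continuous_intros continuous_map_from_subtopology)
    then have "continuous_map (subtopology halfline {real n..real n + 1}) ?Q (\<lambda>t. ((x n, x (Suc n)), t - real n))"
      using x(1) by (simp add: continuous_map_pairwise[of _ "subtopology (prod_topology X X) ?T"] o_def)
    from continuous_map_compose[OF this, of X h] h show ?thesis
      by (simp add: proper_planner_def planner_def g_def[abs_def] o_def)
  qed
  have agree: "g i t = g j t" if "t \<in> {real i..real i + 1}" "t \<in> {real j..real j + 1}" "i < j" for i j t
  proof -
    have "j = Suc i" "t = real j" using that by auto
    then show ?thesis using ends[of "(x i, x (Suc i))"] ends[of "(x j, x (Suc j))"] x(1) by (simp add: g_def)
  qed
  have "continuous_map halfline X \<alpha>"
  \<comment> \<open>The unit intervals form a locally finite closed cover, and two of them meet at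
    most in an endpoint, where both pieces take the value of the common point.\<close>
  proof (rule pasting_lemma_locally_finite[where I = UNIV and T = "\<lambda>n. {real n..real n + 1}" and f = g])
    fix t :: real assume t: "t \<in> topspace halfline"
    have "{i. {real i..real i + 1} \<inter> ({0..} \<inter> {..<t + 1}) \<noteq> {}} \<subseteq> {..nat \<lceil>t + 1\<rceil>}"
      by (auto simp: le_nat_iff) linarith
    then show "\<exists>V. openin halfline V \<and> t \<in> V \<and> finite {i \<in> UNIV. {real i..real i + 1} \<inter> V \<noteq> {}}"
      using t by (intro exI[of _ "{0..} \<inter> {..<t + 1}"]) (auto simp: openin_open_Int finite_subset)
    show "\<exists>j. j \<in> UNIV \<and> t \<in> {real j..real j + 1} \<and> \<alpha> t = g j t"
    proof (intro exI[of _ "nat \<lfloor>t\<rfloor>"] conjI)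
      have "real (nat \<lfloor>t\<rfloor>) = of_int \<lfloor>t\<rfloor>" using t by simp
      then show "t \<in> {real (nat \<lfloor>t\<rfloor>)..real (nat \<lfloor>t\<rfloor>) + 1}"
        using floor_correct[of t] by simp
    qed (simp_all add: \<alpha>_def)
  next
    fix i j t assume "t \<in> topspace halfline \<inter> {real i..real i + 1} \<inter> {real j..real j + 1}"
    then have "t \<in> {real i..real i + 1}" "t \<in> {real j..real j + 1}" by blast+
    then show "g i t = g j t"
      using agree[of t i j] agree[of t j i] by (metis linorder_neqE_nat)
  next
    fix i show "closedin halfline {real i..real i + 1}"
      by (rule closedin_subset_topspace) auto
  qed (use cont in simp)
  then have "proper_cmap halfline X \<alpha>"
  proof (rule proper_cmapI[OF _ X'(1)])
    fix C assume "compactin X C"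
    then obtain N where N: "C \<subseteq> K N" using ex by blast
    have "t \<le> real N" if "0 \<le> t" "\<alpha> t \<in> C" for t
    proof (rule ccontr)
      assume "\<not> t \<le> real N"
      let ?n = "nat \<lfloor>t\<rfloor>"
      have n: "N \<le> ?n" "t - real ?n \<in> {0..1}"
        using \<open>\<not> t \<le> real N\<close> that(1) by (auto simp: le_nat_iff le_floor_iff) linarith
      have "\<alpha> t \<notin> K ?n"
        unfolding \<alpha>_def g_def by (rule L(2)) (use x(1) x(2)[of ?n] x(2)[of "Suc ?n"] n in auto)
      then show False
        using that N incseqD[OF mono n(1)] by blast
    qed
    then have "{t \<in> topspace halfline. \<alpha> t \<in> C} \<subseteq> {0..real N}" by auto
    then show "\<exists>D. compactin halfline D \<and> {t \<in> topspace halfline. \<alpha> t \<in> C} \<subseteq> D"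
      using compactin_halfline_interval by blast
  qed
  then show thesis using that by (simp add: ray_def)
qed

text \<open>Category zero means that the single member of the cover is all of X, so \<alpha> and r
  satisfy one half of an equivalence. The other composite is a proper self-map of the half-line,
  hence homotopic to the identity.\<close>

lemma p_TC_zero_imp_halfline:
  assumes "normal_space X" "P_infinity X" and 0: "p_TC X = 0"
  shows "properly_homotopy_equivalent X halfline"
proof -
  have "p_TC X = enat 0" using 0 by (simp add: zero_enat_def)
  then obtain U where "proper_planners X 0 U"
    by (rule p_TC_eq_enatE)
  then obtain h where "proper_planner X (topspace X \<times> topspace X) h"
    by (auto simp: proper_planners_def)
  then obtain \<alpha> where \<alpha>: "ray X \<alpha>"
    using ray_of_p_TC_zero[OF assms(2)] by blast
  have "p_cat \<alpha> X = enat 0"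
    using p_cat_le_p_TC[OF assms(1,2) \<alpha>] 0 by (simp flip: zero_enat_def)
  then obtain U where "proper_cat_cover \<alpha> X 0 U"
    by (rule p_cat_eq_enatE)
  then obtain r where r: "proper_cmap X halfline r" "properly_homotopic X X (\<alpha> \<circ> r) id"
    by (auto simp: proper_cat_cover_def)
  have \<alpha>': "proper_cmap halfline X \<alpha>" using \<alpha> by (simp add: ray_def)
  have "proper_cmap halfline halfline (r \<circ> \<alpha>)"
    unfolding proper_cmap_def
  proof (intro conjI allI impI)
    show "continuous_map halfline halfline (r \<circ> \<alpha>)"
      using r(1) \<alpha>' continuous_map_compose unfolding proper_cmap_def by blast
    have "\<alpha> t \<in> topspace X" if "t \<in> topspace halfline" for t
      using \<alpha>' that unfolding proper_cmap_def continuous_map_def by blast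
    then have "{t \<in> topspace halfline. (r \<circ> \<alpha>) t \<in> K} =
        {t \<in> topspace halfline. \<alpha> t \<in> {x \<in> topspace X. r x \<in> K}}" for K
      by auto
    then show "compactin halfline {t \<in> topspace halfline. (r \<circ> \<alpha>) t \<in> K}"
      if "compactin halfline K" for K
      using proper_cmap_compactin[OF \<alpha>' proper_cmap_compactin[OF r(1) that]] by simp
  qed
  moreover have "proper_cmap halfline halfline id"
    unfolding proper_cmap_def
  proof (intro conjI allI impI)
    show "compactin halfline {x \<in> topspace halfline. id x \<in> K}" if K: "compactin halfline K" for K
    proof -
      have "{x \<in> topspace halfline. id x \<in> K} = K"
        using compactin_subset_topspace[OF K] by auto
      then show ?thesis using K by simp
    qed
  qed (rule continuous_map_id)
  ultimately have "properly_homotopic halfline halfline (r \<circ> \<alpha>) id"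
    by (rule proper_cmaps_halfline_homotopic)
  then show ?thesis
    using r \<alpha>' by (auto simp: properly_homotopy_equivalent_def)
qed

section \<open>Direct limits\<close>

lemma (in abelian_monoid) finsum_in:
  assumes "finite A" "J \<subseteq> carrier G" "\<zero> \<in> J"
    and add: "\<And>x y. \<lbrakk>x \<in> J; y \<in> J\<rbrakk> \<Longrightarrow> x \<oplus> y \<in> J"
    and f: "\<And>i. i \<in> A \<Longrightarrow> f i \<in> J"
  shows "finsum G f A \<in> J"
  using assms(1) f
proof (induction A rule: finite_induct)
  case (insert i A)
  then have "finsum G f (insert i A) = f i \<oplus> finsum G f A"
    using assms(2) by (intro finsum_insert) auto
  then show ?case using insert add by simp
qed (use assms(3) in simp)

text \<open>Operations on limit classes are encoded as unions over all representatives. Once every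
  representative is shown to give the same class, this turns the union into that class.\<close>

lemma UN_const_eq: "\<lbrakk>A \<noteq> {}; \<And>x. x \<in> A \<Longrightarrow> f x = c\<rbrakk> \<Longrightarrow> (\<Union>x\<in>A. f x) = c"
proof -
  assume "A \<noteq> {}" "\<And>x. x \<in> A \<Longrightarrow> f x = c"
  then have "f ` A = {c}" by auto
  then show ?thesis by simp
qed

locale direct_system =
  fixes \<I> :: "'i set set" and M :: "'i set \<Rightarrow> ('r, 'c) module" and \<phi> :: "'i set \<Rightarrow> 'i set \<Rightarrow> 'c \<Rightarrow> 'c"
  assumes ne: "\<I> \<noteq> {}"
    and directed: "\<lbrakk>E \<in> \<I>; F \<in> \<I>\<rbrakk> \<Longrightarrow> \<exists>G \<in> \<I>. G \<subseteq> E \<and> G \<subseteq> F"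
    and group: "E \<in> \<I> \<Longrightarrow> abelian_group (M E)"
    and closed: "\<lbrakk>E \<in> \<I>; F \<in> \<I>; F \<subseteq> E; a \<in> carrier (M E)\<rbrakk> \<Longrightarrow> \<phi> E F a \<in> carrier (M F)"
    and additive: "\<lbrakk>E \<in> \<I>; F \<in> \<I>; F \<subseteq> E; a \<in> carrier (M E); b \<in> carrier (M E)\<rbrakk> \<Longrightarrow>
        \<phi> E F (a \<oplus>\<^bsub>M E\<^esub> b) = \<phi> E F a \<oplus>\<^bsub>M F\<^esub> \<phi> E F b"
    and identity: "\<lbrakk>E \<in> \<I>; a \<in> carrier (M E)\<rbrakk> \<Longrightarrow> \<phi> E E a = a"
    and compose: "\<lbrakk>E \<in> \<I>; F \<in> \<I>; G \<in> \<I>; G \<subseteq> F; F \<subseteq> E; a \<in> carrier (M E)\<rbrakk> \<Longrightarrow>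
        \<phi> F G (\<phi> E F a) = \<phi> E G a"
begin

abbreviation "dlim \<equiv> direct_limit \<I> M \<phi>"
abbreviation "dcls \<equiv> dl_class \<I> M \<phi>"
abbreviation "reps \<equiv> SIGMA E:\<I>. carrier (M E)"

lemma zero_hom:
  assumes "E \<in> \<I>" "F \<in> \<I>" "F \<subseteq> E"
  shows "\<phi> E F \<zero>\<^bsub>M E\<^esub> = \<zero>\<^bsub>M F\<^esub>"
proof -
  interpret E: abelian_group "M E" using group assms by blast
  interpret F: abelian_group "M F" using group assms by blast
  have c: "\<phi> E F \<zero>\<^bsub>M E\<^esub> \<in> carrier (M F)" using closed assms by simp
  have "\<phi> E F \<zero>\<^bsub>M E\<^esub> \<oplus>\<^bsub>M F\<^esub> \<phi> E F \<zero>\<^bsub>M E\<^esub> = \<phi> E F \<zero>\<^bsub>M E\<^esub> \<oplus>\<^bsub>M F\<^esub> \<zero>\<^bsub>M F\<^esub>"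
    using additive[OF assms, of "\<zero>\<^bsub>M E\<^esub>" "\<zero>\<^bsub>M E\<^esub>"] c by simp
  then show ?thesis using c by simp
qed

lemma equiv_dl_rel: "equiv reps (dl_rel \<I> M \<phi>)"
proof (rule equivI)
  show "dl_rel \<I> M \<phi> \<subseteq> reps \<times> reps" by (auto simp: dl_rel_def)
  show "refl_on reps (dl_rel \<I> M \<phi>)" by (auto simp: refl_on_def dl_rel_def)
  show "sym (dl_rel \<I> M \<phi>)"
  proof (rule symI, clarsimp simp: dl_rel_def)
    fix E a E' a' F
    assume "F \<in> \<I>" "F \<subseteq> E" "F \<subseteq> E'" "\<phi> E F a = \<phi> E' F a'"
    then show "\<exists>F\<in>\<I>. F \<subseteq> E' \<and> F \<subseteq> E \<and> \<phi> E' F a' = \<phi> E F a"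
      by (intro bexI[of _ F]) auto
  qed
  show "trans (dl_rel \<I> M \<phi>)"
  proof (rule transI, clarsimp simp: dl_rel_def)
    fix E a E1 a1 E2 a2 F G
    assume *: "E \<in> \<I>" "a \<in> carrier (M E)" "E1 \<in> \<I>" "a1 \<in> carrier (M E1)" "E2 \<in> \<I>" "a2 \<in> carrier (M E2)"
      "F \<in> \<I>" "F \<subseteq> E" "F \<subseteq> E1" "\<phi> E F a = \<phi> E1 F a1"
      "G \<in> \<I>" "G \<subseteq> E1" "G \<subseteq> E2" "\<phi> E1 G a1 = \<phi> E2 G a2"
    obtain D where D: "D \<in> \<I>" "D \<subseteq> F" "D \<subseteq> G" using directed[OF *(7,11)] by blast
    have "\<phi> E D a = \<phi> E1 D a1"
      using compose[OF *(1,7) D(1,2) *(8,2)] compose[OF *(3,7) D(1,2) *(9,4)] *(10) by simp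
    also have "\<dots> = \<phi> E2 D a2"
      using compose[OF *(3,11) D(1,3) *(12,4)] compose[OF *(5,11) D(1,3) *(13,6)] *(14) by simp
    finally show "\<exists>F\<in>\<I>. F \<subseteq> E \<and> F \<subseteq> E2 \<and> \<phi> E F a = \<phi> E2 F a2"
      using D(1) order_trans[OF D(2) *(8)] order_trans[OF D(3) *(13)] by blast
  qed
qed

lemma cls_eq_iff:
  assumes "E \<in> \<I>" "a \<in> carrier (M E)" "E' \<in> \<I>" "a' \<in> carrier (M E')"
  shows "dcls E a = dcls E' a' \<longleftrightarrow> (\<exists>F \<in> \<I>. F \<subseteq> E \<and> F \<subseteq> E' \<and> \<phi> E F a = \<phi> E' F a')"
  unfolding dl_class_def using assms
  by (subst eq_equiv_class_iff[OF equiv_dl_rel]) (auto simp: dl_rel_def)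

lemma cls_restrict:
  assumes "E \<in> \<I>" "a \<in> carrier (M E)" "F \<in> \<I>" "F \<subseteq> E"
  shows "dcls F (\<phi> E F a) = dcls E a"
  using assms closed identity by (subst cls_eq_iff) auto

lemma in_clsD:
  assumes "(E', a') \<in> dcls E a"
  shows "E' \<in> \<I>" "a' \<in> carrier (M E')" "E \<in> \<I>" "a \<in> carrier (M E)" "dcls E' a' = dcls E a"
    "\<exists>F\<in>\<I>. F \<subseteq> E \<and> F \<subseteq> E' \<and> \<phi> E F a = \<phi> E' F a'"
proof -
  have r: "((E, a), (E', a')) \<in> dl_rel \<I> M \<phi>" using assms by (simp add: dl_class_def)
  then show "E' \<in> \<I>" "a' \<in> carrier (M E')" "E \<in> \<I>" "a \<in> carrier (M E)"
    "\<exists>F\<in>\<I>. F \<subseteq> E \<and> F \<subseteq> E' \<and> \<phi> E F a = \<phi> E' F a'"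
    by (auto simp: dl_rel_def)
  show "dcls E' a' = dcls E a"
    unfolding dl_class_def using equiv_class_eq[OF equiv_dl_rel r] by simp
qed

lemma self_in_cls: "\<lbrakk>E \<in> \<I>; a \<in> carrier (M E)\<rbrakk> \<Longrightarrow> (E, a) \<in> dcls E a"
  unfolding dl_class_def by (rule equiv_class_self[OF equiv_dl_rel]) auto

lemma carrier_dlim: "carrier dlim = {dcls E a | E a. E \<in> \<I> \<and> a \<in> carrier (M E)}"
  by (auto simp: direct_limit_def quotient_def dl_class_def)

lemma cls_in_dlim: "\<lbrakk>E \<in> \<I>; a \<in> carrier (M E)\<rbrakk> \<Longrightarrow> dcls E a \<in> carrier dlim"
  by (auto simp: carrier_dlim)

text \<open>The union that defines the sum runs over all representatives and all indices F below
  both of theirs. Any such choice is compared with the one over E at an index D below everything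
  involved.\<close>

lemma add_cls:
  assumes "E \<in> \<I>" "a \<in> carrier (M E)" "b \<in> carrier (M E)"
  shows "dcls E a \<oplus>\<^bsub>dlim\<^esub> dcls E b = dcls E (a \<oplus>\<^bsub>M E\<^esub> b)"
proof -
  have eq: "dcls F (\<phi> E1 F a1 \<oplus>\<^bsub>M F\<^esub> \<phi> E2 F b1) = dcls E (a \<oplus>\<^bsub>M E\<^esub> b)"
    if 1: "(E1, a1) \<in> dcls E a" and 2: "(E2, b1) \<in> dcls E b" and F: "F \<in> \<I>" "F \<subseteq> E1" "F \<subseteq> E2" for E1 a1 E2 b1 F
  proof -
    obtain G where G: "G \<in> \<I>" "G \<subseteq> E" "G \<subseteq> E1" "\<phi> E G a = \<phi> E1 G a1" using in_clsD(6)[OF 1] by blast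
    obtain G' where G': "G' \<in> \<I>" "G' \<subseteq> E" "G' \<subseteq> E2" "\<phi> E G' b = \<phi> E2 G' b1" using in_clsD(6)[OF 2] by blast
    obtain D where D: "D \<in> \<I>" "D \<subseteq> G" "D \<subseteq> G'" "D \<subseteq> F"
      using directed G G' F by (metis order_trans)
    note E1 = in_clsD(1,2)[OF 1] and E2 = in_clsD(1,2)[OF 2]
    interpret F: abelian_group "M F" using group F by blast
    interpret E: abelian_group "M E" using group assms by blast
    have cF: "\<phi> E1 F a1 \<in> carrier (M F)" "\<phi> E2 F b1 \<in> carrier (M F)"
      using closed E1 E2 F by auto
    have "\<phi> F D (\<phi> E1 F a1 \<oplus>\<^bsub>M F\<^esub> \<phi> E2 F b1) = \<phi> E1 D a1 \<oplus>\<^bsub>M D\<^esub> \<phi> E2 D b1"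
      using additive[OF F(1) D(1) D(4) cF] compose[OF E1(1) F(1) D(1) D(4) F(2) E1(2)]
        compose[OF E2(1) F(1) D(1) D(4) F(3) E2(2)] by simp
    also have "\<phi> E1 D a1 = \<phi> E D a"
      using compose[OF E1(1) G(1) D(1) D(2) G(3) E1(2)] compose[OF assms(1) G(1) D(1) D(2) G(2) assms(2)] G(4) by simp
    also have "\<phi> E2 D b1 = \<phi> E D b"
      using compose[OF E2(1) G'(1) D(1) D(3) G'(3) E2(2)] compose[OF assms(1) G'(1) D(1) D(3) G'(2) assms(3)] G'(4) by simp
    also have "\<phi> E D a \<oplus>\<^bsub>M D\<^esub> \<phi> E D b = \<phi> E D (a \<oplus>\<^bsub>M E\<^esub> b)"
      using additive[OF assms(1) D(1) _ assms(2,3)] D G by auto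
    finally show ?thesis
      using cls_eq_iff[OF F(1) _ assms(1), of "\<phi> E1 F a1 \<oplus>\<^bsub>M F\<^esub> \<phi> E2 F b1" "a \<oplus>\<^bsub>M E\<^esub> b"]
        cF assms(2,3) D(1,4) order_trans[OF D(2) G(2)] by (metis E.a_closed F.a_closed)
  qed
  have "dcls E a \<oplus>\<^bsub>dlim\<^esub> dcls E b = (\<Union>(E1, a1) \<in> dcls E a. \<Union>(E2, b1) \<in> dcls E b. \<Union>F \<in> {F \<in> \<I>. F \<subseteq> E1 \<and> F \<subseteq> E2}.
               dcls F (\<phi> E1 F a1 \<oplus>\<^bsub>M F\<^esub> \<phi> E2 F b1))"
    unfolding direct_limit_def ring.simps by (rule refl)
  also have "\<dots> = dcls E (a \<oplus>\<^bsub>M E\<^esub> b)"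
  proof (rule UN_const_eq, use self_in_cls assms in blast, split prod.split, intro allI impI,
      rule UN_const_eq, use self_in_cls assms in blast, split prod.split, intro allI impI, rule UN_const_eq)
    fix x E1 a1 y E2 b1 assume "x \<in> dcls E a" "x = (E1, a1)" "y \<in> dcls E b" "y = (E2, b1)"
    then have 1: "(E1, a1) \<in> dcls E a" and 2: "(E2, b1) \<in> dcls E b" by auto
    show "{F \<in> \<I>. F \<subseteq> E1 \<and> F \<subseteq> E2} \<noteq> {}"
      using directed[OF in_clsD(1)[OF 1] in_clsD(1)[OF 2]] by blast
    show "dcls F (\<phi> E1 F a1 \<oplus>\<^bsub>M F\<^esub> \<phi> E2 F b1) = dcls E (a \<oplus>\<^bsub>M E\<^esub> b)"
      if "F \<in> {F \<in> \<I>. F \<subseteq> E1 \<and> F \<subseteq> E2}" for F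
      using eq[OF 1 2] that by simp
  qed
  finally show ?thesis .
qed

lemma zero_cls:
  assumes "E \<in> \<I>"
  shows "\<zero>\<^bsub>dlim\<^esub> = dcls E \<zero>\<^bsub>M E\<^esub>"
proof -
  have "dcls F \<zero>\<^bsub>M F\<^esub> = dcls E \<zero>\<^bsub>M E\<^esub>" if F: "F \<in> \<I>" for F
  proof -
    obtain G where G: "G \<in> \<I>" "G \<subseteq> E" "G \<subseteq> F" using directed assms F by blast
    have "\<zero>\<^bsub>M E\<^esub> \<in> carrier (M E)" "\<zero>\<^bsub>M F\<^esub> \<in> carrier (M F)"
      using group assms F by (simp_all add: abelian_group.axioms(1) abelian_monoid.zero_closed)
    then show ?thesis
      using cls_restrict[OF assms _ G(1,2)] cls_restrict[OF F _ G(1,3)] zero_hom[OF assms G(1,2)] zero_hom[OF F G(1,3)]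
      by metis
  qed
  then have "(\<Union>F\<in>\<I>. dcls F \<zero>\<^bsub>M F\<^esub>) = dcls E \<zero>\<^bsub>M E\<^esub>"
    by (rule UN_const_eq[OF ne])
  moreover have "\<zero>\<^bsub>dlim\<^esub> = (\<Union>F\<in>\<I>. dcls F \<zero>\<^bsub>M F\<^esub>)"
    unfolding direct_limit_def ring.simps by (rule refl)
  ultimately show ?thesis by simp
qed

text \<open>By directedness, finitely many classes can be represented over one index; the laws of
  addition in the limit thereby reduce to those of a single group.\<close>

lemma common_rep:
  assumes "finite A" "A \<subseteq> carrier dlim"
  shows "\<exists>E \<in> \<I>. \<forall>C \<in> A. \<exists>a \<in> carrier (M E). C = dcls E a"
  using assms
proof (induction A rule: finite_induct)
  case (insert C A)
  then obtain E where E: "E \<in> \<I>" "\<And>C. C \<in> A \<Longrightarrow> \<exists>a \<in> carrier (M E). C = dcls E a" by blast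
  obtain F c where F: "F \<in> \<I>" "c \<in> carrier (M F)" "C = dcls F c" using insert by (auto simp: carrier_dlim)
  obtain G where G: "G \<in> \<I>" "G \<subseteq> E" "G \<subseteq> F" using directed E(1) F(1) by blast
  have "\<exists>a \<in> carrier (M G). D = dcls G a" if "D \<in> A" for D
    using E(2)[OF that] cls_restrict[OF E(1) _ G(1,2)] closed[OF E(1) G(1,2)] by metis
  moreover have "\<exists>a \<in> carrier (M G). C = dcls G a"
    using F cls_restrict[OF F(1,2) G(1,3)] closed[OF F(1) G(1,3)] by metis
  ultimately show ?case using G(1) by blast
qed (use ne in auto)

lemma abelian_monoid_dlim: "abelian_monoid dlim"
proof (rule abelian_monoidI)
  fix x y z assume "x \<in> carrier dlim" "y \<in> carrier dlim" "z \<in> carrier dlim"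
  then obtain E where E: "E \<in> \<I>" "\<forall>C \<in> {x, y, z}. \<exists>a \<in> carrier (M E). C = dcls E a"
    using common_rep[of "{x, y, z}"] by auto
  then obtain a b c where abc: "a \<in> carrier (M E)" "b \<in> carrier (M E)" "c \<in> carrier (M E)"
    "x = dcls E a" "y = dcls E b" "z = dcls E c" by auto
  interpret E: abelian_group "M E" using group E by blast
  show "x \<oplus>\<^bsub>dlim\<^esub> y \<oplus>\<^bsub>dlim\<^esub> z = x \<oplus>\<^bsub>dlim\<^esub> (y \<oplus>\<^bsub>dlim\<^esub> z)"
    using abc E(1) by (simp add: add_cls E.a_assoc)
next
  fix x y assume "x \<in> carrier dlim" "y \<in> carrier dlim"
  then obtain E where E: "E \<in> \<I>" "\<forall>C \<in> {x, y}. \<exists>a \<in> carrier (M E). C = dcls E a"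
    using common_rep[of "{x, y}"] by auto
  then obtain a b where ab: "a \<in> carrier (M E)" "b \<in> carrier (M E)" "x = dcls E a" "y = dcls E b" by auto
  interpret E: abelian_group "M E" using group E by blast
  show "x \<oplus>\<^bsub>dlim\<^esub> y \<in> carrier dlim" "x \<oplus>\<^bsub>dlim\<^esub> y = y \<oplus>\<^bsub>dlim\<^esub> x"
    using ab E(1) by (simp_all add: add_cls E.a_comm cls_in_dlim)
next
  obtain E where E: "E \<in> \<I>" using ne by blast
  interpret E: abelian_group "M E" using group E by blast
  show "\<zero>\<^bsub>dlim\<^esub> \<in> carrier dlim" using E by (simp add: zero_cls cls_in_dlim)
next
  fix x assume "x \<in> carrier dlim"
  then obtain E a where E: "E \<in> \<I>" "a \<in> carrier (M E)" "x = dcls E a" by (auto simp: carrier_dlim)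
  interpret E: abelian_group "M E" using group E by blast
  show "\<zero>\<^bsub>dlim\<^esub> \<oplus>\<^bsub>dlim\<^esub> x = x" using E by (simp add: zero_cls[OF E(1)] add_cls)
qed

end


section \<open>The universe of iterated products\<close>

lemma topspace_prod_space: "topspace (prod_space X Y) = pt_times (topspace X) (topspace Y)"
  by (auto simp: prod_space_def topspace_pullback_topology pt_times_def)

lemma topspace_lift_space: "topspace (lift_space X) = Pt ` topspace X"
  by (auto simp: lift_space_def topspace_pullback_topology)

lemma continuous_map_prod_space_projections:
  "continuous_map (prod_space X Y) X pt1" "continuous_map (prod_space X Y) Y pt2"
proof -
  have "continuous_map (prod_space X Y) (prod_topology X Y) (id \<circ> (\<lambda>p. (pt1 p, pt2 p)))"
    unfolding prod_space_def by (rule continuous_map_pullback) (rule continuous_map_id)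
  then show "continuous_map (prod_space X Y) X pt1" "continuous_map (prod_space X Y) Y pt2"
    by (simp_all add: continuous_map_pairwise o_def)
qed

lemma continuous_map_Pr:
  assumes "continuous_map Z X f" "continuous_map Z Y g"
  shows "continuous_map Z (prod_space X Y) (\<lambda>z. Pr (f z) (g z))"
  unfolding prod_space_def
proof (rule continuous_map_pullback')
  show "continuous_map Z (prod_topology X Y) ((\<lambda>p. (pt1 p, pt2 p)) \<circ> (\<lambda>z. Pr (f z) (g z)))"
    using assms by (simp add: o_def continuous_map_pairwise)
  show "topspace Z \<subseteq> (\<lambda>z. Pr (f z) (g z)) -` pt_times (topspace X) (topspace Y)"
    using continuous_map_funspace[OF assms(1)] continuous_map_funspace[OF assms(2)]
    by (auto simp: pt_times_def)
qed

lemma homeomorphic_maps_prod_space: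
  "homeomorphic_maps (prod_topology X Y) (prod_space X Y) (\<lambda>(x, y). Pr x y) (\<lambda>p. (pt1 p, pt2 p))"
proof -
  have "continuous_map (prod_topology X Y) (prod_space X Y) (\<lambda>p. Pr (fst p) (snd p))"
    by (rule continuous_map_Pr) (rule continuous_map_fst continuous_map_snd)+
  moreover have "continuous_map (prod_space X Y) (prod_topology X Y) (\<lambda>p. (pt1 p, pt2 p))"
    using continuous_map_prod_space_projections[of X Y] by (simp add: continuous_map_pairwise o_def)
  ultimately show ?thesis
    unfolding case_prod_unfold by (auto simp: homeomorphic_maps_def topspace_prod_space pt_times_def)
qed

lemma homeomorphic_maps_lift_space: "homeomorphic_maps X (lift_space X) Pt un_Pt"
proof -
  have "continuous_map X (lift_space X) Pt"
    unfolding lift_space_def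
    by (rule continuous_map_pullback') (auto simp: o_def continuous_map_id[unfolded id_def])
  moreover have "continuous_map (lift_space X) X (id \<circ> un_Pt)"
    unfolding lift_space_def by (rule continuous_map_pullback) (rule continuous_map_id)
  ultimately show ?thesis
    by (auto simp: homeomorphic_maps_def topspace_lift_space)
qed

lemma metrizable_prod_space:
  assumes "metrizable_space X" "metrizable_space Y"
  shows "metrizable_space (prod_space X Y)"
proof -
  have "metrizable_space (prod_topology X Y)"
    using assms by (simp add: metrizable_space_prod_topology)
  moreover have "prod_topology X Y homeomorphic_space prod_space X Y"
    using homeomorphic_maps_prod_space homeomorphic_space_def by blast
  ultimately show ?thesis
    using homeomorphic_metrizable_space by blast
qed

lemma metrizable_lift_space: "metrizable_space X \<Longrightarrow> metrizable_space (lift_space X)"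
  using homeomorphic_maps_lift_space[of X] homeomorphic_metrizable_space[of X "lift_space X"]
  unfolding homeomorphic_space_def by blast

lemma openin_pt_times:
  assumes "openin X E" "openin Y F"
  shows "openin (prod_space X Y) (pt_times E F)"
  unfolding prod_space_def openin_pullback_topology
proof (intro exI conjI)
  show "openin (prod_topology X Y) (E \<times> F)" using assms by (simp add: openin_prod_Times_iff)
  show "pt_times E F = (\<lambda>p. (pt1 p, pt2 p)) -` (E \<times> F) \<inter> pt_times (topspace X) (topspace Y)"
    using openin_subset[OF assms(1)] openin_subset[OF assms(2)] by (auto simp: pt_times_def)
qed

lemma openin_image_Pr:
  assumes "openin (prod_topology X Y) U"
  shows "openin (prod_space X Y) ((\<lambda>(x, y). Pr x y) ` U)"
  using homeomorphic_imp_open_map[OF homeomorphic_maps_imp_map[OF homeomorphic_maps_prod_space[of X Y]]] assms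
  by (simp add: open_map_def)

lemma openin_prod_sub:
  assumes "openin X E" "openin Y F"
  shows "openin (prod_space X Y) (prod_sub X E Y F)"
  unfolding prod_sub_def using assms by (intro openin_Un openin_pt_times) auto

section \<open>Transport of \<open>p_TC\<close> to the copy of X in the universe\<close>

lemma homeomorphic_imp_properly_homotopy_equivalent:
  assumes "homeomorphic_maps X Y f g"
  shows "properly_homotopy_equivalent X Y"
proof -
  have proper: "proper_cmap X Y f" if "homeomorphic_maps X Y f g" for X :: "'x topology" and Y :: "'y topology" and f g
    unfolding proper_cmap_def
  proof (intro conjI allI impI)
    show "continuous_map X Y f" using that by (simp add: homeomorphic_maps_def)
    fix K assume K: "compactin Y K"
    have fg: "\<And>x. x \<in> topspace X \<Longrightarrow> g (f x) = x" "\<And>y. y \<in> topspace Y \<Longrightarrow> f (g y) = y"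
      "g ` topspace Y \<subseteq> topspace X"
      using that continuous_map_image_subset_topspace unfolding homeomorphic_maps_def by metis+
    have "{x \<in> topspace X. f x \<in> K} = g ` K"
    proof (intro equalityI subsetI)
      fix x assume "x \<in> {x \<in> topspace X. f x \<in> K}"
      then show "x \<in> g ` K" using fg(1)[of x] by (metis (mono_tags, lifting) image_eqI mem_Collect_eq)
    next
      fix x assume "x \<in> g ` K"
      then obtain y where "y \<in> K" "x = g y" by blast
      then show "x \<in> {x \<in> topspace X. f x \<in> K}"
        using fg(2,3) compactin_subset_topspace[OF K] by auto
    qed
    moreover have "compactin X (g ` K)"
      using that K image_compactin by (auto simp: homeomorphic_maps_def)
    ultimately show "compactin X {x \<in> topspace X. f x \<in> K}" by simp
  qed
  have htpy: "properly_homotopic X X k id" if k: "\<And>x. x \<in> topspace X \<Longrightarrow> k x = x" for X :: "'x topology" and k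
    unfolding properly_homotopic_def
  proof (intro exI conjI ballI)
    show "proper_cmap (prod_topology X unit_interval) X fst"
      unfolding proper_cmap_def
    proof (intro conjI allI impI continuous_map_fst)
      fix K assume K: "compactin X K"
      have "{q \<in> topspace (prod_topology X unit_interval). fst q \<in> K} = K \<times> {0..1}"
        using compactin_subset_topspace[OF K] by auto
      moreover have "compactin (prod_topology X unit_interval) (K \<times> {0..1})"
        unfolding compactin_Times using K by (simp add: compactin_subtopology)
      ultimately show "compactin (prod_topology X unit_interval) {q \<in> topspace (prod_topology X unit_interval). fst q \<in> K}"
        by simp
    qed
  qed (use k in auto)
  show ?thesis
    unfolding properly_homotopy_equivalent_def
    using proper[OF assms] proper[of Y X g f] assms
    by (intro exI[of _ f] exI[of _ g] conjI htpy) (auto simp: homeomorphic_maps_def)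
qed

lemma p_TC_lift_space: "p_TC (lift_space X) = p_TC X"
  by (rule p_TC_properly_homotopy_equivalent[symmetric])
    (rule homeomorphic_imp_properly_homotopy_equivalent[OF homeomorphic_maps_lift_space])

section \<open>Cocompact and product externologies\<close>

lemma externology_cocompact: "externology X (cocompact X)"
  unfolding externology_def
proof (intro conjI ballI allI impI)
  have "topspace X - {} \<in> cocompact X"
    unfolding cocompact_def using closedin_empty compactin_empty by blast
  then show "cocompact X \<noteq> {}" by blast
next
  fix E E' assume "E \<in> cocompact X" "E' \<in> cocompact X"
  then obtain K K' where "E = topspace X - K" "E' = topspace X - K'" "closedin X K" "compactin X K"
    "closedin X K'" "compactin X K'" by (auto simp: cocompact_def)
  moreover from this have "E \<inter> E' = topspace X - (K \<union> K')" by blast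
  ultimately show "E \<inter> E' \<in> cocompact X"
    unfolding cocompact_def using compactin_Un closedin_Un by blast
next
  fix E W assume "E \<in> cocompact X" and W: "openin X W \<and> E \<subseteq> W"
  then obtain K where K: "E = topspace X - K" "closedin X K" "compactin X K" by (auto simp: cocompact_def)
  have "closedin X (topspace X - W)" "topspace X - W \<subseteq> K" using W K by auto
  moreover from this have "compactin X (topspace X - W)" using K closed_compactin by metis
  moreover have "W = topspace X - (topspace X - W)" using W openin_subset by blast
  ultimately show "W \<in> cocompact X" unfolding cocompact_def by blast
qed (auto simp: cocompact_def)

lemma externology_prod_ext:
  assumes "externology X \<E>" "externology Y \<F>"
  shows "externology (prod_space X Y) (prod_ext X \<E> Y \<F>)"
  unfolding externology_def
proof (intro conjI ballI allI impI)
  obtain E F where "E \<in> \<E>" "F \<in> \<F>" using assms by (auto simp: externology_def)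
  moreover from this have "openin X E" "openin Y F"
    using assms by (auto simp: externology_def)
  ultimately have "pt_times E F \<in> prod_ext X \<E> Y \<F>"
    using openin_pt_times[of X E Y F] unfolding prod_ext_def by blast
  then show "prod_ext X \<E> Y \<F> \<noteq> {}" by blast
next
  fix W W' assume WW: "W \<in> prod_ext X \<E> Y \<F>" "W' \<in> prod_ext X \<E> Y \<F>"
  then obtain E F E' F' where *: "E \<in> \<E>" "F \<in> \<F>" "pt_times E F \<subseteq> W" "E' \<in> \<E>" "F' \<in> \<F>" "pt_times E' F' \<subseteq> W'"
    unfolding prod_ext_def by blast
  then have "E \<inter> E' \<in> \<E>" "F \<inter> F' \<in> \<F>" using assms unfolding externology_def by blast+
  moreover have "pt_times (E \<inter> E') (F \<inter> F') \<subseteq> W \<inter> W'" using * by (auto simp: pt_times_def)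
  ultimately show "W \<inter> W' \<in> prod_ext X \<E> Y \<F>"
    using WW unfolding prod_ext_def by blast
next
  fix W V assume "W \<in> prod_ext X \<E> Y \<F>" "openin (prod_space X Y) V \<and> W \<subseteq> V"
  moreover from this obtain E F where "E \<in> \<E>" "F \<in> \<F>" "pt_times E F \<subseteq> W"
    unfolding prod_ext_def by blast
  ultimately show "V \<in> prod_ext X \<E> Y \<F>"
    unfolding prod_ext_def using order_trans[of "pt_times E F" W V] by blast
qed (auto simp: prod_ext_def)

section \<open>Consequences of the axioms of an ES-theory\<close>

lemma pair_map_inclusion:
  assumes "metrizable_space Y" "V' \<subseteq> topspace Y" "V \<subseteq> V'" "A \<subseteq> V" "A \<subseteq> A'" "A' \<subseteq> V'"
  shows "pair_map (subtopology Y V) A (subtopology Y V') A' id"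
proof -
  have "continuous_map (subtopology Y V) (subtopology Y V') id"
    using assms(3) by (auto simp: continuous_map_in_subtopology)
  then show ?thesis
    using assms by (auto simp: pair_map_def space_pair_def metrizable_space_subtopology)
qed

context ES_theory
begin

lemma abelian_group_coh: "space_pair X A \<Longrightarrow> abelian_group (coh T n X A)"
  using coh_module by (blast dest: left_module.axioms)

lemma ind_closed:
  "\<lbrakk>pair_map X A Y B f; a \<in> carrier (coh T n Y B)\<rbrakk> \<Longrightarrow> ind T n X A Y B f a \<in> carrier (coh T n X A)"
  using ind_linear[of X A Y B f n] unfolding linear_map_def by blast

lemma ind_add:
  "\<lbrakk>pair_map X A Y B f; a \<in> carrier (coh T n Y B); b \<in> carrier (coh T n Y B)\<rbrakk> \<Longrightarrow>
    ind T n X A Y B f (a \<oplus>\<^bsub>coh T n Y B\<^esub> b) = ind T n X A Y B f a \<oplus>\<^bsub>coh T n X A\<^esub> ind T n X A Y B f b"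
  using ind_linear[of X A Y B f n] by (auto simp: linear_map_def)

lemma ind_zero:
  assumes "pair_map X A Y B f"
  shows "ind T n X A Y B f \<zero>\<^bsub>coh T n Y B\<^esub> = \<zero>\<^bsub>coh T n X A\<^esub>"
proof -
  have p: "space_pair X A" "space_pair Y B" using assms by (auto simp: pair_map_def)
  interpret X: abelian_group "coh T n X A" using abelian_group_coh p by blast
  interpret Y: abelian_group "coh T n Y B" using abelian_group_coh p by blast
  have c: "ind T n X A Y B f \<zero>\<^bsub>coh T n Y B\<^esub> \<in> carrier (coh T n X A)"
    using ind_closed[OF assms] by simp
  show ?thesis
    using ind_add[OF assms, of "\<zero>\<^bsub>coh T n Y B\<^esub>" n "\<zero>\<^bsub>coh T n Y B\<^esub>"] c
      X.add.l_cancel_one[OF c c] by simp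
qed

lemma cobd_closed:
  "\<lbrakk>space_pair X A; a \<in> carrier (coh T n (subtopology X A) {})\<rbrakk> \<Longrightarrow> cobd T n X A a \<in> carrier (coh T (Suc n) X A)"
  using cobd_linear[of X A n] unfolding linear_map_def by blast

lemma direct_system_ext:
  assumes X: "metrizable_space X" and \<E>: "externology X \<E>"
  shows "direct_system \<E> (\<lambda>E. coh T n X E) (\<lambda>E E'. ind T n X E' X E id)"
proof (rule direct_system.intro)
  have sp: "space_pair X E" if "E \<in> \<E>" for E
    using X \<E> that openin_subset by (auto simp: space_pair_def externology_def)
  have pm: "pair_map X F X E id" if "E \<in> \<E>" "F \<in> \<E>" "F \<subseteq> E" for E F
    using sp that by (auto simp: pair_map_def)
  show "\<E> \<noteq> {}" using \<E> by (simp add: externology_def)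
  show "\<exists>G \<in> \<E>. G \<subseteq> E \<and> G \<subseteq> F" if "E \<in> \<E>" "F \<in> \<E>" for E F
  proof -
    have "E \<inter> F \<in> \<E>" using \<E> that unfolding externology_def by blast
    then show ?thesis by blast
  qed
  show "abelian_group (coh T n X E)" if "E \<in> \<E>" for E
    using abelian_group_coh sp that by blast
  show "ind T n X E X E id a = a" if "E \<in> \<E>" "a \<in> carrier (coh T n X E)" for E a
    using ind_id sp that by blast
  show "ind T n X F X E id a \<in> carrier (coh T n X F)"
    if "E \<in> \<E>" "F \<in> \<E>" "F \<subseteq> E" "a \<in> carrier (coh T n X E)" for E F a
    using ind_closed pm that by blast
  show "ind T n X F X E id (a \<oplus>\<^bsub>coh T n X E\<^esub> b) =
      ind T n X F X E id a \<oplus>\<^bsub>coh T n X F\<^esub> ind T n X F X E id b"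
    if "E \<in> \<E>" "F \<in> \<E>" "F \<subseteq> E" "a \<in> carrier (coh T n X E)" "b \<in> carrier (coh T n X E)" for E F a b
    using ind_add pm that by blast
  show "ind T n X G X F id (ind T n X F X E id a) = ind T n X G X E id a"
    if "E \<in> \<E>" "F \<in> \<E>" "G \<in> \<E>" "G \<subseteq> F" "F \<subseteq> E" "a \<in> carrier (coh T n X E)" for E F G a
    using ind_comp[OF pm[OF that(2,3,4)] pm[OF that(1,2,5)] that(6)] by simp
qed

section \<open>Relative cohomology of subspaces of a fixed space\<close>

context
  fixes Y :: "'a pt topology"
  assumes Y: "metrizable_space Y"
begin

abbreviation "hh n V A \<equiv> coh T n (subtopology Y V) A"
abbreviation "res n V A V' A' \<equiv> ind T n (subtopology Y V) A (subtopology Y V') A' id"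

lemma res_res:
  assumes "V'' \<subseteq> topspace Y" "V' \<subseteq> V''" "V \<subseteq> V'" "A \<subseteq> V" "A' \<subseteq> V'" "A'' \<subseteq> V''" "A \<subseteq> A'" "A' \<subseteq> A''"
    and "a \<in> carrier (hh n V'' A'')"
  shows "res n V A V' A' (res n V' A' V'' A'' a) = res n V A V'' A'' a"
proof -
  have "V' \<subseteq> topspace Y" using assms by blast
  from ind_comp[OF pair_map_inclusion[OF Y this] pair_map_inclusion[OF Y assms(1)] assms(9), of V A A']
  show ?thesis using assms by simp
qed

lemma space_pair_sub: "V \<subseteq> topspace Y \<Longrightarrow> A \<subseteq> V \<Longrightarrow> space_pair (subtopology Y V) A"
  by (auto simp: space_pair_def Y metrizable_space_subtopology)

lemma sub_sub: "A \<subseteq> V \<Longrightarrow> subtopology (subtopology Y V) A = subtopology Y A"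
  by (simp add: subtopology_subtopology inf.absorb2)

lemma exactness:
  assumes "V \<subseteq> topspace Y" "A \<subseteq> V"
  shows "res n V {} V A ` carrier (hh n V A) = {x \<in> carrier (hh n V {}). res n A {} V {} x = \<zero>\<^bsub>hh n A {}\<^esub>}"
    "res n A {} V {} ` carrier (hh n V {}) =
      {c \<in> carrier (hh n A {}). cobd T n (subtopology Y V) A c = \<zero>\<^bsub>hh (Suc n) V A\<^esub>}"
    "cobd T n (subtopology Y V) A ` carrier (hh n A {}) =
      {x \<in> carrier (hh (Suc n) V A). res (Suc n) V {} V A x = \<zero>\<^bsub>hh (Suc n) V {}\<^esub>}"
  using exact_X[OF space_pair_sub[OF assms], of n] exact_A[OF space_pair_sub[OF assms], of n]
    exact_XA[OF space_pair_sub[OF assms], of n]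
  by (simp_all add: sub_sub[OF assms(2)] a_kernel_def')

text \<open>In the sequence of the pair (W, W) the restriction to the subspace is the identity, so
  the map into the absolute group has zero image. It is injective as well: in degree 0 by
  \<open>exact_0\<close>, and in higher degrees because the coboundary kills every class that
  extends, which here means every class.\<close>

lemma coh_self_zero:
  assumes W: "W \<subseteq> topspace Y" and x: "x \<in> carrier (hh n W W)"
  shows "x = \<zero>\<^bsub>hh n W W\<^esub>"
proof -
  have p: "pair_map (subtopology Y W) {} (subtopology Y W) W id"
    by (rule pair_map_inclusion) (use Y W in auto)
  have id: "res n W {} W {} y = y" if "y \<in> carrier (hh n W {})" for n y
    using that W by (intro ind_id space_pair_sub) auto
  have "res n W {} W W x \<in> res n W {} W W ` carrier (hh n W W)" using x by blast
  then have *: "res n W {} W W x = \<zero>\<^bsub>hh n W {}\<^esub>"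
    unfolding exactness(1)[OF W order_refl] using id by auto
  show ?thesis
  proof (cases n)
    case 0
    have "\<zero>\<^bsub>hh n W W\<^esub> \<in> carrier (hh n W W)"
      using abelian_group_coh[OF space_pair_sub[OF W order_refl]]
      by (simp add: abelian_group.axioms(1) abelian_monoid.zero_closed)
    moreover have "res n W {} W W \<zero>\<^bsub>hh n W W\<^esub> = \<zero>\<^bsub>hh n W {}\<^esub>"
      by (rule ind_zero[OF p])
    ultimately show ?thesis
      using exact_0[OF space_pair_sub[OF W order_refl]] * x unfolding 0 by (metis inj_onD)
  next
    case (Suc m)
    have "x \<in> cobd T m (subtopology Y W) W ` carrier (hh m W {})"
      unfolding exactness(3)[OF W order_refl] using x * Suc by simp
    then obtain c where c: "c \<in> carrier (hh m W {})" "x = cobd T m (subtopology Y W) W c" by blast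
    have "c \<in> res m W {} W {} ` carrier (hh m W {})"
      using id[OF c(1)] c(1) by (metis image_eqI)
    then show ?thesis
      unfolding exactness(2)[OF W order_refl] using c Suc by simp
  qed
qed

text \<open>Exactness of the triple (V, W, F) at its middle term, derived from the sequences of the
  three pairs. After subtracting a class from (V, W) with the same absolute image, x becomes a
  coboundary of some c on F. Its vanishing over W lets c extend to W, and the coboundary of the
  extension is the missing part of the lift.\<close>

lemma triple_exactness:
  assumes V: "V \<subseteq> topspace Y" and W: "W \<subseteq> V" and F: "F \<subseteq> W"
    and x: "x \<in> carrier (hh n V F)" and x0: "res n W F V F x = \<zero>\<^bsub>hh n W F\<^esub>"
  obtains y where "y \<in> carrier (hh n V W)" "x = res n V F V W y"
proof -
  have W': "W \<subseteq> topspace Y" and FV: "F \<subseteq> V" and F': "F \<subseteq> topspace Y" using V W F by auto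
  note pm = pair_map_inclusion[OF Y]
  have pVF: "pair_map (subtopology Y V) {} (subtopology Y V) F id"
    and pVFW: "pair_map (subtopology Y V) F (subtopology Y V) W id"
    and pWFV: "pair_map (subtopology Y W) F (subtopology Y V) F id"
    and pWF: "pair_map (subtopology Y W) {} (subtopology Y W) F id"
    and pWWV: "pair_map (subtopology Y W) W (subtopology Y V) W id"
    and pWFW: "pair_map (subtopology Y W) F (subtopology Y W) W id"
    by (rule pm; use V W F W' FV in auto)+
  interpret VF: abelian_group "hh n V F" using abelian_group_coh space_pair_sub V FV by blast
  interpret V0: abelian_group "hh n V {}" using abelian_group_coh space_pair_sub V by blast
  interpret WF: abelian_group "hh n W F" using abelian_group_coh space_pair_sub W' F by blast
  let ?x = "res n V {} V F x"
  have x'c: "?x \<in> carrier (hh n V {})" using ind_closed[OF pVF x] .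
  have "res n W {} V {} ?x = res n W {} V F x"
    by (rule res_res) (use V W FV x in auto)
  also have "\<dots> = res n W {} W F (res n W F V F x)"
    by (rule res_res[symmetric]) (use V W F FV x in auto)
  also have "\<dots> = \<zero>\<^bsub>hh n W {}\<^esub>"
    unfolding x0 by (rule ind_zero[OF pWF])
  finally have "?x \<in> res n V {} V W ` carrier (hh n V W)"
    unfolding exactness(1)[OF V W] using x'c by simp
  then obtain y0 where y0: "y0 \<in> carrier (hh n V W)" "?x = res n V {} V W y0" by blast
  let ?j = "res n V F V W"
  have jy0: "?j y0 \<in> carrier (hh n V F)" using ind_closed[OF pVFW y0(1)] .
  have "res n V {} V F (?j y0) = ?x"
    unfolding y0(2) by (rule res_res) (use V W F FV y0 in auto)
  \<comment> \<open>Since y0 was chosen with the same image in the absolute group of V, the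
    difference z dies there and thus comes from F.\<close>
  define z where "z = x \<ominus>\<^bsub>hh n V F\<^esub> ?j y0"
  have z: "z \<in> carrier (hh n V F)" using x jy0 by (simp add: z_def)
  have xz: "x = z \<oplus>\<^bsub>hh n V F\<^esub> ?j y0"
    using x jy0 by (simp add: z_def VF.minus_eq VF.a_assoc VF.l_neg)
  have zc: "res n V {} V F z \<in> carrier (hh n V {})" using ind_closed[OF pVF z] .
  have "?x = res n V {} V F z \<oplus>\<^bsub>hh n V {}\<^esub> ?x"
    using ind_add[OF pVF z jy0] xz \<open>res n V {} V F (?j y0) = ?x\<close> by simp
  then have z0: "res n V {} V F z = \<zero>\<^bsub>hh n V {}\<^esub>"
    using zc x'c V0.add.r_cancel_one by metis
  show thesis
  proof (cases n)
    \<comment> \<open>There is no coboundary into degree 0; injectivity makes z vanish outright, and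
      y0 alone is the lift.\<close>
    case 0
    have "z = \<zero>\<^bsub>hh n V F\<^esub>"
      using exact_0[OF space_pair_sub[OF V FV]] z z0 ind_zero[OF pVF, of n] VF.zero_closed
      unfolding 0 by (metis inj_onD)
    then have "x = ?j y0" using xz jy0 by simp
    then show thesis using that y0(1) by blast
  next
    case (Suc m)
    have "z \<in> cobd T m (subtopology Y V) F ` carrier (hh m F {})"
      unfolding exactness(3)[OF V FV] using z z0 Suc by simp
    then obtain c where c: "c \<in> carrier (hh m F {})" "z = cobd T m (subtopology Y V) F c" by blast
    \<comment> \<open>The restriction of \<open>?j y0\<close> to (W, F) factors through the zero
      group of (W, W), so z dies on (W, F) just as x does.\<close>
    have "res n W F V F (?j y0) = res n W F V W y0"
      by (rule res_res) (use V W F FV y0 in auto)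
    also have "\<dots> = res n W F W W (res n W W V W y0)"
      by (rule res_res[symmetric]) (use V W F FV y0 in auto)
    also have "res n W W V W y0 = \<zero>\<^bsub>hh n W W\<^esub>"
      using coh_self_zero[OF W'] ind_closed[OF pWWV y0(1)] by blast
    also have "res n W F W W \<zero>\<^bsub>hh n W W\<^esub> = \<zero>\<^bsub>hh n W F\<^esub>"
      by (rule ind_zero[OF pWFW])
    finally have "res n W F V F (?j y0) = \<zero>\<^bsub>hh n W F\<^esub>" .
    moreover have "res n W F V F x = res n W F V F z \<oplus>\<^bsub>hh n W F\<^esub> res n W F V F (?j y0)"
      unfolding xz by (rule ind_add[OF pWFV z jy0])
    ultimately have "res n W F V F z = \<zero>\<^bsub>hh n W F\<^esub>"
      using x0 WF.r_zero[OF ind_closed[OF pWFV z]] by simp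
    moreover have "cobd T m (subtopology Y W) F (res m F {} F {} c) = res (Suc m) W F V F (cobd T m (subtopology Y V) F c)"
      using cobd_natural[OF pWFV, of c m] c(1) by (simp add: sub_sub F FV)
    moreover have "res m F {} F {} c = c"
      using c(1) F' by (intro ind_id space_pair_sub) auto
    ultimately have "cobd T m (subtopology Y W) F c = \<zero>\<^bsub>hh n W F\<^esub>"
      using c(2) Suc by simp
    \<comment> \<open>A class on F with zero coboundary relative to W extends to W; by naturality
      the coboundary of the extension d for (V, W) maps to z.\<close>
    then have "c \<in> res m F {} W {} ` carrier (hh m W {})"
      unfolding exactness(2)[OF W' F] using c(1) Suc by simp
    then obtain d where d: "d \<in> carrier (hh m W {})" "c = res m F {} W {} d" by blast
    let ?e = "cobd T m (subtopology Y V) W d"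
    have e: "?e \<in> carrier (hh n V W)"
      using cobd_closed[OF space_pair_sub[OF V W], of d m] d(1) Suc by (simp add: sub_sub W)
    have "z = ?j ?e"
      using cobd_natural[OF pVFW, of d m] d c(2) Suc by (simp add: sub_sub W FV)
    then have "x = ?j (?e \<oplus>\<^bsub>hh n V W\<^esub> y0)"
      using ind_add[OF pVFW e y0(1)] xz by simp
    moreover have "?e \<oplus>\<^bsub>hh n V W\<^esub> y0 \<in> carrier (hh n V W)"
      using abelian_group_coh[OF space_pair_sub[OF V W]] e y0(1)
      by (simp add: abelian_group.axioms(1) abelian_monoid.a_closed)
    ultimately show thesis using that by blast
  qed
qed

text \<open>The axiom removes an open set whose closure lies in the interior of F. Normality
  provides such an S that contains the part of the union outside U; what remains of the pair lies
  inside (U, \<open>U \<inter> F\<close>), so a class that vanishes there vanishes after an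
  injective restriction.\<close>

lemma open_excision_zero:
  assumes U: "openin Y U" and F: "openin Y F" and x: "x \<in> carrier (hh n (U \<union> F) F)"
    and x0: "res n U (U \<inter> F) (U \<union> F) F x = \<zero>\<^bsub>hh n U (U \<inter> F)\<^esub>"
  shows "x = \<zero>\<^bsub>hh n (U \<union> F) F\<^esub>"
proof -
  define W where "W = U \<union> F"
  have W: "W \<subseteq> topspace Y" "openin Y W" using U F openin_subset by (auto simp: W_def)
  let ?W = "subtopology Y W"
  have topW: "topspace ?W = W" using W by auto
  have UW: "openin ?W U" "openin ?W F"
    using U F W by (auto simp: openin_open_subtopology W_def)
  have "normal_space ?W"
    using Y metrizable_imp_normal_space metrizable_space_subtopology by blast
  moreover have "closedin ?W (W - U)" using UW(1) topW by (metis closedin_diff closedin_topspace)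
  moreover have "W - U \<subseteq> F" by (auto simp: W_def)
  ultimately obtain S where S: "openin ?W S" "W - U \<subseteq> S" "?W closure_of S \<subseteq> F"
    using UW(2) unfolding normal_space_alt by meson
  have "S \<subseteq> ?W closure_of S"
    by (rule closure_of_subset[OF openin_subset[OF S(1)]])
  have "bij_betw (ind T n (subtopology ?W (topspace ?W - S)) (F - S) ?W F id)
          (carrier (coh T n ?W F)) (carrier (coh T n (subtopology ?W (topspace ?W - S)) (F - S)))"
    by (rule excision) (use S UW W in \<open>auto simp: W_def interior_of_openin intro!: space_pair_sub\<close>)
  moreover have "subtopology ?W (topspace ?W - S) = subtopology Y (W - S)"
    unfolding topW by (rule sub_sub) auto
  ultimately have inj: "inj_on (res n (W - S) (F - S) W F) (carrier (hh n W F))"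
    by (simp add: bij_betw_def)
  have xW: "x \<in> carrier (hh n W F)" using x by (simp add: W_def)
  have WS: "W - S \<subseteq> U" "F - S \<subseteq> U \<inter> F" using S(2) by (auto simp: W_def)
  have "res n (W - S) (F - S) W F x = res n (W - S) (F - S) U (U \<inter> F) (res n U (U \<inter> F) W F x)"
    by (rule res_res[symmetric]) (use W WS xW in \<open>auto simp: W_def\<close>)
  also have "\<dots> = \<zero>\<^bsub>hh n (W - S) (F - S)\<^esub>"
    unfolding W_def x0 unfolding W_def[symmetric]
    by (rule ind_zero, rule pair_map_inclusion) (use Y W WS in \<open>auto simp: W_def\<close>)
  also have "\<dots> = res n (W - S) (F - S) W F \<zero>\<^bsub>hh n W F\<^esub>"
    by (rule ind_zero[symmetric], rule pair_map_inclusion) (use Y W WS in \<open>auto simp: W_def\<close>)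
  finally have "res n (W - S) (F - S) W F x = res n (W - S) (F - S) W F \<zero>\<^bsub>hh n W F\<^esub>" .
  moreover have "\<zero>\<^bsub>hh n W F\<^esub> \<in> carrier (hh n W F)"
    using abelian_group_coh[OF space_pair_sub[OF W(1), of F]]
    by (simp add: W_def abelian_group.axioms(1) abelian_monoid.zero_closed)
  ultimately show ?thesis
    using inj xW unfolding W_def by (metis inj_onD)
qed

end

end

section \<open>Exterior cohomology and the zero-divisor bound\<close>

lemma ext_nbhds_empty: "ext_nbhds \<E> {} = \<E>"
  by (simp add: ext_nbhds_def)

lemma ext_coh_eq: "ext_coh T n X \<E> = direct_limit \<E> (\<lambda>E. coh T n X E) (\<lambda>E E'. ind T n X E' X E id)"
  by (simp add: ext_coh_def ext_pair_coh_def ext_nbhds_empty)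

lemma ext_class_eq: "ext_class T n X \<E> E = dl_class \<E> (\<lambda>E. coh T n X E) (\<lambda>E E'. ind T n X E' X E id) E"
  by (rule ext) (simp add: ext_class_def ext_nbhds_empty)

lemma exterior_map_diag:
  assumes "externology X \<E>"
  shows "exterior_map X \<E> (prod_space X X) (prod_ext X \<E> X \<E>) diag"
  unfolding exterior_map_def
proof (intro conjI ballI)
  show c: "continuous_map X (prod_space X X) diag"
    using continuous_map_Pr[OF continuous_map_id continuous_map_id, of X] by (simp add: diag_def[abs_def])
  fix W assume W: "W \<in> prod_ext X \<E> X \<E>"
  then obtain E F where EF: "E \<in> \<E>" "F \<in> \<E>" "pt_times E F \<subseteq> W" and Wo: "openin (prod_space X X) W"
    unfolding prod_ext_def by blast
  have "E \<inter> F \<in> \<E>" "E \<subseteq> topspace X"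
    using assms EF openin_subset[of X E] unfolding externology_def by blast+
  moreover have "E \<inter> F \<subseteq> {x \<in> topspace X. diag x \<in> W}"
    using EF(3) \<open>E \<subseteq> topspace X\<close> by (auto simp: pt_times_def diag_def)
  moreover have "openin X {x \<in> topspace X. diag x \<in> W}"
    using openin_continuous_map_preimage[OF c Wo] .
  ultimately show "{x \<in> topspace X. diag x \<in> W} \<in> \<E>"
    using assms unfolding externology_def by blast
qed

text \<open>The supports of a product add up, and a class supported on the whole space vanishes.\<close>

definition supported :: "('a, 'r, 'c) cohomology_data \<Rightarrow> nat \<Rightarrow> 'a pt topology \<Rightarrow> 'a pt set set \<Rightarrow>
    'a pt set \<Rightarrow> ('a pt set \<times> 'c) set set" where
  "supported T n X \<E> A = {ext_class T n X \<E> E a | E a. E \<in> \<E> \<and> A \<subseteq> E \<and> a \<in> carrier (coh T n X E)}"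

section \<open>Operations on exterior classes in terms of representatives and supports\<close>

context ES_theory
begin

lemma pair_map_ext:
  assumes "metrizable_space X" "externology X \<E>" "E \<in> \<E>" "F \<in> \<E>" "F \<subseteq> E"
  shows "pair_map X F X E id"
proof -
  have "openin X E" "openin X F" using assms unfolding externology_def by blast+
  then show ?thesis
    using assms openin_subset by (auto simp: pair_map_def space_pair_def)
qed

lemma exterior_map_pair_map:
  assumes "metrizable_space X" "metrizable_space Y" "externology Y \<F>"
    and f: "exterior_map X \<E> Y \<F> f" and "F \<in> \<F>"
  shows "pair_map X {x \<in> topspace X. f x \<in> F} Y F f"
proof -
  have "openin Y F" using assms unfolding externology_def by blast
  then show ?thesis
    using assms openin_subset by (auto simp: pair_map_def space_pair_def exterior_map_def)
qed

text \<open>Two representatives of a class agree over a common smaller exterior set;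
  \<open>shrink\<close> shows that passing to such a set does not change the resulting
  class.\<close>

lemma ext_ind_class:
  assumes X: "metrizable_space X" "externology X \<E>" and Y: "metrizable_space Y" "externology Y \<F>"
    and f: "exterior_map X \<E> Y \<F> f" and F: "F \<in> \<F>" and a: "a \<in> carrier (coh T n Y F)"
  shows "ext_ind T n X \<E> Y \<F> f (ext_class T n Y \<F> F a) =
    ext_class T n X \<E> {x \<in> topspace X. f x \<in> F} (ind T n X {x \<in> topspace X. f x \<in> F} Y F f a)"
proof -
  interpret DX: direct_system \<E> "\<lambda>E. coh T n X E" "\<lambda>E E'. ind T n X E' X E id"
    by (rule direct_system_ext[OF X])
  interpret DY: direct_system \<F> "\<lambda>E. coh T n Y E" "\<lambda>E E'. ind T n Y E' Y E id"
    by (rule direct_system_ext[OF Y])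
  let ?p = "\<lambda>F. {x \<in> topspace X. f x \<in> F}"
  have pE: "?p F \<in> \<E>" if "F \<in> \<F>" for F using f that by (auto simp: exterior_map_def)
  note pm = exterior_map_pair_map[OF X(1) Y f]
  have shrink: "ext_class T n X \<E> (?p F) (ind T n X (?p F) Y F f a) =
      ext_class T n X \<E> (?p G) (ind T n X (?p G) Y G f (ind T n Y G Y F id a))"
    if F: "F \<in> \<F>" and a: "a \<in> carrier (coh T n Y F)" and G: "G \<in> \<F>" "G \<subseteq> F" for F G a
  proof -
    have sub: "?p G \<subseteq> ?p F" using G by auto
    have "ind T n X (?p G) Y G f (ind T n Y G Y F id a) = ind T n X (?p G) Y F f a"
      using ind_comp[OF pm[OF G(1)] pair_map_ext[OF Y F G] a] by simp
    also have "\<dots> = ind T n X (?p G) X (?p F) id (ind T n X (?p F) Y F f a)"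
      using ind_comp[OF pair_map_ext[OF X pE[OF F] pE[OF G(1)] sub] pm[OF F] a] by simp
    finally show ?thesis
      unfolding ext_class_eq
      using DX.cls_restrict[OF pE[OF F] ind_closed[OF pm[OF F] a] pE[OF G(1)] sub] by simp
  qed
  show ?thesis
    unfolding ext_ind_def
  proof (rule UN_const_eq)
    show "ext_class T n Y \<F> F a \<noteq> {}"
      using DY.self_in_cls[OF F a] unfolding ext_class_eq by blast
    fix q assume q: "q \<in> ext_class T n Y \<F> F a"
    obtain F' a' where q': "q = (F', a')" by (cases q)
    have m: "(F', a') \<in> DY.dcls F a" using q unfolding q' ext_class_eq .
    obtain G where G: "G \<in> \<F>" "G \<subseteq> F" "G \<subseteq> F'" "ind T n Y G Y F id a = ind T n Y G Y F' id a'"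
      using DY.in_clsD(6)[OF m] by blast
    show "(case q of (F, a) \<Rightarrow> ext_class T n X \<E> (?p F) (ind T n X (?p F) Y F f a)) =
        ext_class T n X \<E> (?p F) (ind T n X (?p F) Y F f a)"
      unfolding q' prod.case shrink[OF F a G(1,2)] shrink[OF DY.in_clsD(1,2)[OF m] G(1,3)] G(4) ..
  qed
qed

text \<open>The same comparison for two arguments: naturality of the cross product under shrinking
  both exterior sets makes the result independent of the representatives.\<close>

lemma ext_cross_class:
  assumes X: "metrizable_space X" "externology X \<E>" and Y: "metrizable_space Y" "externology Y \<F>"
    and E: "E \<in> \<E>" and a: "a \<in> carrier (coh T p X E)" and F: "F \<in> \<F>" and b: "b \<in> carrier (coh T q Y F)"
  shows "prod_sub X E Y F \<in> prod_ext X \<E> Y \<F>"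
    and "ext_cross T p q X \<E> Y \<F> (ext_class T p X \<E> E a) (ext_class T q Y \<F> F b) =
      ext_class T (p + q) (prod_space X Y) (prod_ext X \<E> Y \<F>) (prod_sub X E Y F) (cross T p q X E Y F a b)"
proof -
  let ?P = "prod_space X Y" and ?\<G> = "prod_ext X \<E> Y \<F>"
  have P: "metrizable_space ?P" "externology ?P ?\<G>"
    using metrizable_prod_space X Y externology_prod_ext by blast+
  interpret DX: direct_system \<E> "\<lambda>E. coh T p X E" "\<lambda>E E'. ind T p X E' X E id"
    by (rule direct_system_ext[OF X])
  interpret DY: direct_system \<F> "\<lambda>E. coh T q Y E" "\<lambda>E E'. ind T q Y E' Y E id"
    by (rule direct_system_ext[OF Y])
  interpret DP: direct_system ?\<G> "\<lambda>E. coh T (p + q) ?P E" "\<lambda>E E'. ind T (p + q) ?P E' ?P E id"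
    by (rule direct_system_ext[OF P])
  have Eo: "openin X E" if "E \<in> \<E>" for E using X that unfolding externology_def by blast
  have Fo: "openin Y F" if "F \<in> \<F>" for F using Y that unfolding externology_def by blast
  have mem: "prod_sub X E Y F \<in> ?\<G>" if "E \<in> \<E>" "F \<in> \<F>" for E F
  proof -
    have "pt_times E F \<subseteq> prod_sub X E Y F"
      using openin_subset[OF Fo[OF that(2)]] by (auto simp: prod_sub_def pt_times_def)
    then show ?thesis
      unfolding prod_ext_def using openin_prod_sub Eo Fo that by blast
  qed
  then show "prod_sub X E Y F \<in> ?\<G>" using E F by blast
  have shrink: "ext_class T (p + q) ?P ?\<G> (prod_sub X E Y F) (cross T p q X E Y F a b) =
      ext_class T (p + q) ?P ?\<G> (prod_sub X G Y G') (cross T p q X G Y G' (ind T p X G X E id a) (ind T q Y G' Y F id b))"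
    if E: "E \<in> \<E>" and a: "a \<in> carrier (coh T p X E)" and F: "F \<in> \<F>" and b: "b \<in> carrier (coh T q Y F)"
      and G: "G \<in> \<E>" "G \<subseteq> E" "G' \<in> \<F>" "G' \<subseteq> F" for E a F b G G'
  proof -
    let ?c = "cross T p q X E Y F a b"
    have c: "?c \<in> carrier (coh T (p + q) ?P (prod_sub X E Y F))"
      by (rule cross_closed) (use X Y Eo Fo E F a b in blast)+
    have sub: "prod_sub X G Y G' \<subseteq> prod_sub X E Y F"
      using G by (auto simp: prod_sub_def pt_times_def)
    have "cross T p q X G Y G' (ind T p X G X E id a) (ind T q Y G' Y F id b) =
        ind T (p + q) ?P (prod_sub X G Y G') ?P (prod_sub X E Y F) (pt_map_prod id id) ?c"
      by (rule cross_natural[OF pair_map_ext[OF X E G(1,2)] Eo[OF G(1)] Eo[OF E]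
            pair_map_ext[OF Y F G(3,4)] Fo[OF G(3)] Fo[OF F] a b])
    \<comment> \<open>\<open>pt_map_prod id id\<close> agrees with \<open>id\<close> on formal
      pairs, hence on the product space, but not on the points \<open>Pt x\<close>.\<close>
    also have "\<dots> = ind T (p + q) ?P (prod_sub X G Y G') ?P (prod_sub X E Y F) id ?c"
      by (rule ind_cong[symmetric, OF pair_map_ext[OF P mem[OF E F] mem[OF G(1,3)] sub] _ c])
        (auto simp: topspace_prod_space pt_times_def pt_map_prod_def)
    finally show ?thesis
      unfolding ext_class_eq using DP.cls_restrict[OF mem[OF E F] c mem[OF G(1,3)] sub] by simp
  qed
  show "ext_cross T p q X \<E> Y \<F> (ext_class T p X \<E> E a) (ext_class T q Y \<F> F b) =
      ext_class T (p + q) ?P ?\<G> (prod_sub X E Y F) (cross T p q X E Y F a b)"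
    unfolding ext_cross_def
  proof (rule UN_const_eq)
    show "ext_class T p X \<E> E a \<noteq> {}"
      using DX.self_in_cls[OF E a] unfolding ext_class_eq by blast
    fix u assume u: "u \<in> ext_class T p X \<E> E a"
    obtain E' a' where u': "u = (E', a')" by (cases u)
    have mu: "(E', a') \<in> DX.dcls E a" using u unfolding u' ext_class_eq .
    obtain G where G: "G \<in> \<E>" "G \<subseteq> E" "G \<subseteq> E'" "ind T p X G X E id a = ind T p X G X E' id a'"
      using DX.in_clsD(6)[OF mu] by blast
    show "(case u of (E, a) \<Rightarrow> \<Union>(F, b) \<in> ext_class T q Y \<F> F b.
        ext_class T (p + q) ?P ?\<G> (prod_sub X E Y F) (cross T p q X E Y F a b)) =
        ext_class T (p + q) ?P ?\<G> (prod_sub X E Y F) (cross T p q X E Y F a b)"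
      unfolding u' prod.case
    proof (rule UN_const_eq)
      show "ext_class T q Y \<F> F b \<noteq> {}"
        using DY.self_in_cls[OF F b] unfolding ext_class_eq by blast
      fix v assume v: "v \<in> ext_class T q Y \<F> F b"
      obtain F' b' where v': "v = (F', b')" by (cases v)
      have mv: "(F', b') \<in> DY.dcls F b" using v unfolding v' ext_class_eq .
      obtain G' where G': "G' \<in> \<F>" "G' \<subseteq> F" "G' \<subseteq> F'" "ind T q Y G' Y F id b = ind T q Y G' Y F' id b'"
        using DY.in_clsD(6)[OF mv] by blast
      show "(case v of (F, b) \<Rightarrow> ext_class T (p + q) ?P ?\<G> (prod_sub X E' Y F) (cross T p q X E' Y F a' b)) =
        ext_class T (p + q) ?P ?\<G> (prod_sub X E Y F) (cross T p q X E Y F a b)"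
        unfolding v' prod.case shrink[OF E a F b G(1,2) G'(1,2)]
          shrink[OF DX.in_clsD(1,2)[OF mu] DY.in_clsD(1,2)[OF mv] G(1,3) G'(1,3)] G(4) G'(4) ..
    qed
  qed
qed

lemma supported_cup:
  assumes X: "metrizable_space X" "externology X \<E>"
    and C: "C \<in> supported T p X \<E> A" and D: "D \<in> supported T q X \<E> B"
  shows "ext_cup T p q X \<E> C D \<in> supported T (p + q) X \<E> (A \<union> B)"
proof -
  obtain E a where E: "E \<in> \<E>" "A \<subseteq> E" "a \<in> carrier (coh T p X E)" "C = ext_class T p X \<E> E a"
    using C unfolding supported_def by blast
  obtain F b where F: "F \<in> \<E>" "B \<subseteq> F" "b \<in> carrier (coh T q X F)" "D = ext_class T q X \<E> F b"
    using D unfolding supported_def by blast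
  let ?P = "prod_space X X" and ?\<G> = "prod_ext X \<E> X \<E>"
  have P: "metrizable_space ?P" "externology ?P ?\<G>"
    using metrizable_prod_space X externology_prod_ext by blast+
  have Eo: "openin X E" "openin X F" using X E F unfolding externology_def by blast+
  let ?c = "cross T p q X E X F a b"
  have c: "?c \<in> carrier (coh T (p + q) ?P (prod_sub X E X F))"
    by (rule cross_closed) (use X Eo E F in blast)+
  note d = exterior_map_diag[OF X(2)]
  \<comment> \<open>This equality is the reason why supports add up: pulled back along the diagonal,
    the product of (X, E) and (X, F) becomes the pair of X and \<open>E \<union> F\<close>.\<close>
  have pre: "{x \<in> topspace X. diag x \<in> prod_sub X E X F} = E \<union> F"
    using openin_subset[OF Eo(1)] openin_subset[OF Eo(2)] by (auto simp: diag_def prod_sub_def pt_times_def)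
  note mem = ext_cross_class(1)[OF X X E(1,3) F(1,3)]
  have "ext_cup T p q X \<E> C D =
      ext_class T (p + q) X \<E> (E \<union> F) (ind T (p + q) X (E \<union> F) ?P (prod_sub X E X F) diag ?c)"
    unfolding ext_cup_def E(4) F(4) ext_cross_class(2)[OF X X E(1,3) F(1,3)]
    using ext_ind_class[OF X P d mem c] unfolding pre .
  moreover have "E \<union> F \<in> \<E>"
    using d mem unfolding exterior_map_def pre[symmetric] by blast
  moreover have "ind T (p + q) X (E \<union> F) ?P (prod_sub X E X F) diag ?c \<in> carrier (coh T (p + q) X (E \<union> F))"
    using ind_closed[OF exterior_map_pair_map[OF X(1) P d mem] c] unfolding pre .
  ultimately show ?thesis
    unfolding supported_def using E(2) F(2) by blast
qed

text \<open>Each degree of a total cup product is a sum over the splittings of that degree. Sums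
  keep the support because two representatives can be restricted to the intersection of their
  exterior sets, which still contains A.\<close>

lemma supported_finsum:
  assumes X: "metrizable_space X" "externology X \<E>" and A: "A \<subseteq> topspace X"
    and I: "finite I" and f: "\<And>i. i \<in> I \<Longrightarrow> f i \<in> supported T n X \<E> A"
  shows "finsum (ext_coh T n X \<E>) f I \<in> supported T n X \<E> A"
proof -
  interpret D: direct_system \<E> "\<lambda>E. coh T n X E" "\<lambda>E E'. ind T n X E' X E id"
    by (rule direct_system_ext[OF X])
  interpret abelian_monoid D.dlim by (rule D.abelian_monoid_dlim)
  have "finsum D.dlim f I \<in> supported T n X \<E> A"
  proof (rule finsum_in[OF I])
    show "supported T n X \<E> A \<subseteq> carrier D.dlim"
      using D.cls_in_dlim unfolding supported_def ext_class_eq by blast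
    obtain E where "E \<in> \<E>" using D.ne by blast
    then have top: "topspace X \<in> \<E>"
      using X(2) openin_subset unfolding externology_def by blast
    have "\<zero>\<^bsub>coh T n X (topspace X)\<^esub> \<in> carrier (coh T n X (topspace X))"
      using D.group[OF top] by (simp add: abelian_group.axioms(1) abelian_monoid.zero_closed)
    then show "\<zero>\<^bsub>D.dlim\<^esub> \<in> supported T n X \<E> A"
      unfolding supported_def ext_class_eq D.zero_cls[OF top] using top A by blast
    fix x y assume "x \<in> supported T n X \<E> A" "y \<in> supported T n X \<E> A"
    then obtain E a F b where E: "E \<in> \<E>" "A \<subseteq> E" "a \<in> carrier (coh T n X E)" "x = D.dcls E a"
      and F: "F \<in> \<E>" "A \<subseteq> F" "b \<in> carrier (coh T n X F)" "y = D.dcls F b"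
      unfolding supported_def ext_class_eq by blast
    define G where "G = E \<inter> F"
    have G: "G \<in> \<E>" "G \<subseteq> E" "G \<subseteq> F" "A \<subseteq> G"
      using X(2) E F unfolding externology_def G_def by blast+
    let ?a = "ind T n X G X E id a" and ?b = "ind T n X G X F id b"
    have ab: "?a \<in> carrier (coh T n X G)" "?b \<in> carrier (coh T n X G)"
      using D.closed[OF E(1) G(1,2) E(3)] D.closed[OF F(1) G(1,3) F(3)] by auto
    have "x \<oplus>\<^bsub>D.dlim\<^esub> y = D.dcls G (?a \<oplus>\<^bsub>coh T n X G\<^esub> ?b)"
      unfolding E(4) F(4) D.cls_restrict[OF E(1,3) G(1,2), symmetric] D.cls_restrict[OF F(1,3) G(1,3), symmetric]
      by (rule D.add_cls[OF G(1) ab])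
    moreover have "?a \<oplus>\<^bsub>coh T n X G\<^esub> ?b \<in> carrier (coh T n X G)"
      using D.group[OF G(1)] ab by (simp add: abelian_group.axioms(1) abelian_monoid.a_closed)
    ultimately show "x \<oplus>\<^bsub>D.dlim\<^esub> y \<in> supported T n X \<E> A"
      unfolding supported_def ext_class_eq using G by blast
  qed (use f in blast)
  then show ?thesis by (simp add: ext_coh_eq)
qed

lemma supported_total_cup:
  assumes X: "metrizable_space X" "externology X \<E>" and AB: "A \<subseteq> topspace X" "B \<subseteq> topspace X"
    and u: "\<And>n. u n \<in> supported T n X \<E> A" and v: "\<And>n. v n \<in> supported T n X \<E> B"
  shows "total_cup T X \<E> u v n \<in> supported T n X \<E> (A \<union> B)"
  unfolding total_cup_def
proof (rule supported_finsum[OF X])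
  fix p assume "p \<in> {..n}"
  then show "ext_cup T p (n - p) X \<E> (u p) (v (n - p)) \<in> supported T n X \<E> (A \<union> B)"
    using supported_cup[OF X u[of p] v[of "n - p"]] by simp
qed (use AB in auto)

text \<open>An exterior set containing the whole space is the whole space, and
  \<open>coh_self_zero\<close> kills every class relative to it.\<close>

lemma supported_topspace:
  assumes X: "metrizable_space X" "externology X \<E>" and C: "C \<in> supported T n X \<E> (topspace X)"
  shows "C = \<zero>\<^bsub>ext_coh T n X \<E>\<^esub>"
proof -
  interpret D: direct_system \<E> "\<lambda>E. coh T n X E" "\<lambda>E E'. ind T n X E' X E id"
    by (rule direct_system_ext[OF X])
  obtain E a where E: "E \<in> \<E>" "topspace X \<subseteq> E" "a \<in> carrier (coh T n X E)" "C = ext_class T n X \<E> E a"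
    using C unfolding supported_def by blast
  have "openin X E" using X(2) E(1) unfolding externology_def by blast
  then have eq: "E = topspace X" using E(2) openin_subset by blast
  have "a = \<zero>\<^bsub>coh T n X E\<^esub>"
    using coh_self_zero[OF X(1) order_refl, of a n] E(3) unfolding eq by simp
  then show ?thesis
    unfolding ext_coh_eq D.zero_cls[OF E(1)] E(4) ext_class_eq by simp
qed

text \<open>Over \<open>U\<close> the planner deforms the identity into the diagonal of the first coordinate, within
  the exterior set \<open>E \<times> E\<close> for pairs of points close to infinity. Hence a class that
  vanishes on the diagonal vanishes on \<open>U\<close>, and by exactness it lifts to a class relative to an
  exterior set containing \<open>U\<close>.\<close>

lemma kernel_supported:
  fixes X :: "'a pt topology"
  defines "Y \<equiv> prod_space X X" and "\<E> \<equiv> cocompact X"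
  defines "\<F> \<equiv> prod_ext X \<E> X \<E>"
  assumes X: "metrizable_space X" and U: "openin (prod_topology X X) U" and h: "proper_planner X U h"
    and C: "C \<in> carrier (ext_coh T n Y \<F>)"
    and C0: "ext_ind T n X \<E> Y \<F> diag C = \<zero>\<^bsub>ext_coh T n X \<E>\<^esub>"
  shows "C \<in> supported T n Y \<F> ((\<lambda>(x, y). Pr x y) ` U)"
proof -
  have EX: "externology X \<E>" unfolding \<E>_def by (rule externology_cocompact)
  have Y: "metrizable_space Y" "externology Y \<F>"
    using metrizable_prod_space X EX externology_prod_ext unfolding Y_def \<F>_def by blast+
  have d: "exterior_map X \<E> Y \<F> diag"
    unfolding Y_def \<F>_def by (rule exterior_map_diag[OF EX])
  interpret DX: direct_system \<E> "\<lambda>E. coh T n X E" "\<lambda>E E'. ind T n X E' X E id"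
    by (rule direct_system_ext[OF X EX])
  interpret DY: direct_system \<F> "\<lambda>E. coh T n Y E" "\<lambda>E E'. ind T n Y E' Y E id"
    by (rule direct_system_ext[OF Y])
  obtain W a where W: "W \<in> \<F>" and a: "a \<in> carrier (coh T n Y W)" and Ca: "C = DY.dcls W a"
    using C unfolding ext_coh_eq DY.carrier_dlim by blast
  define E1 where "E1 = {x \<in> topspace X. diag x \<in> W}"
  have E1: "E1 \<in> \<E>" using d W by (auto simp: exterior_map_def E1_def)
  have pd: "pair_map X E1 Y W diag"
    unfolding E1_def by (rule exterior_map_pair_map[OF X Y d W])
  let ?da = "ind T n X E1 Y W diag a"
  have da: "?da \<in> carrier (coh T n X E1)" by (rule ind_closed[OF pd a])
  have z: "\<zero>\<^bsub>coh T n X E1\<^esub> \<in> carrier (coh T n X E1)"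
    using DX.group[OF E1] by (simp add: abelian_group.axioms(1) abelian_monoid.zero_closed)
  have "DX.dcls E1 ?da = DX.dcls E1 \<zero>\<^bsub>coh T n X E1\<^esub>"
    using C0 ext_ind_class[OF X EX Y d W a]
    unfolding Ca ext_class_eq ext_coh_eq DX.zero_cls[OF E1] E1_def[symmetric] by simp
  \<comment> \<open>A class is zero in the limit exactly when it is zero over some smaller exterior
    set.\<close>
  then obtain E0 where E0: "E0 \<in> \<E>" "E0 \<subseteq> E1"
    "ind T n X E0 X E1 id ?da = ind T n X E0 X E1 id \<zero>\<^bsub>coh T n X E1\<^esub>"
    unfolding DX.cls_eq_iff[OF E1 da E1 z] by blast
  obtain E2 E3 where E23: "E2 \<in> \<E>" "E3 \<in> \<E>" "pt_times E2 E3 \<subseteq> W"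
    using W unfolding \<F>_def prod_ext_def by blast
  \<comment> \<open>Inside E0 the pullback of a along the diagonal vanishes; inside E2 and E3 the
    square of E lies in W, where the homotopy below has to stay.\<close>
  define E where "E = E0 \<inter> (E2 \<inter> E3)"
  have E: "E \<in> \<E>" using E0(1) E23(1,2) EX unfolding externology_def E_def by blast
  have EE1: "E \<subseteq> E1" using E0(2) by (auto simp: E_def)
  have EW: "pt_times E E \<subseteq> W" using E23(3) by (auto simp: E_def pt_times_def)
  have pdE: "pair_map X E Y W diag"
    using pd E EE1 order_trans[OF image_mono[OF EE1]] unfolding pair_map_def space_pair_def by blast
  have "ind T n X E Y W diag a = ind T n X E X E1 id ?da"
    using ind_comp[OF pair_map_ext[OF X EX E1 E EE1] pd a] by simp
  also have "\<dots> = ind T n X E X E0 id (ind T n X E0 X E1 id ?da)"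
    using DX.compose[OF E1 E0(1) E _ E0(2) da] by (simp add: E_def)
  also have "\<dots> = \<zero>\<^bsub>coh T n X E\<^esub>"
    unfolding E0(3) ind_zero[OF pair_map_ext[OF X EX E1 E0(1,2)]]
    by (rule ind_zero[OF pair_map_ext[OF X EX E0(1) E]]) (auto simp: E_def)
  finally have diag0: "ind T n X E Y W diag a = \<zero>\<^bsub>coh T n X E\<^esub>" .
  obtain K where K: "E = topspace X - K" "compactin X K"
    using E unfolding \<E>_def cocompact_def by blast
  have "proper_track X U h" using h by (simp add: proper_planner_iff_track)
  from proper_trackE[OF this K(2)] obtain L where L: "compactin X L" "K \<subseteq> L"
    "\<And>p t. \<lbrakk>p \<in> U; t \<in> {0..1}; fst p \<notin> L; snd p \<notin> L\<rbrakk> \<Longrightarrow> h (p, t) \<notin> K" by metis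
  \<comment> \<open>L is assigned by the planner to the complement K of E, so a planned path between
    two points of D never leaves E.\<close>
  define D where "D = topspace X - L"
  have "closedin X L"
    using L(1) X metrizable_imp_Hausdorff_space compactin_imp_closedin by blast
  then have D: "D \<in> \<E>" "openin X D"
    using L(1) unfolding \<E>_def cocompact_def D_def by blast+
  have DE: "D \<subseteq> E" using L(2) K(1) by (auto simp: D_def)
  define F where "F = pt_times D D"
  have Fo: "openin Y F" unfolding F_def Y_def by (rule openin_pt_times[OF D(2,2)])
  have F: "F \<in> \<F>" using Fo D(1) unfolding \<F>_def prod_ext_def F_def Y_def by blast
  have FW: "F \<subseteq> W" using EW DE by (auto simp: F_def pt_times_def)
  define V where "V = (\<lambda>(x, y). Pr x y) ` U"
  have Vo: "openin Y V" unfolding V_def Y_def by (rule openin_image_Pr[OF U])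
  have VF: "V \<subseteq> topspace Y" "F \<subseteq> topspace Y" using Vo Fo openin_subset by blast+
  have U': "U \<subseteq> topspace X \<times> topspace X" using openin_prod_subset[OF U] .
  let ?V = "subtopology Y V"
  have "openin Y W" using Y(2) W unfolding externology_def by blast
  then have Wsub: "W \<subseteq> topspace Y" by (rule openin_subset)
  have pi1: "continuous_map ?V X pt1"
    unfolding Y_def by (intro continuous_map_from_subtopology continuous_map_prod_space_projections)
  have hc: "continuous_map (prod_topology (subtopology (prod_topology X X) U) unit_interval) X h"
    using h by (simp add: proper_planner_def planner_def)
  have hom: "homotopic_with (\<lambda>k. k ` (V \<inter> F) \<subseteq> W) ?V Y id (diag \<circ> pt1)"
  proof (subst homotopic_with)
    fix k k' :: "'a pt \<Rightarrow> 'a pt" assume "\<And>x. x \<in> topspace ?V \<Longrightarrow> k x = k' x"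
    moreover have "x \<in> topspace ?V" if "x \<in> V \<inter> F" for x using VF that by auto
    ultimately have "k ` (V \<inter> F) = k' ` (V \<inter> F)" by (intro image_cong refl) blast
    then show "(k ` (V \<inter> F) \<subseteq> W) = (k' ` (V \<inter> F) \<subseteq> W)" by simp
  next
    let ?Q = "prod_topology unit_interval ?V"
    \<comment> \<open>The first coordinate stays fixed while the second runs back along its path,
      with time reversed so that the homotopy starts at the identity and ends on the
      diagonal.\<close>
    let ?G = "\<lambda>q. Pr (pt1 (snd q)) (h ((pt1 (snd q), pt2 (snd q)), 1 - fst q))"
    have c2: "continuous_map ?Q ?V snd" by (rule continuous_map_snd)
    have "continuous_map ?V (prod_topology X X) (\<lambda>p. (pt1 p, pt2 p))"
      using pi1 continuous_map_prod_space_projections(2)[of X X]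
      by (simp add: continuous_map_pairwise o_def Y_def continuous_map_from_subtopology)
    then have "continuous_map ?V (subtopology (prod_topology X X) U) (\<lambda>p. (pt1 p, pt2 p))"
      by (auto simp: continuous_map_in_subtopology V_def)
    from continuous_map_compose[OF c2 this]
    have g1: "continuous_map ?Q (subtopology (prod_topology X X) U) (\<lambda>q. (pt1 (snd q), pt2 (snd q)))"
      by (simp add: o_def)
    have "continuous_map ?Q euclideanreal fst"
      using continuous_map_fst continuous_map_in_subtopology by blast
    then have "continuous_map ?Q unit_interval (\<lambda>q. 1 - fst q)"
      by (auto simp: continuous_map_in_subtopology intro!: continuous_intros)
    with g1 have "continuous_map ?Q (prod_topology (subtopology (prod_topology X X) U) unit_interval)
        (\<lambda>q. ((pt1 (snd q), pt2 (snd q)), 1 - fst q))"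
      by (simp add: continuous_map_pairwise[of _ "subtopology (prod_topology X X) U"] o_def)
    from continuous_map_compose[OF this hc] continuous_map_compose[OF c2 pi1]
    have G: "continuous_map ?Q Y ?G"
      unfolding Y_def o_def by (intro continuous_map_Pr)
    have ends: "\<forall>x\<in>topspace ?V. ?G (0, x) = id x" "\<forall>x\<in>topspace ?V. ?G (1, x) = (diag \<circ> pt1) x"
      using h by (auto simp: V_def proper_planner_iff_track diag_def)
    have "(\<lambda>x. ?G (t, x)) ` (V \<inter> F) \<subseteq> W" if t: "t \<in> {0..1}" for t
    proof clarify
      fix p assume p: "p \<in> V" "p \<in> F"
      obtain x y where xy: "p = Pr x y" "(x, y) \<in> U" "x \<in> D" "y \<in> D"
        using p by (auto simp: V_def F_def pt_times_def)
      have t': "1 - t \<in> {0..1}" using t by auto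
      have "h ((x, y), 1 - t) \<notin> K"
        using L(3)[OF xy(2) t'] xy(3,4) by (auto simp: D_def)
      moreover have "h ((x, y), 1 - t) \<in> topspace X"
        using continuous_map_funspace[OF hc] xy(2) t' U' by (auto simp: Pi_iff)
      ultimately have "Pr x (h ((x, y), 1 - t)) \<in> pt_times E E"
        using xy(3) DE K(1) by (auto simp: pt_times_def)
      then show "?G (t, p) \<in> W" using EW by (auto simp: xy(1))
    qed
    then show "\<exists>G. continuous_map ?Q Y G \<and> (\<forall>x\<in>topspace ?V. G (0, x) = id x) \<and>
        (\<forall>x\<in>topspace ?V. G (1, x) = (diag \<circ> pt1) x) \<and> (\<forall>t\<in>{0..1}. (\<lambda>x. G (t, x)) ` (V \<inter> F) \<subseteq> W)"
      using G ends by blast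
  qed
  have spV: "space_pair ?V (V \<inter> F)" and spW: "space_pair Y W"
    using Y(1) VF Wsub by (auto simp: space_pair_def metrizable_space_subtopology)
  have p1: "pair_map ?V (V \<inter> F) X E pt1"
    using spV X pi1 DE K(1) by (auto simp: pair_map_def space_pair_def F_def pt_times_def)
  have "ind T n ?V (V \<inter> F) Y W id a = ind T n ?V (V \<inter> F) Y W (diag \<circ> pt1) a"
    by (rule homotopy_invariance[OF spV spW hom a])
  also have "\<dots> = ind T n ?V (V \<inter> F) X E pt1 (ind T n X E Y W diag a)"
    by (rule ind_comp[OF p1 pdE a])
  also have "\<dots> = \<zero>\<^bsub>coh T n ?V (V \<inter> F)\<^esub>"
    unfolding diag0 by (rule ind_zero[OF p1])
  finally have V0: "ind T n ?V (V \<inter> F) Y W id a = \<zero>\<^bsub>coh T n ?V (V \<inter> F)\<^esub>" .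
  let ?x = "ind T n Y F Y W id a"
  have pFW: "pair_map Y F Y W id" by (rule pair_map_ext[OF Y W F FW])
  have x: "?x \<in> carrier (coh T n Y F)" by (rule ind_closed[OF pFW a])
  \<comment> \<open>Excision transfers the vanishing from (V, \<open>V \<inter> F\<close>) to the
    pair of \<open>V \<union> F\<close> and F, which fits into a triple with Y.\<close>
  let ?Z = "subtopology Y (V \<union> F)"
  have top: "subtopology Y (topspace Y) = Y" by simp
  have pZ: "pair_map ?Z F Y F id" and pVZ: "pair_map ?V (V \<inter> F) ?Z F id"
    using pair_map_inclusion[OF Y(1), of "topspace Y" "V \<union> F" F F]
      pair_map_inclusion[OF Y(1), of "V \<union> F" V "V \<inter> F" F] VF by simp_all
  let ?x' = "ind T n ?Z F Y F id ?x"
  have x': "?x' \<in> carrier (coh T n ?Z F)" by (rule ind_closed[OF pZ x])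
  have pZW: "pair_map ?Z F Y W id"
    using pZ spW FW by (auto simp: pair_map_def)
  have "ind T n ?V (V \<inter> F) ?Z F id ?x' = ind T n ?V (V \<inter> F) ?Z F id (ind T n ?Z F Y W id a)"
    using ind_comp[OF pZ pFW a] by simp
  also have "\<dots> = \<zero>\<^bsub>coh T n ?V (V \<inter> F)\<^esub>"
    using ind_comp[OF pVZ pZW a] V0 by simp
  finally have "?x' = \<zero>\<^bsub>coh T n ?Z F\<^esub>"
    by (rule open_excision_zero[OF Y(1) Vo Fo x'])
  then obtain y where y: "y \<in> carrier (coh T n Y (V \<union> F))" "?x = ind T n Y F Y (V \<union> F) id y"
    using triple_exactness[OF Y(1) order_refl, of "V \<union> F" F ?x n] x VF unfolding top by auto
  \<comment> \<open>V alone need not be exterior; the union is, because it contains F.\<close>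
  have Z: "V \<union> F \<in> \<F>"
  proof -
    have "openin Y (V \<union> F)" using Vo Fo by (rule openin_Un)
    moreover have "F \<subseteq> V \<union> F" by blast
    ultimately show ?thesis using Y(2) F unfolding externology_def by blast
  qed
  have "C = DY.dcls F ?x" unfolding Ca using DY.cls_restrict[OF W a F FW] by simp
  also have "\<dots> = DY.dcls (V \<union> F) y"
    unfolding y(2) by (rule DY.cls_restrict[OF Z y(1) F]) simp
  finally show ?thesis
    unfolding supported_def ext_class_eq V_def[symmetric] using Z y(1) by blast
qed

text \<open>Every kernel class is supported on each of the sets \<open>V i\<close>, so the i-th
  factor of a product can be assigned to \<open>V i\<close>, and n + 1 factors exhaust the
  cover.\<close>

lemma nil_ker_le:
  fixes X :: "'a pt topology"
  assumes X: "metrizable_space X"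
  shows "nil_ker T X (cocompact X) (prod_space X X) (prod_ext X (cocompact X) X (cocompact X)) diag \<le> p_TC X"
proof (cases "p_TC X")
  case (enat n)
  then obtain U where U: "proper_planners X n U" by (rule p_TC_eq_enatE)
  define Y where "Y = prod_space X X"
  define \<F> where "\<F> = prod_ext X (cocompact X) X (cocompact X)"
  have Y: "metrizable_space Y" "externology Y \<F>"
    using metrizable_prod_space X externology_cocompact externology_prod_ext unfolding Y_def \<F>_def by blast+
  \<comment> \<open>Capping the index at n gives every factor of a product of arbitrary length a
    set, which keeps the induction on the number of factors uniform.\<close>
  define V where "V i = (\<lambda>(x, y). Pr x y) ` U (min i n)" for i
  have Vsub: "V i \<subseteq> topspace Y" for i
  proof -
    have "openin Y (V i)"
      unfolding V_def Y_def using U by (intro openin_image_Pr) (simp add: proper_planners_def)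
    then show ?thesis by (rule openin_subset)
  qed
  let ?ker = "ker_ext_ind T X (cocompact X) Y \<F> diag"
  have sup: "w k \<in> supported T k Y \<F> (V i)" if "w \<in> ?ker" for w k i
  proof -
    have "min i n \<le> n" by simp
    then obtain h where "proper_planner X (U (min i n)) h" and o: "openin (prod_topology X X) (U (min i n))"
      using U unfolding proper_planners_def by blast
    from kernel_supported[OF X o this(1), of "w k" k] that show ?thesis
      by (simp add: ker_ext_ind_def total_ext_coh_def V_def Y_def \<F>_def)
  qed
  have prod: "foldl (total_cup T Y \<F>) u us k \<in> supported T k Y \<F> (\<Union>i\<le>length us. V i)"
    if "set (u # us) \<subseteq> ?ker" for u us k
    using that
  proof (induction us arbitrary: k rule: rev_induct)
    case Nil
    then show ?case using sup[of u k 0] by simp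
  next
    case (snoc v us)
    have "total_cup T Y \<F> (foldl (total_cup T Y \<F>) u us) v k \<in>
        supported T k Y \<F> ((\<Union>i\<le>length us. V i) \<union> V (Suc (length us)))"
      using snoc Vsub by (intro supported_total_cup[OF Y] sup) auto
    moreover have "(\<Union>i\<le>length us. V i) \<union> V (Suc (length us)) = (\<Union>i\<le>length (us @ [v]). V i)"
      by (auto simp: atMost_Suc)
    ultimately show ?case by simp
  qed
  have "enat (Suc (length us)) \<le> enat n"
    if us: "set (u # us) \<subseteq> ?ker" and nz: "foldl (total_cup T Y \<F>) u us k \<noteq> \<zero>\<^bsub>ext_coh T k Y \<F>\<^esub>" for u us k
  proof (rule ccontr)
    assume "\<not> enat (Suc (length us)) \<le> enat n"
    \<comment> \<open>The initial factor u is counted besides \<open>us\<close>, so more than n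
      factors make the sets V 0 to V (\<open>length us\<close>) include the whole cover.\<close>
    then have len: "n \<le> length us" by simp
    have "topspace Y \<subseteq> (\<Union>i\<le>length us. V i)"
    proof
      fix p assume "p \<in> topspace Y"
      then obtain x y where p: "p = Pr x y" "(x, y) \<in> topspace X \<times> topspace X"
        by (auto simp: Y_def topspace_prod_space pt_times_def)
      then obtain i where i: "i \<le> n" "(x, y) \<in> U i"
        using U unfolding proper_planners_def by blast
      then have "p \<in> V i" unfolding V_def p(1) by (force simp: min_absorb1)
      then show "p \<in> (\<Union>i\<le>length us. V i)" using i(1) len by auto
    qed
    then have "(\<Union>i\<le>length us. V i) = topspace Y" using Vsub by blast
    then have "foldl (total_cup T Y \<F>) u us k = \<zero>\<^bsub>ext_coh T k Y \<F>\<^esub>"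
      using supported_topspace[OF Y] prod[OF us] by metis
    then show False using nz by blast
  qed
  then have "nil_ker T X (cocompact X) Y \<F> diag \<le> enat n"
    unfolding nil_ker_def by (intro Sup_least) blast
  then show ?thesis by (simp add: enat Y_def \<F>_def)
qed simp

end

theorem theorem3p6:
  shows
    "\<comment> \<open>(i)\<close>
     (\<forall>(X :: 'a topology) (Y :: 'b topology).
        metrizable_space X \<and> metrizable_space Y \<and> properly_homotopy_equivalent X Y \<longrightarrow>
        p_TC X = p_TC Y) \<and>
     \<comment> \<open>(ii)\<close>
     (\<forall>X :: 'a topology. metrizable_space X \<longrightarrow>
        TC X \<le> p_TC X \<and> (compact_space X \<longrightarrow> TC X = p_TC X)) \<and>
     \<comment> \<open>(iii)\<close>
     (\<forall>X :: 'a topology. metrizable_space X \<longrightarrow>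
        (properly_homotopy_equivalent X halfline \<longrightarrow> p_TC X = 0) \<and>
        (P_infinity X \<and> p_TC X = 0 \<longrightarrow> properly_homotopy_equivalent X halfline)) \<and>
     \<comment> \<open>(iv)\<close>
     (\<forall>(X :: 'a topology) \<alpha>. metrizable_space X \<and> P_infinity X \<and> ray X \<alpha> \<longrightarrow>
        p_cat \<alpha> X \<le> p_TC X \<and> p_TC X \<le> 2 * p_cat \<alpha> X) \<and>
     \<comment> \<open>(v)\<close>
     (\<forall>(X :: 'a topology) (H :: ('a, 'r, 'c) cohomology_data).
        metrizable_space X \<and> ES_theory H \<longrightarrow>
        nil_ker H
          (lift_space X) (cocompact (lift_space X))
          (prod_space (lift_space X) (lift_space X))
          (prod_ext (lift_space X) (cocompact (lift_space X))
                    (lift_space X) (cocompact (lift_space X)))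
          diag \<le> p_TC X)"
proof (intro conjI allI impI; (elim conjE)?)
  fix X :: "'a topology" and Y :: "'b topology"
  assume "properly_homotopy_equivalent X Y"
  then show "p_TC X = p_TC Y" by (rule p_TC_properly_homotopy_equivalent)
next
  fix X :: "'a topology"
  show "TC X \<le> p_TC X" by (rule TC_le_p_TC)
next
  fix X :: "'a topology"
  assume "compact_space X"
  then show "TC X = p_TC X" by (rule TC_eq_p_TC_compact)
next
  fix X :: "'a topology"
  assume "properly_homotopy_equivalent X halfline"
  from p_TC_properly_homotopy_equivalent[OF this] show "p_TC X = 0"
    by (simp add: p_TC_halfline)
next
  fix X :: "'a topology"
  assume "metrizable_space X" "P_infinity X" "p_TC X = 0"
  then show "properly_homotopy_equivalent X halfline"
    by (intro p_TC_zero_imp_halfline metrizable_imp_normal_space)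
next
  fix X :: "'a topology" and \<alpha>
  assume "metrizable_space X" "P_infinity X" "ray X \<alpha>"
  then show "p_cat \<alpha> X \<le> p_TC X"
    by (intro p_cat_le_p_TC metrizable_imp_normal_space)
next
  fix X :: "'a topology" and \<alpha>
  assume "metrizable_space X" "ray X \<alpha>"
  then show "p_TC X \<le> 2 * p_cat \<alpha> X"
    by (intro p_TC_le_twice_p_cat metrizable_imp_normal_space)
next
  fix X :: "'a topology" and H :: "('a, 'r, 'c) cohomology_data"
  assume X: "metrizable_space X" and H: "ES_theory H"
  show "nil_ker H (lift_space X) (cocompact (lift_space X)) (prod_space (lift_space X) (lift_space X))
      (prod_ext (lift_space X) (cocompact (lift_space X)) (lift_space X) (cocompact (lift_space X)))
      diag \<le> p_TC X"
    using ES_theory.nil_ker_le[OF H metrizable_lift_space[OF X]] by (simp add: p_TC_lift_space)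
qed

end
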